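(* Let $r \ge 2$ and let $F_1,\ldots,F_r$ be $k$-uniform hypergraphs, each with at least one edge, such that $m_k(F_1)\ge m_k(F_2)\ge \cdots \ge m_k(F_r)$ and $F_1$ is strictly balanced with respect to $m_k(\cdot,F_2)$. Then there exists a constant $C>0$ such that for $p \ge C n^{-1/m_k(F_1,F_2)}$ we have $$\lim_{n\to\infty}\Pr[H^k(n,p)\rightarrow (F_1,\ldots,F_r)] = 1.$$
   Context: $H^k(n,p)$ is the random $k$-uniform hypergraph on $n$ vertices in which each $k$-element subset is an edge independently with probability $p$. $G\rightarrow(F_1,\ldots,F_r)$ means that for every colouring of the edges of $G$ with colours $1,\ldots,r$ there is some $i$ and a copy of $F_i$ in $G$ all of whose edges have colour $i$. For a $k$-uniform hypergraph $G$: $d_k(G)=0$ if $e(G)=0$, $d_k(G)=1/k$ if $e(G)=1$ and $v(G)=k$, and $d_k(G)=\frac{e(G)-1}{v(G)-k}$ otherwise; $m_k(G)=\max_{H\subseteq G}d_k(H)$. For $k$-uniform $F_1,F_2$ with at least one edge and $m_k(F_1)\ge m_k(F_2)$, the asymmetric $k$-density is $$m_k(F_1,F_2)=\max\left\{\frac{e(F_1')}{v(F_1')-k+1/m_k(F_2)} : F_1'\subseteq F_1,\ e(F_1')\ge 1\right\}.$$ $F_1$ is strictly balanced with respect to $m_k(\cdot,F_2)$ if no proper subhypergraph $F_1'\subsetneq F_1$ with at least one edge attains this maximum.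
   Formalization: The formal theorem additionally assumes that two distinct edges of F_2 share a vertex; without this the claim fails, e.g. for F_1=F_2=K_2 (k=2), where at p=Cn^{-2} the random graph has no edge with probability tending to e^{-C/2}. *)

theory Defs
  imports "HOL-Probability.Probability"
begin

datatype 'a hypergraph = Hypergraph (verts: "'a set") (edges: "'a set set")

definition uniform_hypergraph :: "nat \<Rightarrow> 'a hypergraph \<Rightarrow> bool" where
  "uniform_hypergraph k G \<longleftrightarrow>
     finite (verts G) \<and> (\<forall>e\<in>edges G. e \<subseteq> verts G \<and> card e = k)"

definition subhypergraph :: "'a hypergraph \<Rightarrow> 'a hypergraph \<Rightarrow> bool" where
  "subhypergraph H G \<longleftrightarrow>
     verts H \<subseteq> verts G \<and> edges H \<subseteq> edges G \<and> (\<forall>e\<in>edges H. e \<subseteq> verts H)"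

definition hypergraph_iso :: "'a hypergraph \<Rightarrow> 'b hypergraph \<Rightarrow> bool" where
  "hypergraph_iso F H \<longleftrightarrow>
     (\<exists>\<phi>. bij_betw \<phi> (verts F) (verts H) \<and> (\<lambda>e. \<phi> ` e) ` edges F = edges H)"

definition k_dens :: "nat \<Rightarrow> 'a hypergraph \<Rightarrow> real" where
  "k_dens k G =
     (if card (edges G) = 0 then 0
      else if card (edges G) = 1 \<and> card (verts G) = k then 1 / real k
      else (real (card (edges G)) - 1) / (real (card (verts G)) - real k))"

definition max_k_dens :: "nat \<Rightarrow> 'a hypergraph \<Rightarrow> real" where
  "max_k_dens k G = Max (k_dens k ` {H. subhypergraph H G})"

text \<open>The quantity whose maximum over subhypergraphs of \<open>F\<^sub>1\<close> is the asymmetric density;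
  its first hypergraph argument plays the role of the subhypergraph.\<close>

definition asym_dens :: "nat \<Rightarrow> 'a hypergraph \<Rightarrow> 'b hypergraph \<Rightarrow> real" where
  "asym_dens k H F2 =
     real (card (edges H)) / (real (card (verts H)) - real k + 1 / max_k_dens k F2)"

definition max_asym_dens :: "nat \<Rightarrow> 'a hypergraph \<Rightarrow> 'b hypergraph \<Rightarrow> real" where
  "max_asym_dens k F1 F2 =
     Max ((\<lambda>H. asym_dens k H F2) ` {H. subhypergraph H F1 \<and> card (edges H) \<ge> 1})"

definition strictly_balanced :: "nat \<Rightarrow> 'a hypergraph \<Rightarrow> 'b hypergraph \<Rightarrow> bool" where
  "strictly_balanced k F1 F2 \<longleftrightarrow>
     \<not> (\<exists>H. subhypergraph H F1 \<and> H \<noteq> F1 \<and> card (edges H) \<ge> 1 \<and>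
            asym_dens k H F2 = max_asym_dens k F1 F2)"

definition ramsey_arrow :: "'b hypergraph \<Rightarrow> nat \<Rightarrow> (nat \<Rightarrow> 'a hypergraph) \<Rightarrow> bool" where
  "ramsey_arrow G r F \<longleftrightarrow>
     (\<forall>c. (\<forall>e\<in>edges G. c e \<in> {1..r}) \<longrightarrow>
        (\<exists>i\<in>{1..r}. \<exists>H. subhypergraph H G \<and> hypergraph_iso (F i) H \<and> (\<forall>e\<in>edges H. c e = i)))"

definition k_subsets :: "nat \<Rightarrow> nat \<Rightarrow> nat set set" where
  "k_subsets k n = {e. e \<subseteq> {..<n} \<and> card e = k}"

definition binomial_hypergraph :: "nat \<Rightarrow> nat \<Rightarrow> real \<Rightarrow> nat hypergraph pmf" where
  "binomial_hypergraph k n p =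
     map_pmf (\<lambda>present. Hypergraph {..<n} {e \<in> k_subsets k n. present e})
       (Pi_pmf (k_subsets k n) False (\<lambda>_. bernoulli_pmf p))"

end

theory Submission
  imports Defs "HOL-Library.Ramsey" "HOL-Real_Asymp.Real_Asymp"
begin

text \<open>
  Write \<open>m\<^sub>2\<close> for the \<open>k\<close>-density of \<open>F\<^sub>2\<close> and \<open>x = n\<^bsup>k - 1/m\<^sub>2\<^esup>\<close>. By monotonicity it suffices to treat
  \<open>p = C n\<^bsup>-1/m\<^esup>\<close>, where \<open>m\<close> is the asymmetric density. Suppose a colouring of the random hypergraph
  \<open>G\<close> has no copy of \<open>F\<^sub>i\<close> in colour \<open>i\<close>. Edges that lie in no copy of \<open>F\<^sub>1\<close> can be ignored; the
  remaining edges of colour \<open>i \<ge> 2\<close> form an \<open>F\<^sub>i\<close>-free hypergraph, so they lie in a container with few copies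
  of \<open>F\<^sub>i\<close> that is determined by a fingerprint of \<open>O(x)\<close> edges. By Ramsey supersaturation the
  complement \<open>D\<close> of the containers spans a positive proportion of all copies of \<open>F\<^sub>1\<close>, yet
  \<open>G \<inter> D\<close> contains none. As \<open>F\<^sub>1\<close> is strictly balanced, its copies in \<open>G\<close> hardly overlap, and
  Janson's inequality bounds the probability of the latter by \<open>exp (- c C\<^bsup>e\<^esup> x)\<close>, \<open>e\<close> being the
  number of edges of \<open>F\<^sub>1\<close>.

  A union bound over all fingerprints would lose a factor \<open>log n\<close> in the exponent. But all fingerprint edges lie
  in copies of \<open>F\<^sub>1\<close>, and up to a negligible part these copies are pairwise disjoint. A fingerprint is thus
  encoded by \<open>O(x)\<close> disjoint copies of \<open>F\<^sub>1\<close>, of which \<open>G\<close> is expected to contain only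
  \<open>exp (O(log C) x)\<close> families. Harris' inequality decouples the presence of such a family from the
  absence of copies in \<open>D\<close>.
\<close>

section \<open>Hypergraph containers\<close>

text \<open>Two quantities of the same order shape the proof. The container theorem for the colours
  i \<ge> 2 runs at density \<open>n powr (- 1 / m2)\<close> on the \<open>k\<close>-subsets, which
  makes fingerprints of size O(x). Since \<open>F 1\<close> attains the maximum defining
  \<open>m\<close>, the expected number of its copies at \<open>p = C * n powr (- 1 / m)\<close> is
  also of order x, with leading factor \<open>C ^ e\<close>. No power of \<open>n\<close> separates
  the cost of a union bound from the gain, so only the dependence on \<open>C\<close> can decide.
  This works because the constants of supersaturation and of the container theorem are fixed before
  \<open>C\<close> is chosen. Edges in overlapping copies are listed explicitly, at a factor of
  about \<open>n ^ k\<close> each. Strict balancedness makes this affordable: every way of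
  overlapping costs at least \<open>n powr (- \<epsilon>)\<close>, so with high probability there
  are at most \<open>x * n powr (- \<epsilon> / 2)\<close> overlapping pairs, which absorbs the
  logarithm. Finally x must grow: two intersecting edges of \<open>F 2\<close> make its exponent
  positive.\<close>

text \<open>Weights replace edge sets because links of different vertices are added with multiplicity.\<close>

definition wdeg :: "'v set \<Rightarrow> ('v set \<Rightarrow> real) \<Rightarrow> 'v set \<Rightarrow> real" where
  "wdeg U w A = (\<Sum>B | B \<subseteq> U \<and> A \<subseteq> B. w B)"

text \<open>A nonempty set is saturated once its degree in the link weight \<open>g\<close>
  collected so far reaches \<open>\<tau>\<close>. Discarding every edge above a saturated set stops
  later links from raising that degree.\<close>

definition unsaturated ::
  "'v set \<Rightarrow> (nat \<Rightarrow> real) \<Rightarrow> ('v set \<Rightarrow> real) \<Rightarrow> ('v set \<Rightarrow> real) \<Rightarrow> 'v set \<Rightarrow> real" where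
  "unsaturated U \<tau> w g B =
     (if \<exists>A. A \<noteq> {} \<and> A \<subseteq> B \<and> \<tau> (card A) \<le> wdeg U g A then 0 else w B)"

definition link :: "('v set \<Rightarrow> real) \<Rightarrow> 'v \<Rightarrow> 'v set \<Rightarrow> real" where
  "link h v B = (if v \<in> B then 0 else h (insert v B))"

lemma wdeg_mono:
  assumes "\<And>B. g B \<le> h B"
  shows "wdeg U g A \<le> wdeg U h A"
  unfolding wdeg_def by (intro sum_mono assms)

lemma wdeg_nonneg:
  assumes "\<And>B. 0 \<le> g B"
  shows "0 \<le> wdeg U g A"
  unfolding wdeg_def by (intro sum_nonneg assms)

lemma wdeg_add: "wdeg U (\<lambda>B. g B + h B) A = wdeg U g A + wdeg U h A"
  unfolding wdeg_def by (rule sum.distrib)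

lemma wdeg_link:
  assumes "finite U" "v \<in> U" "v \<notin> A"
  shows "wdeg U (link h v) A = wdeg U h (insert v A)"
proof -
  have "wdeg U (link h v) A = (\<Sum>B | B \<subseteq> U \<and> A \<subseteq> B \<and> v \<notin> B. link h v B)"
    unfolding wdeg_def
    by (rule sum.mono_neutral_right) (use assms in \<open>auto simp: link_def\<close>)
  also have "\<dots> = (\<Sum>B | B \<subseteq> U \<and> insert v A \<subseteq> B. h B)"
    by (rule sum.reindex_bij_witness[where i = "\<lambda>B. B - {v}" and j = "insert v"])
       (use assms in \<open>auto simp: link_def insert_absorb\<close>)
  finally show ?thesis by (simp add: wdeg_def)
qed

lemma wdeg_link_mem: "v \<in> A \<Longrightarrow> wdeg U (link h v) A = 0"
  unfolding wdeg_def by (rule sum.neutral) (auto simp: link_def)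

lemma sum_wdeg:
  assumes "finite U" "finite \<A>"
  shows "(\<Sum>A\<in>\<A>. wdeg U h A) = (\<Sum>B\<in>Pow U. real (card {A\<in>\<A>. A \<subseteq> B}) * h B)"
proof -
  have "(\<Sum>A\<in>\<A>. wdeg U h A) = (\<Sum>A\<in>\<A>. \<Sum>B | B \<in> Pow U \<and> A \<subseteq> B. h B)"
    by (simp add: wdeg_def)
  also have "\<dots> = (\<Sum>B\<in>Pow U. \<Sum>A | A \<in> \<A> \<and> A \<subseteq> B. h B)"
    by (rule sum.swap_restrict) (use assms in auto)
  finally show ?thesis by simp
qed

lemma sum_wdeg_singletons:
  assumes "finite U" and "\<And>B. h B \<noteq> 0 \<Longrightarrow> B \<subseteq> U \<and> card B = c"
  shows "(\<Sum>v\<in>U. wdeg U h {v}) = real c * wdeg U h {}"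
proof -
  have "(\<Sum>v\<in>U. wdeg U h {v}) = (\<Sum>A\<in>(\<lambda>v. {v}) ` U. wdeg U h A)"
    by (subst sum.reindex) auto
  also have "\<dots> = (\<Sum>B\<in>Pow U. real (card {A\<in>(\<lambda>v. {v}) ` U. A \<subseteq> B}) * h B)"
    by (rule sum_wdeg) (use assms in auto)
  also have "\<dots> = (\<Sum>B\<in>Pow U. real c * h B)"
  proof (rule sum.cong[OF refl])
    fix B assume B: "B \<in> Pow U"
    have "{A\<in>(\<lambda>v. {v}) ` U. A \<subseteq> B} = (\<lambda>v. {v}) ` B" using B by auto
    then have "card {A\<in>(\<lambda>v. {v}) ` U. A \<subseteq> B} = card B" by (simp add: card_image)
    then show "real (card {A\<in>(\<lambda>v. {v}) ` U. A \<subseteq> B}) * h B = real c * h B"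
      using assms(2)[of B] by (cases "h B = 0") auto
  qed
  finally show ?thesis by (simp add: wdeg_def sum_distrib_left Pow_def)
qed

lemma sum_wdeg_Pow:
  assumes "finite U" and "\<And>B. h B \<noteq> 0 \<Longrightarrow> B \<subseteq> U \<and> card B = c"
  shows "(\<Sum>A\<in>Pow U. wdeg U h A) = 2 ^ c * wdeg U h {}"
proof -
  have "(\<Sum>A\<in>Pow U. wdeg U h A) = (\<Sum>B\<in>Pow U. real (card {A\<in>Pow U. A \<subseteq> B}) * h B)"
    by (rule sum_wdeg) (use assms in auto)
  also have "\<dots> = (\<Sum>B\<in>Pow U. 2 ^ c * h B)"
  proof (rule sum.cong[OF refl])
    fix B assume B: "B \<in> Pow U"
    have "{A\<in>Pow U. A \<subseteq> B} = Pow B" using B by auto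
    moreover have "finite B" using B assms(1) finite_subset by auto
    ultimately have "card {A\<in>Pow U. A \<subseteq> B} = 2 ^ card B" by (simp add: card_Pow)
    then show "real (card {A\<in>Pow U. A \<subseteq> B}) * h B = 2 ^ c * h B"
      using assms(2)[of B] by (cases "h B = 0") auto
  qed
  finally show ?thesis by (simp add: wdeg_def sum_distrib_left Pow_def)
qed

section \<open>Scanning the vertices for a fingerprint\<close>

text \<open>The set \<open>I\<close> is consulted only at active vertices: those inside
  \<open>I\<close> form the fingerprint, those outside are deleted from the container. The state
  stays abstract because replaying a run needs nothing about link weights.\<close>

fun scan_state :: "('s \<Rightarrow> 'v \<Rightarrow> bool) \<Rightarrow> ('s \<Rightarrow> 'v \<Rightarrow> 's) \<Rightarrow> 'v set \<Rightarrow> 'v list \<Rightarrow> 's \<Rightarrow> 's" where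
  "scan_state act upd I [] s = s"
| "scan_state act upd I (v # vs) s =
     scan_state act upd I vs (if act s v \<and> v \<in> I then upd s v else s)"

fun scan_selected :: "('s \<Rightarrow> 'v \<Rightarrow> bool) \<Rightarrow> ('s \<Rightarrow> 'v \<Rightarrow> 's) \<Rightarrow> 'v set \<Rightarrow> 'v list \<Rightarrow> 's \<Rightarrow> 'v set" where
  "scan_selected act upd I [] s = {}"
| "scan_selected act upd I (v # vs) s =
     (if act s v \<and> v \<in> I then {v} else {}) \<union>
     scan_selected act upd I vs (if act s v \<and> v \<in> I then upd s v else s)"

fun scan_container :: "('s \<Rightarrow> 'v \<Rightarrow> bool) \<Rightarrow> ('s \<Rightarrow> 'v \<Rightarrow> 's) \<Rightarrow> 'v set \<Rightarrow> 'v list \<Rightarrow> 's \<Rightarrow> 'v set" where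
  "scan_container act upd I [] s = {}"
| "scan_container act upd I (v # vs) s =
     (if act s v \<and> v \<notin> I then {} else {v}) \<union>
     scan_container act upd I vs (if act s v \<and> v \<in> I then upd s v else s)"

lemma scan_selected_subset: "scan_selected act upd I vs s \<subseteq> I \<inter> set vs"
  by (induction vs arbitrary: s) auto

lemma scan_container_subset: "scan_container act upd I vs s \<subseteq> set vs"
  by (induction vs arbitrary: s) auto

lemma scan_container_superset: "I \<inter> set vs \<subseteq> scan_container act upd I vs s"
  by (induction vs arbitrary: s) (simp_all, blast)

text \<open>Each answer of \<open>I\<close> is visible in the fingerprint: an active vertex lies in
  \<open>I\<close> exactly if it is selected. So the fingerprint alone replays the run, and the
  container is a function of it. Distinctness excludes that a vertex passed over is selected at a
  later occurrence.\<close>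

lemma scan_determined:
  assumes "distinct vs" "J \<inter> set vs = scan_selected act upd I vs s"
  shows "scan_state act upd J vs s = scan_state act upd I vs s \<and>
         scan_container act upd J vs s = scan_container act upd I vs s"
  using assms
proof (induction vs arbitrary: s)
  case (Cons v vs)
  define s' where "s' = (if act s v \<and> v \<in> I then upd s v else s)"
  have v: "v \<notin> set vs" using Cons.prems by auto
  have sub: "scan_selected act upd I vs s' \<subseteq> set vs"
    using scan_selected_subset by fast
  have eq: "J \<inter> set (v # vs) = (if act s v \<and> v \<in> I then {v} else {}) \<union> scan_selected act upd I vs s'"
    using Cons.prems by (simp add: s'_def)
  have vJ: "v \<in> J \<longleftrightarrow> act s v \<and> v \<in> I"
    using eq v sub by (auto split: if_splits)
  have "J \<inter> set vs = scan_selected act upd I vs s'"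
    using eq v sub by (auto split: if_splits)
  with Cons have IH: "scan_state act upd J vs s' = scan_state act upd I vs s' \<and>
         scan_container act upd J vs s' = scan_container act upd I vs s'" by auto
  show ?case using IH vJ unfolding s'_def by auto
qed auto

text \<open>One round lowers the uniformity from \<open>Suc l\<close> to \<open>l\<close>: the state
  is the sum of the links of the selected vertices. \<open>\<Delta>\<close> bounds the codegrees of
  \<open>w\<close>, \<open>\<tau>\<close> is the saturation threshold, and \<open>\<beta>\<close>
  the remaining degree from which a vertex is worth querying.\<close>

locale link_scan =
  fixes U :: "'v set" and w :: "'v set \<Rightarrow> real" and l :: nat
    and \<tau> \<Delta> :: "nat \<Rightarrow> real" and \<beta> :: real
  assumes finite_U: "finite U"
    and w_nonneg: "0 \<le> w B"
    and w_support: "w B \<noteq> 0 \<Longrightarrow> B \<subseteq> U \<and> card B = Suc l"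
    and codegree: "A \<subseteq> U \<Longrightarrow> A \<noteq> {} \<Longrightarrow> wdeg U w A \<le> \<Delta> (card A)"
    and \<tau>_nonneg: "0 \<le> \<tau> j"
    and \<Delta>_nonneg: "0 \<le> \<Delta> j"
begin

abbreviation rest :: "('v set \<Rightarrow> real) \<Rightarrow> 'v set \<Rightarrow> real" where
  "rest g \<equiv> unsaturated U \<tau> w g"

definition active :: "('v set \<Rightarrow> real) \<Rightarrow> 'v \<Rightarrow> bool" where
  "active g v \<longleftrightarrow> \<beta> \<le> wdeg U (rest g) {v}"

definition extend :: "('v set \<Rightarrow> real) \<Rightarrow> 'v \<Rightarrow> 'v set \<Rightarrow> real" where
  "extend g v B = g B + link (rest g) v B"

lemma rest_nonneg: "0 \<le> rest g B"
  by (simp add: unsaturated_def w_nonneg)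

lemma rest_le: "rest g B \<le> w B"
  by (simp add: unsaturated_def w_nonneg)

lemma rest_antimono:
  assumes "\<And>B. g B \<le> h B"
  shows "rest h B \<le> rest g B"
proof -
  have "\<tau> (card A) \<le> wdeg U g A \<Longrightarrow> \<tau> (card A) \<le> wdeg U h A" for A
    using wdeg_mono[of g h U A, OF assms] by linarith
  then show ?thesis by (auto simp: unsaturated_def w_nonneg)
qed

lemma link_rest_nonneg: "0 \<le> link (rest g) v B"
  by (simp add: link_def rest_nonneg)

lemma extend_ge: "g B \<le> extend g v B"
  by (simp add: extend_def link_rest_nonneg)

lemma wdeg_extend_total: "v \<in> U \<Longrightarrow> wdeg U (extend g v) {} = wdeg U g {} + wdeg U (rest g) {v}"
  unfolding extend_def[abs_def] wdeg_add by (simp add: wdeg_link finite_U)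

text \<open>The invariant of the scan. A degree can overshoot \<open>\<tau>\<close> only by the
  contribution of a single link, which is where the codegree of sets with one more element
  enters.\<close>

definition valid_link :: "('v set \<Rightarrow> real) \<Rightarrow> bool" where
  "valid_link g \<longleftrightarrow> (\<forall>B. 0 \<le> g B) \<and> (\<forall>B. g B \<noteq> 0 \<longrightarrow> B \<subseteq> U \<and> card B = l) \<and>
     (\<forall>A. A \<subseteq> U \<longrightarrow> A \<noteq> {} \<longrightarrow> wdeg U g A \<le> \<tau> (card A) + \<Delta> (Suc (card A)))"

lemma valid_link_zero: "valid_link (\<lambda>_. 0)"
  by (simp add: valid_link_def wdeg_def \<tau>_nonneg \<Delta>_nonneg)

text \<open>A saturated \<open>A\<close> gains nothing, since no remaining edge contains it; an
  unsaturated one has degree below \<open>\<tau>\<close> and gains at most the codegree of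
  \<open>insert v A\<close>.\<close>

lemma valid_link_extend:
  assumes g: "valid_link g" and v: "v \<in> U"
  shows "valid_link (extend g v)"
  unfolding valid_link_def
proof (intro conjI allI impI)
  fix B
  show "0 \<le> extend g v B"
    using g by (simp add: extend_def link_rest_nonneg valid_link_def)
next
  fix B assume "extend g v B \<noteq> 0"
  then consider "g B \<noteq> 0" | "link (rest g) v B \<noteq> 0" by (force simp: extend_def)
  then have "B \<subseteq> U \<and> card B = l"
  proof cases
    case 1 then show ?thesis using g by (simp add: valid_link_def)
  next
    case 2
    then have vB: "v \<notin> B" and "w (insert v B) \<noteq> 0"
      by (auto simp: link_def unsaturated_def split: if_splits)
    then have ins: "insert v B \<subseteq> U" "card (insert v B) = Suc l" using w_support by blast+
    then have "finite B" using finite_U by (auto intro: finite_subset)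
    then show ?thesis using ins vB by simp
  qed
  then show "B \<subseteq> U" "card B = l" by auto
next
  fix A assume A: "A \<subseteq> U" "A \<noteq> {}"
  have add: "wdeg U (extend g v) A = wdeg U g A + wdeg U (link (rest g) v) A"
    unfolding extend_def[abs_def] by (rule wdeg_add)
  show "wdeg U (extend g v) A \<le> \<tau> (card A) + \<Delta> (Suc (card A))"
  proof (cases "\<tau> (card A) \<le> wdeg U g A \<or> v \<in> A")
    case True
    have "wdeg U (link (rest g) v) A = 0"
    proof (cases "v \<in> A")
      case False
      then have "\<tau> (card A) \<le> wdeg U g A" using True by simp
      then have "link (rest g) v B = 0" if "A \<subseteq> B" for B
        using that A by (auto simp: link_def unsaturated_def)
      then show ?thesis by (auto simp: wdeg_def intro!: sum.neutral)
    qed (rule wdeg_link_mem)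
    then show ?thesis using add g A by (simp add: valid_link_def)
  next
    case False
    have "finite A" using A finite_U finite_subset by blast
    have "wdeg U (link (rest g) v) A = wdeg U (rest g) (insert v A)"
      using False by (intro wdeg_link finite_U v) auto
    also have "\<dots> \<le> wdeg U w (insert v A)" by (rule wdeg_mono) (rule rest_le)
    also have "\<dots> \<le> \<Delta> (card (insert v A))" using A v by (intro codegree) auto
    also have "card (insert v A) = Suc (card A)" using False \<open>finite A\<close> by simp
    finally show ?thesis using False add by simp
  qed
qed

abbreviation final :: "'v set \<Rightarrow> 'v list \<Rightarrow> ('v set \<Rightarrow> real) \<Rightarrow> ('v set \<Rightarrow> real)" where
  "final \<equiv> scan_state active extend"

lemma final_ge: "g B \<le> final I vs g B"
proof (induction vs arbitrary: g)
  case (Cons v vs)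
  have "g B \<le> (if active g v \<and> v \<in> I then extend g v else g) B"
    by (simp add: extend_ge)
  also have "\<dots> \<le> final I (v # vs) g B" using Cons by simp
  finally show ?case .
qed simp

lemma valid_link_final: "set vs \<subseteq> U \<Longrightarrow> valid_link g \<Longrightarrow> valid_link (final I vs g)"
  by (induction vs arbitrary: g) (auto simp: valid_link_extend)

text \<open>Only links of vertices of \<open>I\<close> are added, and an edge \<open>B\<close> of
  such a link inside \<open>I\<close> would make \<open>insert v B\<close> an edge of
  \<open>w\<close> inside \<open>I\<close>. So independence passes to the link weight, which is what
  lets the uniformity drop.\<close>

lemma final_indep_set:
  assumes I: "\<And>B. B \<subseteq> I \<Longrightarrow> w B = 0" and "\<And>B. B \<subseteq> I \<Longrightarrow> g B = 0" "B \<subseteq> I"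
  shows "final I vs g B = 0"
  using assms(2,3)
proof (induction vs arbitrary: g)
  case (Cons v vs)
  have "extend g v B = 0" if "v \<in> I" "B \<subseteq> I" for B
    using that Cons.prems I[of "insert v B"]
    by (simp add: extend_def link_def unsaturated_def)
  then show ?case using Cons by simp
qed auto

text \<open>A selected vertex is active, so its link adds at least \<open>\<beta>\<close> to the
  total weight; an upper bound on that total limits the fingerprint.\<close>

lemma card_selected:
  assumes "set vs \<subseteq> U" "distinct vs"
  shows "wdeg U g {} + \<beta> * real (card (scan_selected active extend I vs g))
           \<le> wdeg U (final I vs g) {}"
  using assms
proof (induction vs arbitrary: g)
  case (Cons v vs)
  define g' where "g' = (if active g v \<and> v \<in> I then extend g v else g)"
  have IH: "wdeg U g' {} + \<beta> * real (card (scan_selected active extend I vs g'))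
           \<le> wdeg U (final I vs g') {}" using Cons by simp
  show ?case
  proof (cases "active g v \<and> v \<in> I")
    case True
    have "v \<notin> scan_selected active extend I vs g'"
      using scan_selected_subset[of active extend I vs g'] Cons.prems by auto
    moreover have "finite (scan_selected active extend I vs g')"
      using scan_selected_subset[of active extend I vs g'] by (rule finite_subset) auto
    moreover have "wdeg U g' {} \<ge> wdeg U g {} + \<beta>"
      using True Cons.prems by (simp add: g'_def wdeg_extend_total active_def)
    ultimately show ?thesis using IH True by (simp add: g'_def algebra_simps)
  qed (use IH in \<open>auto simp: g'_def\<close>)
qed simp

text \<open>A container vertex was either inactive, with remaining degree below
  \<open>\<beta>\<close>, or selected, and then its remaining degree is exactly what its link added
  to the total. Remaining degrees only fall afterwards.\<close>

lemma container_degree_sum: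
  assumes "set vs \<subseteq> U" "distinct vs" "0 \<le> \<beta>"
  shows "(\<Sum>v\<in>scan_container active extend I vs g. wdeg U (rest (final I vs g)) {v})
           \<le> \<beta> * real (length vs) + (wdeg U (final I vs g) {} - wdeg U g {})"
  using assms(1,2)
proof (induction vs arbitrary: g)
  case (Cons v vs)
  define g' where "g' = (if active g v \<and> v \<in> I then extend g v else g)"
  define h where "h = final I vs g'"
  let ?d = "\<lambda>u. wdeg U (rest h) {u}"
  have h: "h = final I (v # vs) g" by (simp add: h_def g'_def)
  have IH: "(\<Sum>v\<in>scan_container active extend I vs g'. ?d v)
           \<le> \<beta> * real (length vs) + (wdeg U h {} - wdeg U g' {})"
    using Cons unfolding h_def by simp
  have "g B \<le> h B" for B unfolding h by (rule final_ge)
  then have d_le: "?d v \<le> wdeg U (rest g) {v}" by (intro wdeg_mono rest_antimono)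
  have fin: "finite (scan_container active extend I vs g')"
    using scan_container_subset[of active extend I vs g'] by (rule finite_subset) auto
  have v: "v \<notin> scan_container active extend I vs g'"
    using scan_container_subset[of active extend I vs g'] Cons.prems by auto
  show ?case
  proof (cases "active g v")
    case True
    show ?thesis
    proof (cases "v \<in> I")
      case vI: True
      have "wdeg U g' {} = wdeg U g {} + wdeg U (rest g) {v}"
        using True vI Cons.prems by (simp add: g'_def wdeg_extend_total)
      then show ?thesis
        using IH d_le True vI v fin assms(3) unfolding h[symmetric]
        by (simp add: g'_def[symmetric] distrib_left) (simp add: g'_def)
    next
      case False
      then show ?thesis
        using IH assms(3) unfolding h[symmetric]
        by (simp add: g'_def True distrib_left)
    qed
  next
    case False
    then have "?d v \<le> \<beta>" using d_le by (simp add: active_def)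
    then show ?thesis
      using IH False v fin unfolding h[symmetric]
      by (simp add: g'_def distrib_left)
  qed
qed simp

text \<open>Every edge lost to saturation contains a saturated set, and the link weight bounds the number
  of saturated sets.\<close>

lemma rest_total:
  assumes g: "valid_link g" and "0 < c"
    and c: "\<And>j. 0 < j \<Longrightarrow> \<Delta> j \<le> c * \<tau> j"
  shows "wdeg U w {} - c * 2 ^ l * wdeg U g {} \<le> wdeg U (rest g) {}"
proof -
  let ?S = "{A \<in> Pow U. A \<noteq> {} \<and> \<tau> (card A) \<le> wdeg U g A}"
  have fin: "finite ?S" using finite_U by auto
  have "w B - rest g B \<le> (\<Sum>A\<in>?S. if A \<subseteq> B then w B else 0)" if "B \<subseteq> U" for B
  proof (cases "\<exists>A. A \<noteq> {} \<and> A \<subseteq> B \<and> \<tau> (card A) \<le> wdeg U g A")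
    case True
    then obtain A where A: "A \<noteq> {}" "A \<subseteq> B" "\<tau> (card A) \<le> wdeg U g A" by blast
    then have "A \<in> ?S" using that by auto
    have "w B - rest g B \<le> (if A \<subseteq> B then w B else 0)"
      using A rest_nonneg[of g B] by simp
    also have "\<dots> \<le> (\<Sum>A\<in>?S. if A \<subseteq> B then w B else 0)"
      using \<open>A \<in> ?S\<close> fin by (intro member_le_sum) (auto simp: w_nonneg)
    finally show ?thesis .
  next
    case False
    then have "w B - rest g B = 0" by (auto simp: unsaturated_def)
    also have "0 \<le> (\<Sum>A\<in>?S. if A \<subseteq> B then w B else 0)"
      by (intro sum_nonneg) (simp add: w_nonneg)
    finally show ?thesis .
  qed
  then have "(\<Sum>B\<in>Pow U. w B - rest g B) \<le> (\<Sum>B\<in>Pow U. \<Sum>A\<in>?S. if A \<subseteq> B then w B else 0)"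
    by (intro sum_mono) auto
  also have "\<dots> = (\<Sum>A\<in>?S. \<Sum>B\<in>Pow U. if A \<subseteq> B then w B else 0)"
    by (rule sum.swap)
  also have "\<dots> = (\<Sum>A\<in>?S. wdeg U w A)"
    by (intro sum.cong refl) (simp add: wdeg_def sum.inter_filter[symmetric] finite_U)
  also have "\<dots> \<le> (\<Sum>A\<in>?S. c * wdeg U g A)"
  proof (rule sum_mono)
    fix A assume A: "A \<in> ?S"
    then have "finite A" using finite_U finite_subset by auto
    then have "wdeg U w A \<le> c * \<tau> (card A)"
      using codegree[of A] c[of "card A"] A by (auto simp: card_gt_0_iff)
    also have "\<dots> \<le> c * wdeg U g A" using A \<open>0 < c\<close> by simp
    finally show "wdeg U w A \<le> c * wdeg U g A" .
  qed
  also have "\<dots> \<le> (\<Sum>A\<in>Pow U. c * wdeg U g A)"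
    using g \<open>0 < c\<close> finite_U
    by (intro sum_mono2) (auto intro!: mult_nonneg_nonneg wdeg_nonneg simp: valid_link_def)
  also have "\<dots> = c * (2 ^ l * wdeg U g {})"
    unfolding sum_distrib_left[symmetric]
    by (subst sum_wdeg_Pow) (use g finite_U in \<open>auto simp: valid_link_def\<close>)
  finally show ?thesis by (simp add: sum_subtractf wdeg_def Pow_def mult.assoc)
qed

end

section \<open>The container theorem\<close>

text \<open>The usual codegree condition of container theorems, with \<open>E / N\<close> in the
  role of the average degree and a factor \<open>p\<close> for each further vertex of
  \<open>A\<close>. \<open>N\<close> and \<open>E\<close> are free reference scales, so that they
  can stay fixed while the vertex set shrinks.\<close>

definition codegree_bounded ::
  "'v set \<Rightarrow> ('v set \<Rightarrow> real) \<Rightarrow> nat \<Rightarrow> real \<Rightarrow> real \<Rightarrow> real \<Rightarrow> real \<Rightarrow> bool" where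
  "codegree_bounded U w l K p N E \<longleftrightarrow>
     finite U \<and> real (card U) \<le> N \<and> (\<forall>B. 0 \<le> w B) \<and> (\<forall>B. w B \<noteq> 0 \<longrightarrow> B \<subseteq> U \<and> card B = l) \<and>
     (\<forall>A\<subseteq>U. A \<noteq> {} \<longrightarrow> wdeg U w A \<le> K * p ^ (card A - 1) * E / N)"

definition indep_set :: "('v set \<Rightarrow> real) \<Rightarrow> 'v set \<Rightarrow> bool" where
  "indep_set w I \<longleftrightarrow> (\<forall>B\<subseteq>I. w B = 0)"

text \<open>Fingerprints come as a list because containers are computed in nested rounds, each
  revealing one more subset of \<open>I\<close>. The order of quantifiers is the point:
  \<open>f\<close> is fixed before \<open>I\<close>.\<close>

definition has_containers ::
  "'v set \<Rightarrow> ('v set \<Rightarrow> real) \<Rightarrow> nat \<Rightarrow> real \<Rightarrow> ('v set \<Rightarrow> bool) \<Rightarrow> bool" where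
  "has_containers U w m t Q \<longleftrightarrow>
     (\<exists>f. \<forall>I\<subseteq>U. indep_set w I \<longrightarrow>
        (\<exists>Ts. length Ts = m \<and> (\<forall>T\<in>set Ts. T \<subseteq> I \<and> real (card T) \<le> t) \<and>
              I \<subseteq> f Ts \<and> f Ts \<subseteq> U \<and> Q (f Ts)))"

text \<open>Induction on the uniformity. If the link weight after one scan has total at least
  \<open>p * e\<close>, its codegrees are small enough relative to its own total for the induction
  hypothesis. If not, little of \<open>w\<close> was lost to saturation and the container carries
  little of the remaining degree sum; as no vertex has large degree, a constant proportion of the
  vertices lies outside.\<close>

lemma container_step:
  assumes "0 < (K::real)"
  shows "\<exists>\<delta>>0. \<exists>M>0. \<forall>(U::'v set) N p w.
           codegree_bounded U w l K p N (wdeg U w {}) \<and> 0 < p \<and> p \<le> 1 / 4 \<and> 0 < wdeg U w {} \<longrightarrow>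
           has_containers U w l (M * p * N) (\<lambda>C. \<delta> * N \<le> real (card (U - C)))"
  using assms
proof (induction l arbitrary: K)
  case 0
  \<comment> \<open>A 0-uniform weight of positive total sits on the empty set, so no set is
    independent.\<close>
  have "\<not> indep_set w I"
    if cb: "codegree_bounded U w 0 K p N (wdeg U w {})" and pos: "0 < wdeg U w {}"
    for U I :: "'v set" and w p N
  proof
    assume "indep_set w I"
    then have "w {} = 0" by (simp add: indep_set_def)
    moreover have "B = {}" if "w B \<noteq> 0" for B
    proof -
      have "finite U" "B \<subseteq> U" "card B = 0"
        using cb \<open>w B \<noteq> 0\<close> unfolding codegree_bounded_def by blast+
      then show ?thesis using finite_subset[of B U] by simp
    qed
    ultimately have "w B = 0" for B by blast
    then show False using pos by (simp add: wdeg_def)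
  qed
  then show ?case
    by (intro exI[of _ 1] conjI allI impI) (auto simp: has_containers_def)
next
  case (Suc l)
  \<comment> \<open>The factor \<open>2 ^ (l + 2)\<close> limits the saturation loss to
    \<open>e / 4\<close> if the link weight is small; \<open>K'\<close> is the constant of threshold
    plus overshoot.\<close>
  define \<kappa> where "\<kappa> = 2 ^ (l + 2) * K"
  define K' where "K' = \<kappa> + K"
  have \<kappa>: "0 < \<kappa>" and K': "0 < K'" using Suc.prems by (simp_all add: \<kappa>_def K'_def add_pos_pos)
  from Suc.IH[OF K'] obtain \<delta>' M' where \<delta>': "0 < \<delta>'" and M': "0 < M'" and
    IH: "\<And>(U::'v set) N p w. codegree_bounded U w l K' p N (wdeg U w {}) \<Longrightarrow> 0 < p \<Longrightarrow> p \<le> 1 / 4 \<Longrightarrow>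
           0 < wdeg U w {} \<Longrightarrow>
           has_containers U w l (M' * p * N) (\<lambda>C. \<delta>' * N \<le> real (card (U - C)))"
    by blast
  \<comment> \<open>\<open>\<delta>'\<close> serves the case of a large link weight,
    \<open>1 / (4 * K)\<close> the other one. \<open>4 * K'\<close> comes from dividing the bound
    \<open>K' * p * e\<close> on the total link weight by the activity threshold
    \<open>e / (4 * N)\<close>.\<close>
  define \<delta> where "\<delta> = min \<delta>' (1 / (4 * K))"
  define M where "M = max M' (4 * K')"
  have "has_containers U w (Suc l) (M * p * N) (\<lambda>C. \<delta> * N \<le> real (card (U - C)))"
    if cb: "codegree_bounded U w (Suc l) K p N (wdeg U w {})" and p: "0 < p" "p \<le> 1 / 4"
      and e_pos: "0 < wdeg U w {}" for U :: "'v set" and w p N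
  proof -
    define e where "e = wdeg U w {}"
    note cbD = cb[unfolded codegree_bounded_def, folded e_def]
    have e: "0 < e" using e_pos by (simp add: e_def)
    have "finite U" using cbD by blast
    have "\<exists>B. w B \<noteq> 0"
    proof (rule ccontr)
      assume "\<nexists>B. w B \<noteq> 0"
      then show False using e by (simp add: e_def wdeg_def)
    qed
    then obtain B where "w B \<noteq> 0" by blast
    then have "B \<subseteq> U" "card B = Suc l" using cbD by simp_all
    then have "0 < card U" using card_mono[OF \<open>finite U\<close>, of B] by simp
    then have N: "0 < N" using cbD by linarith
    \<comment> \<open>With this threshold the inactive vertices carry at most \<open>e / 4\<close>;
      a small link weight adds at most another \<open>e / 4\<close>, as \<open>p\<close> is at most
      1/4.\<close>
    define \<beta> where "\<beta> = e / (4 * N)"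
    define \<tau> where "\<tau> = (\<lambda>j::nat. \<kappa> * p ^ j * e / N)"
    define \<Delta> where "\<Delta> = (\<lambda>j::nat. K * p ^ (j - 1) * e / N)"
    interpret link_scan U w l \<tau> \<Delta> \<beta>
      using cbD N e p Suc.prems \<kappa> by unfold_locales (auto simp: \<tau>_def \<Delta>_def)
    obtain xs where xs: "set xs = U" "distinct xs"
      using finite_distinct_list[OF \<open>finite U\<close>] by blast
    define G where "G = (\<lambda>J. final J xs (\<lambda>_. 0))"
    define S where "S = (\<lambda>J. scan_selected active extend J xs (\<lambda>_. 0))"
    define C where "C = (\<lambda>J. scan_container active extend J xs (\<lambda>_. 0))"
    have vG: "valid_link (G J)" for J
      unfolding G_def using xs by (intro valid_link_final valid_link_zero) auto
    have G_deg: "wdeg U (G J) A \<le> K' * p ^ card A * e / N" if "A \<subseteq> U" "A \<noteq> {}" for J A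
    proof -
      have "wdeg U (G J) A \<le> \<tau> (card A) + \<Delta> (Suc (card A))"
        using vG that by (simp add: valid_link_def)
      then show ?thesis by (simp add: \<tau>_def \<Delta>_def K'_def add_divide_distrib distrib_right)
    qed
    have G_cont: "has_containers U (G J) l (M' * p * N) (\<lambda>C. \<delta>' * N \<le> real (card (U - C)))"
      if big: "p * e \<le> wdeg U (G J) {}" for J
    proof (rule IH[OF _ p])
      have "wdeg U (G J) A \<le> K' * p ^ (card A - 1) * wdeg U (G J) {} / N"
        if A: "A \<subseteq> U" "A \<noteq> {}" for A
      proof -
        have "0 < card A" using A \<open>finite U\<close> finite_subset card_gt_0_iff by blast
        then have "p ^ card A = p ^ (card A - 1) * p" by (cases "card A") auto
        then have "wdeg U (G J) A \<le> K' * p ^ (card A - 1) * (p * e) / N"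
          using G_deg[OF A, of J] by (simp add: mult.assoc)
        also have "\<dots> \<le> K' * p ^ (card A - 1) * wdeg U (G J) {} / N"
          using big N p K' by (intro divide_right_mono mult_left_mono) auto
        finally show ?thesis .
      qed
      then show "codegree_bounded U (G J) l K' p N (wdeg U (G J) {})"
        using vG[of J] cbD by (auto simp: codegree_bounded_def valid_link_def)
      show "0 < wdeg U (G J) {}" using big p e mult_pos_pos[of p e] by linarith
    qed
    define good where "good = (\<lambda>g f. \<forall>I\<subseteq>U. indep_set g I \<longrightarrow>
        (\<exists>Ts. length Ts = l \<and> (\<forall>T\<in>set Ts. T \<subseteq> I \<and> real (card T) \<le> M' * p * N) \<and>
              I \<subseteq> f Ts \<and> f Ts \<subseteq> U \<and> \<delta>' * N \<le> real (card (U - f Ts))))"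
    \<comment> \<open>The choice depends on the link weight alone, so independent sets with equal
      fingerprints share it.\<close>
    define Fc where "Fc = (\<lambda>g. SOME f. good g f)"
    have "good (G J) (Fc (G J))" if "p * e \<le> wdeg U (G J) {}" for J
    proof -
      have "\<exists>f. good (G J) f" using G_cont[OF that] by (simp only: has_containers_def good_def)
      then show ?thesis unfolding Fc_def by (rule someI_ex)
    qed
    then have Fc: "\<exists>Ts. length Ts = l \<and> (\<forall>T\<in>set Ts. T \<subseteq> I \<and> real (card T) \<le> M' * p * N) \<and>
              I \<subseteq> Fc (G J) Ts \<and> Fc (G J) Ts \<subseteq> U \<and> \<delta>' * N \<le> real (card (U - Fc (G J) Ts))"
      if "p * e \<le> wdeg U (G J) {}" "I \<subseteq> U" "indep_set (G J) I" for I J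
      using that by (simp only: good_def)
    \<comment> \<open>The head of the list replays the scan, which recovers both the link weight and
      the case distinction.\<close>
    define f where "f = (\<lambda>Ts. if p * e \<le> wdeg U (G (hd Ts)) {} then Fc (G (hd Ts)) (tl Ts) else C (hd Ts))"
    show ?thesis
      unfolding has_containers_def
    proof (intro exI[of _ f] allI impI)
      fix I assume I: "I \<subseteq> U" and ind: "indep_set w I"
      have S_sub: "S I \<subseteq> I" "S I \<subseteq> U"
        using scan_selected_subset[of active extend I xs] xs by (auto simp: S_def)
      have "G (S I) = G I \<and> C (S I) = C I"
        unfolding G_def C_def
        by (rule scan_determined[OF xs(2)]) (use S_sub xs in \<open>auto simp: S_def\<close>)
      then have GS: "G (S I) = G I" and CS: "C (S I) = C I" by auto
      have indG: "indep_set (G I) I"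
        using ind final_indep_set[of I "\<lambda>_. 0"] by (auto simp: indep_set_def G_def)
      \<comment> \<open>For \<open>l > 0\<close> the total is bounded through the degrees of single
        vertices. For \<open>l = 0\<close> these say nothing, but the link weight can only sit on
        the empty set, where independence of \<open>I\<close> makes it vanish.\<close>
      have total: "wdeg U (G I) {} \<le> K' * p * e"
      proof (cases "l = 0")
        case True
        have "G I B = 0" if "B \<subseteq> U" for B
        proof (rule ccontr)
          assume "G I B \<noteq> 0"
          then have "card B = l" using vG[of I] unfolding valid_link_def by blast
          then have "card B = 0" using True by simp
          then have "B = {}" using that \<open>finite U\<close> finite_subset[of B U] by simp
          then show False using indG \<open>G I B \<noteq> 0\<close> by (auto simp: indep_set_def)
        qed
        then have "wdeg U (G I) {} = 0" by (auto simp: wdeg_def intro!: sum.neutral)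
        then show ?thesis using K' p e by simp
      next
        case False
        have "0 \<le> wdeg U (G I) {}" using vG[of I] by (intro wdeg_nonneg) (auto simp: valid_link_def)
        then have "wdeg U (G I) {} \<le> real l * wdeg U (G I) {}"
          using False by (simp add: mult_le_cancel_right1)
        also have "\<dots> = (\<Sum>v\<in>U. wdeg U (G I) {v})"
          using vG[of I] by (subst sum_wdeg_singletons[OF \<open>finite U\<close>]) (auto simp: valid_link_def)
        also have "\<dots> \<le> (\<Sum>v\<in>U. K' * p * e / N)"
          using G_deg[of "{_}" I] by (intro sum_mono) auto
        also have "\<dots> = real (card U) * (K' * p * e / N)" by simp
        also have "\<dots> \<le> N * (K' * p * e / N)"
          using cbD K' p e N by (intro mult_right_mono) auto
        finally show ?thesis using N by simp
      qed
      have "\<beta> * real (card (S I)) \<le> wdeg U (G I) {}"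
        using card_selected[of xs "\<lambda>_. 0" I] xs by (simp add: S_def G_def wdeg_def)
      then have "\<beta> * real (card (S I)) \<le> K' * p * e" using total by linarith
      then have "real (card (S I)) \<le> 4 * K' * p * N"
        using e N by (simp add: \<beta>_def field_simps)
      also have "\<dots> \<le> M * p * N"
        using p N by (intro mult_right_mono) (auto simp: M_def)
      finally have cardS: "real (card (S I)) \<le> M * p * N" .
      have M'M: "M' * p * N \<le> M * p * N" using p N by (intro mult_right_mono) (auto simp: M_def)
      show "\<exists>Ts. length Ts = Suc l \<and> (\<forall>T\<in>set Ts. T \<subseteq> I \<and> real (card T) \<le> M * p * N) \<and>
              I \<subseteq> f Ts \<and> f Ts \<subseteq> U \<and> \<delta> * N \<le> real (card (U - f Ts))"
      proof (cases "p * e \<le> wdeg U (G I) {}")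
        case True
        from Fc[OF True I indG] obtain Ts where Ts: "length Ts = l"
          "\<forall>T\<in>set Ts. T \<subseteq> I \<and> real (card T) \<le> M' * p * N"
          "I \<subseteq> Fc (G I) Ts" "Fc (G I) Ts \<subseteq> U" "\<delta>' * N \<le> real (card (U - Fc (G I) Ts))" by blast
        have fTs: "f (S I # Ts) = Fc (G I) Ts" using True by (simp add: f_def GS)
        have "\<delta> * N \<le> \<delta>' * N" using N by (intro mult_right_mono) (auto simp: \<delta>_def)
        then show ?thesis
          using Ts cardS M'M S_sub by (intro exI[of _ "S I # Ts"]) (unfold fTs, force)
      next
        case False
        define R where "R = rest (G I)"
        \<comment> \<open>Empty sets pad the list to the common length.\<close>
        have fTs: "f (S I # replicate l {}) = C I" using False by (simp add: f_def GS CS)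
        have C: "I \<subseteq> C I" "C I \<subseteq> U"
          using scan_container_superset[of I xs active extend "\<lambda>_. 0"]
            scan_container_subset[of active extend I xs "\<lambda>_. 0"] I xs by (auto simp: C_def)
        have "K / (\<kappa> * p) * 2 ^ l * wdeg U (G I) {} \<le> K / (\<kappa> * p) * 2 ^ l * (p * e)"
          using False Suc.prems \<kappa> p by (intro mult_left_mono) auto
        also have "\<dots> = e / 4" using Suc.prems p by (simp add: \<kappa>_def field_simps)
        finally have "wdeg U w {} - e / 4 \<le> wdeg U w {} - K / (\<kappa> * p) * 2 ^ l * wdeg U (G I) {}" by simp
        also have "\<dots> \<le> wdeg U R {}"
          unfolding R_def
        proof (rule rest_total[OF vG])
          show "0 < K / (\<kappa> * p)" using Suc.prems \<kappa> p by simp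
          show "\<Delta> j \<le> K / (\<kappa> * p) * \<tau> j" if "0 < j" for j
            using that Suc.prems \<kappa> p N by (cases j) (auto simp: \<Delta>_def \<tau>_def field_simps)
        qed
        finally have R: "3 / 4 * e \<le> wdeg U R {}" by (simp add: e_def)
        also have "wdeg U R {} \<le> real (Suc l) * wdeg U R {}"
          using R e by (simp add: mult_le_cancel_right1)
        also have "\<dots> = (\<Sum>v\<in>U. wdeg U R {v})"
          using w_support by (subst sum_wdeg_singletons[OF \<open>finite U\<close>, of _ "Suc l"])
            (auto simp: R_def unsaturated_def split: if_splits)
        also have "\<dots> = (\<Sum>v\<in>C I. wdeg U R {v}) + (\<Sum>v\<in>U - C I. wdeg U R {v})"
          using sum.subset_diff[OF C(2) \<open>finite U\<close>, of "\<lambda>v. wdeg U R {v}"] by simp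
        finally have 1: "3 / 4 * e \<le> (\<Sum>v\<in>C I. wdeg U R {v}) + (\<Sum>v\<in>U - C I. wdeg U R {v})" .
        have "(\<Sum>v\<in>C I. wdeg U R {v}) \<le> \<beta> * real (length xs) + (wdeg U (G I) {} - wdeg U (\<lambda>_. 0) {})"
          unfolding R_def G_def C_def
          by (rule container_degree_sum) (use xs e N in \<open>auto simp: \<beta>_def\<close>)
        also have "\<dots> \<le> \<beta> * N + e / 4"
        proof -
          have "real (length xs) \<le> N" using xs cbD distinct_card by fastforce
          moreover have "wdeg U (G I) {} \<le> e / 4"
          proof -
            have "p * e \<le> 1 / 4 * e" using p e by (intro mult_right_mono) auto
            then show ?thesis using False by linarith
          qed
          moreover have "wdeg U (\<lambda>_. 0) {} = 0" by (simp add: wdeg_def)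
          ultimately show ?thesis
            using e N by (intro add_mono mult_left_mono) (auto simp: \<beta>_def)
        qed
        also have "\<dots> = e / 2" using N by (simp add: \<beta>_def)
        \<comment> \<open>At least \<open>3 / 4 * e\<close> of the weight remains, while the
          container accounts for at most \<open>e / 2\<close> of the degree sum.\<close>
        finally have "e / 4 \<le> (\<Sum>v\<in>U - C I. wdeg U R {v})" using 1 by simp
        also have "\<dots> \<le> (\<Sum>v\<in>U - C I. K * e / N)"
        proof (rule sum_mono)
          fix v assume "v \<in> U - C I"
          then have "wdeg U w {v} \<le> K * e / N" using codegree[of "{v}"] by (simp add: \<Delta>_def)
          moreover have "wdeg U R {v} \<le> wdeg U w {v}"
            unfolding R_def by (rule wdeg_mono) (rule rest_le)
          ultimately show "wdeg U R {v} \<le> K * e / N" by linarith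
        qed
        also have "\<dots> = real (card (U - C I)) * K * e / N" by simp
        finally have "1 / (4 * K) * N \<le> real (card (U - C I))"
          using e N Suc.prems by (simp add: field_simps)
        moreover have "\<delta> * N \<le> 1 / (4 * K) * N"
          using N by (intro mult_right_mono) (auto simp: \<delta>_def)
        moreover have "0 \<le> M * p * N" using cardS by linarith
        ultimately show ?thesis
          using C cardS S_sub
          by (intro exI[of _ "S I # replicate l {}"]) (unfold fTs, auto)
      qed
    qed
  qed
  moreover have "0 < \<delta>" "0 < M" using \<delta>' Suc.prems M' by (auto simp: \<delta>_def M_def)
  ultimately show ?case
    by (intro exI[of _ \<delta>] exI[of _ M] conjI allI impI) simp_all
qed

lemma codegree_bounded_restrict:
  assumes cb: "codegree_bounded U w l K p N E" and C: "C \<subseteq> U"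
  shows "codegree_bounded C (\<lambda>B. if B \<subseteq> C then w B else 0) l K p N E"
proof -
  have fin: "finite U" using cb by (simp add: codegree_bounded_def)
  have nn: "0 \<le> w B" for B using cb by (simp add: codegree_bounded_def)
  have "wdeg C (\<lambda>B. if B \<subseteq> C then w B else 0) A \<le> K * p ^ (card A - 1) * E / N"
    if A: "A \<subseteq> C" "A \<noteq> {}" for A
  proof -
    have "wdeg C (\<lambda>B. if B \<subseteq> C then w B else 0) A = (\<Sum>B | B \<subseteq> C \<and> A \<subseteq> B. w B)"
      unfolding wdeg_def by (rule sum.cong) auto
    also have "\<dots> \<le> wdeg U w A"
      unfolding wdeg_def using fin C nn by (intro sum_mono2) auto
    also have "\<dots> \<le> K * p ^ (card A - 1) * E / N"
      using cb A order_trans[OF A(1) C] by (simp add: codegree_bounded_def)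
    finally show ?thesis .
  qed
  moreover have "finite C" using C fin by (rule finite_subset)
  moreover have "real (card C) \<le> N"
    using cb card_mono[OF fin C] by (simp add: codegree_bounded_def)
  moreover have "card B = l" if "w B \<noteq> 0" for B using cb that by (simp add: codegree_bounded_def)
  ultimately show ?thesis
    using nn by (simp add: codegree_bounded_def)
qed

text \<open>While a container still carries more than \<open>\<epsilon> * E\<close>, the codegree
  condition holds relative to its actual weight with \<open>K / \<epsilon>\<close> in place of
  \<open>K\<close>, and another round removes \<open>\<delta> * N\<close> vertices. About
  \<open>1 / \<delta>\<close> rounds exhaust the vertex set.\<close>

lemma containers:
  assumes "0 < (K::real)" "0 < \<epsilon>" "0 < l"
  shows "\<exists>m. \<exists>M>0. \<forall>(U::'v set) N p w E.
           codegree_bounded U w l K p N E \<and> 0 < p \<and> p \<le> 1 / 4 \<and> 0 < E \<longrightarrow>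
           has_containers U w m (M * p * N) (\<lambda>C. wdeg C w {} \<le> \<epsilon> * E)"
proof -
  have "0 < K / \<epsilon>" using assms by simp
  from container_step[OF this, of l] obtain \<delta> M where \<delta>: "0 < \<delta>" and M: "0 < M" and
    step: "\<And>(U::'v set) N p w. codegree_bounded U w l (K / \<epsilon>) p N (wdeg U w {}) \<Longrightarrow> 0 < p \<Longrightarrow>
       p \<le> 1 / 4 \<Longrightarrow> 0 < wdeg U w {} \<Longrightarrow>
       has_containers U w l (M * p * N) (\<lambda>C. \<delta> * N \<le> real (card (U - C)))"
    by blast
  \<comment> \<open>\<open>j\<close> bounds the number of rounds still possible, through the number
    of vertices left.\<close>
  have iter: "has_containers U w (j * l) (M * p * N) (\<lambda>C. wdeg C w {} \<le> \<epsilon> * E)"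
    if "codegree_bounded U w l K p N E" "real (card U) \<le> real j * \<delta> * N" "0 < p" "p \<le> 1 / 4" "0 < E"
    for j and U :: "'v set" and w N p E
    using that
  proof (induction j arbitrary: U w)
    case 0
    have "finite U" using "0.prems" by (simp add: codegree_bounded_def)
    then have "U = {}" using "0.prems" by simp
    moreover have "w {} = 0"
    proof (rule ccontr)
      assume "w {} \<noteq> 0"
      then have "card ({}::'v set) = l" using "0.prems"(1) unfolding codegree_bounded_def by blast
      then show False using assms by simp
    qed
    ultimately show ?case
      using "0.prems"(5) assms unfolding has_containers_def
      by (intro exI[of _ "\<lambda>_. {}"]) (auto simp: wdeg_def)
  next
    case (Suc j)
    note cb = Suc.prems(1)
    have fin: "finite U" and N0: "0 \<le> N"
      using cb by (auto simp: codegree_bounded_def intro: order_trans[OF of_nat_0_le_iff])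
    show ?case
    proof (cases "wdeg U w {} \<le> \<epsilon> * E")
      case True
      have "0 \<le> M * p * N" using M Suc.prems N0 by simp
      then show ?thesis
        using True unfolding has_containers_def
        by (intro exI[of _ "\<lambda>_. U"] allI impI exI[of _ "replicate (Suc j * l) {}"]) auto
    next
      case False
      then have pos: "0 < wdeg U w {}" using assms Suc.prems by (smt (verit) mult_pos_pos)
      have "wdeg U w A \<le> K / \<epsilon> * p ^ (card A - 1) * wdeg U w {} / N" if "A \<subseteq> U" "A \<noteq> {}" for A
      proof -
        have "wdeg U w A \<le> K * p ^ (card A - 1) * E / N"
          using cb that unfolding codegree_bounded_def by blast
        also have "\<dots> = (K / \<epsilon> * p ^ (card A - 1)) * (\<epsilon> * E) / N" using assms by simp
        also have "\<dots> \<le> (K / \<epsilon> * p ^ (card A - 1)) * wdeg U w {} / N"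
          using False assms Suc.prems N0 by (intro divide_right_mono mult_left_mono) auto
        finally show ?thesis .
      qed
      then have "codegree_bounded U w l (K / \<epsilon>) p N (wdeg U w {})"
        using cb unfolding codegree_bounded_def by blast
      from step[OF this Suc.prems(3,4) pos] obtain f1 where
        f1: "\<And>I. I \<subseteq> U \<Longrightarrow> indep_set w I \<Longrightarrow>
          \<exists>Ts. length Ts = l \<and> (\<forall>T\<in>set Ts. T \<subseteq> I \<and> real (card T) \<le> M * p * N) \<and>
              I \<subseteq> f1 Ts \<and> f1 Ts \<subseteq> U \<and> \<delta> * N \<le> real (card (U - f1 Ts))"
        unfolding has_containers_def by blast
      define wr where "wr = (\<lambda>C B. if B \<subseteq> C then w B else (0::real))"
      define good where "good = (\<lambda>C f. \<forall>I\<subseteq>C. indep_set (wr C) I \<longrightarrow>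
        (\<exists>Ts. length Ts = j * l \<and> (\<forall>T\<in>set Ts. T \<subseteq> I \<and> real (card T) \<le> M * p * N) \<and>
              I \<subseteq> f Ts \<and> f Ts \<subseteq> C \<and> wdeg (f Ts) (wr C) {} \<le> \<epsilon> * E))"
      \<comment> \<open>Chosen per container rather than per independent set, so that the
        concatenated list still determines the result.\<close>
      define f2 where "f2 = (\<lambda>C. SOME f. good C f)"
      have f2: "good C (f2 C)" if C: "C \<subseteq> U" "\<delta> * N \<le> real (card (U - C))" for C
      proof -
        have "real (card C) = real (card U) - real (card (U - C))"
          using C fin by (simp add: card_Diff_subset finite_subset card_mono of_nat_diff)
        then have "real (card C) \<le> real j * \<delta> * N"
          using C Suc.prems(2) by (simp add: algebra_simps)
        then have "has_containers C (wr C) (j * l) (M * p * N) (\<lambda>C'. wdeg C' (wr C) {} \<le> \<epsilon> * E)"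
          unfolding wr_def
          using Suc.prems codegree_bounded_restrict[OF cb C(1)] by (intro Suc.IH) auto
        then have "\<exists>f. good C f" by (simp only: has_containers_def good_def)
        then show ?thesis unfolding f2_def by (rule someI_ex)
      qed
      define f where "f = (\<lambda>Ts. f2 (f1 (take l Ts)) (drop l Ts))"
      show ?thesis
        unfolding has_containers_def
      proof (intro exI[of _ f] allI impI)
        fix I assume I: "I \<subseteq> U" "indep_set w I"
        from f1[OF this] obtain Ts1 where Ts1: "length Ts1 = l"
          "\<forall>T\<in>set Ts1. T \<subseteq> I \<and> real (card T) \<le> M * p * N"
          "I \<subseteq> f1 Ts1" "f1 Ts1 \<subseteq> U" "\<delta> * N \<le> real (card (U - f1 Ts1))" by blast
        have "indep_set (wr (f1 Ts1)) I" using I by (simp add: indep_set_def wr_def)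
        with f2[OF Ts1(4,5)] Ts1(3) have "\<exists>Ts. length Ts = j * l \<and>
            (\<forall>T\<in>set Ts. T \<subseteq> I \<and> real (card T) \<le> M * p * N) \<and>
              I \<subseteq> f2 (f1 Ts1) Ts \<and> f2 (f1 Ts1) Ts \<subseteq> f1 Ts1 \<and>
              wdeg (f2 (f1 Ts1) Ts) (wr (f1 Ts1)) {} \<le> \<epsilon> * E"
          by (simp only: good_def)
        then obtain Ts2 where Ts2: "length Ts2 = j * l"
          "\<forall>T\<in>set Ts2. T \<subseteq> I \<and> real (card T) \<le> M * p * N"
          "I \<subseteq> f2 (f1 Ts1) Ts2" "f2 (f1 Ts1) Ts2 \<subseteq> f1 Ts1"
          "wdeg (f2 (f1 Ts1) Ts2) (wr (f1 Ts1)) {} \<le> \<epsilon> * E" by blast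
        have eq: "f (Ts1 @ Ts2) = f2 (f1 Ts1) Ts2" using Ts1(1) by (simp add: f_def)
        have "wdeg (f2 (f1 Ts1) Ts2) (wr (f1 Ts1)) {} = wdeg (f2 (f1 Ts1) Ts2) w {}"
          unfolding wdeg_def wr_def using Ts2(4) by (intro sum.cong) auto
        then show "\<exists>Ts. length Ts = Suc j * l \<and> (\<forall>T\<in>set Ts. T \<subseteq> I \<and> real (card T) \<le> M * p * N) \<and>
              I \<subseteq> f Ts \<and> f Ts \<subseteq> U \<and> wdeg (f Ts) w {} \<le> \<epsilon> * E"
          using Ts1 Ts2 by (intro exI[of _ "Ts1 @ Ts2"]) (unfold eq, auto)
      qed
    qed
  qed
  define j where "j = nat \<lceil>1 / \<delta>\<rceil>"
  have "1 / \<delta> \<le> real j" unfolding j_def by linarith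
  then have j: "1 \<le> real j * \<delta>" using \<delta> by (simp add: field_simps)
  have "has_containers U w (j * l) (M * p * N) (\<lambda>C. wdeg C w {} \<le> \<epsilon> * E)"
    if cb: "codegree_bounded U w l K p N E" and p: "0 < p" "p \<le> 1 / 4" "0 < E"
    for U :: "'v set" and w N p E
  proof (rule iter[OF cb _ p])
    have cN: "real (card U) \<le> N" using cb by (simp add: codegree_bounded_def)
    then have "0 \<le> N" by (rule order_trans[OF of_nat_0_le_iff])
    then have "1 * N \<le> real j * \<delta> * N" using j by (intro mult_right_mono) auto
    then show "real (card U) \<le> real j * \<delta> * N" using cN by linarith
  qed
  then show ?thesis using M by blast
qed

section \<open>Copies of a fixed hypergraph\<close>

definition embeddings :: "'a hypergraph \<Rightarrow> nat \<Rightarrow> ('a \<Rightarrow> nat) set" where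
  "embeddings F n = {\<phi> \<in> verts F \<rightarrow>\<^sub>E {..<n}. inj_on \<phi> (verts F)}"

abbreviation copy :: "('a \<Rightarrow> nat) \<Rightarrow> 'a set set \<Rightarrow> nat set set" where
  "copy \<phi> E \<equiv> (\<lambda>e. \<phi> ` e) ` E"

lemma finite_embeddings: "finite (verts F) \<Longrightarrow> finite (embeddings F n)"
  unfolding embeddings_def by (rule finite_subset[OF _ finite_PiE[of "verts F" "\<lambda>_. {..<n}"]]) auto

lemma card_embeddings_le: "finite (verts F) \<Longrightarrow> card (embeddings F n) \<le> n ^ card (verts F)"
  using card_mono[of "verts F \<rightarrow>\<^sub>E {..<n}" "embeddings F n"]
  by (simp add: card_funcsetE finite_PiE embeddings_def)

lemma finite_edges: "uniform_hypergraph k F \<Longrightarrow> finite (edges F)"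
  unfolding uniform_hypergraph_def by (rule finite_subset[of _ "Pow (verts F)"]) auto

lemma copy_subset_k_subsets:
  assumes "uniform_hypergraph k F" "\<phi> \<in> embeddings F n"
  shows "copy \<phi> (edges F) \<subseteq> k_subsets k n"
proof
  fix f assume "f \<in> copy \<phi> (edges F)"
  then obtain e where e: "e \<in> edges F" "f = \<phi> ` e" by auto
  have eF: "e \<subseteq> verts F" and "card e = k" using e assms by (auto simp: uniform_hypergraph_def)
  moreover have "card f = card e"
    using assms(2) inj_on_subset[of \<phi>, OF _ eF] unfolding e(2)
    by (intro card_image) (simp add: embeddings_def)
  moreover have "f \<subseteq> {..<n}" using e(2) eF assms(2) by (auto simp: embeddings_def)
  ultimately show "f \<in> k_subsets k n" by (simp add: k_subsets_def)
qed

lemma inj_on_image_edges: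
  assumes "uniform_hypergraph k F" "inj_on \<phi> (verts F)" "E \<subseteq> edges F"
  shows "inj_on (\<lambda>e. \<phi> ` e) E"
  using assms unfolding uniform_hypergraph_def
  by (intro inj_onI) (metis inj_on_image_eq_iff subset_iff)

lemma card_copy:
  assumes "uniform_hypergraph k F" "\<phi> \<in> embeddings F n" "E \<subseteq> edges F"
  shows "card (copy \<phi> E) = card E"
  using assms by (intro card_image inj_on_image_edges) (auto simp: embeddings_def)

lemma finite_k_subsets: "finite (k_subsets k n)"
  unfolding k_subsets_def by (rule finite_subset[of _ "Pow {..<n}"]) auto

lemma card_k_subsets_le: "card (k_subsets k n) \<le> n ^ k"
proof -
  have "card (k_subsets k n) = n choose k" unfolding k_subsets_def by (simp add: n_subsets)
  also have "\<dots> \<le> n ^ k" by (cases "k \<le> n") (auto intro: binomial_le_pow simp: binomial_eq_0)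
  finally show ?thesis .
qed

text \<open>The vertices of \<open>\<Union>E\<close> are mapped onto \<open>\<Union>A\<close>, a set
  of the same size, in boundedly many ways; every other vertex has at most \<open>n\<close> images.
  This count is the source of the powers of \<open>n\<close> in both the codegree and the overlap
  bounds.\<close>

lemma card_embeddings_fixed:
  assumes F: "uniform_hypergraph k F" and E: "E \<subseteq> edges F"
  shows "card {\<phi>\<in>embeddings F n. copy \<phi> E = A}
           \<le> card (verts F) ^ card (verts F) * n ^ (card (verts F) - card (\<Union>E))"
proof (cases "{\<phi>\<in>embeddings F n. copy \<phi> E = A} = {}")
  case False
  define V W Z where "V = verts F" and "W = \<Union>E" and "Z = \<Union>A"
  let ?S = "{\<phi>\<in>embeddings F n. copy \<phi> E = A}"
  have finV: "finite V" using F by (simp add: V_def uniform_hypergraph_def)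
  have WV: "W \<subseteq> V" using F E by (auto simp: W_def V_def uniform_hypergraph_def)
  have finW: "finite W" using WV finV by (rule finite_subset)
  have img: "\<phi> ` W = Z" if "\<phi> \<in> ?S" for \<phi> using that by (auto simp: W_def Z_def)
  from False obtain \<phi>0 where \<phi>0: "\<phi>0 \<in> ?S" by auto
  have "inj_on \<phi>0 W" using \<phi>0 WV inj_on_subset[of \<phi>0 V W] by (simp add: embeddings_def V_def)
  then have "card Z = card W" using img[OF \<phi>0] card_image by metis
  have finZ: "finite Z" using img[OF \<phi>0] finW by auto
  let ?h = "\<lambda>\<phi>. (restrict \<phi> W, restrict \<phi> (V - W))"
  let ?T = "(W \<rightarrow>\<^sub>E Z) \<times> ((V - W) \<rightarrow>\<^sub>E {..<n})"
  have "inj_on ?h ?S"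
  proof (rule inj_onI)
    fix \<phi> \<psi> assume \<phi>: "\<phi> \<in> ?S" and \<psi>: "\<psi> \<in> ?S" and eq: "?h \<phi> = ?h \<psi>"
    show "\<phi> = \<psi>"
    proof
      fix x
      have "\<phi> x = \<psi> x" if "x \<in> W" using eq that by (metis (no_types, lifting) Pair_inject restrict_apply')
      moreover have "\<phi> x = \<psi> x" if "x \<in> V - W"
        using eq that by (metis (no_types, lifting) Pair_inject restrict_apply')
      moreover have "\<phi> x = \<psi> x" if "x \<notin> V"
        using \<phi> \<psi> that by (auto simp: embeddings_def V_def PiE_def extensional_def)
      ultimately show "\<phi> x = \<psi> x" by blast
    qed
  qed
  moreover have "?h ` ?S \<subseteq> ?T"
  proof (rule image_subsetI)
    fix \<phi> assume \<phi>: "\<phi> \<in> ?S"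
    then have "\<phi> \<in> V \<rightarrow> {..<n}" by (auto simp: embeddings_def V_def)
    then show "?h \<phi> \<in> ?T" using img[OF \<phi>] by auto
  qed
  moreover have "finite ?T" using finW finZ finV by (intro finite_cartesian_product finite_PiE) auto
  ultimately have "card ?S \<le> card ?T" by (rule card_inj_on_le)
  also have "\<dots> = card W ^ card W * n ^ (card V - card W)"
    using finW finV WV \<open>card Z = card W\<close>
    by (simp add: card_cartesian_product card_funcsetE card_Diff_subset)
  also have "\<dots> \<le> card V ^ card V * n ^ (card V - card W)"
  proof (rule mult_right_mono)
    have "card W \<le> card V" using WV finV by (rule card_mono[rotated])
    moreover have "card W ^ card W \<le> card V ^ card W" using calculation by (rule power_mono) simp
    moreover have "card V ^ card W \<le> card V ^ card V" if "0 < card V"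
      using calculation that by (intro power_increasing) auto
    ultimately show "card W ^ card W \<le> card V ^ card V" by (cases "card V = 0") auto
  qed simp
  finally show ?thesis by (simp add: V_def W_def)
next
  case True
  show ?thesis unfolding True by simp
qed

text \<open>The hypergraph fed to the container theorem has the \<open>k\<close>-subsets as vertices
  and the edge sets of copies as edges, weighted so that degrees count embeddings.\<close>

definition copy_weight :: "'a hypergraph \<Rightarrow> nat \<Rightarrow> nat set set \<Rightarrow> real" where
  "copy_weight F n B = real (card {\<phi>\<in>embeddings F n. copy \<phi> (edges F) = B})"

lemma wdeg_copy_weight:
  assumes F: "uniform_hypergraph k F" and U: "finite U"
  shows "wdeg U (copy_weight F n) A =
    real (card {\<phi>\<in>embeddings F n. A \<subseteq> copy \<phi> (edges F) \<and> copy \<phi> (edges F) \<subseteq> U})"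
proof -
  let ?B = "{B. B \<subseteq> U \<and> A \<subseteq> B}"
  have fin: "finite (embeddings F n)" using F by (intro finite_embeddings) (simp add: uniform_hypergraph_def)
  have "wdeg U (copy_weight F n) A = real (\<Sum>B\<in>?B. card {\<phi>\<in>embeddings F n. copy \<phi> (edges F) = B})"
    by (simp add: wdeg_def copy_weight_def)
  also have "(\<Sum>B\<in>?B. card {\<phi>\<in>embeddings F n. copy \<phi> (edges F) = B}) =
      card (\<Union>B\<in>?B. {\<phi>\<in>embeddings F n. copy \<phi> (edges F) = B})"
    using U fin by (intro card_UN_disjoint[symmetric]) auto
  also have "(\<Union>B\<in>?B. {\<phi>\<in>embeddings F n. copy \<phi> (edges F) = B}) =
      {\<phi>\<in>embeddings F n. A \<subseteq> copy \<phi> (edges F) \<and> copy \<phi> (edges F) \<subseteq> U}" by auto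
  finally show ?thesis .
qed

lemma finite_subhypergraphs:
  assumes "uniform_hypergraph k F"
  shows "finite {H. subhypergraph H F}"
proof (rule finite_subset)
  show "{H. subhypergraph H F} \<subseteq> (\<lambda>(V, E). Hypergraph V E) ` (Pow (verts F) \<times> Pow (edges F))"
  proof
    fix H assume "H \<in> {H. subhypergraph H F}"
    then show "H \<in> (\<lambda>(V, E). Hypergraph V E) ` (Pow (verts F) \<times> Pow (edges F))"
      by (intro image_eqI[of _ _ "(verts H, edges H)"]) (auto simp: subhypergraph_def)
  qed
  show "finite ((\<lambda>(V, E). Hypergraph V E) ` (Pow (verts F) \<times> Pow (edges F)))"
    using finite_edges[OF assms] assms by (auto simp: uniform_hypergraph_def)
qed

lemma subhypergraph_spanned: "E \<subseteq> edges F \<Longrightarrow> uniform_hypergraph k F \<Longrightarrow> subhypergraph (Hypergraph (\<Union>E) E) F"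
  by (auto simp: subhypergraph_def uniform_hypergraph_def)

text \<open>Keeps the denominator of the \<open>k\<close>-density positive from two edges
  on.\<close>

lemma card_Union_edges_gt:
  assumes F: "uniform_hypergraph k F" and E: "E \<subseteq> edges F" "2 \<le> card E"
  shows "k < card (\<Union>E)"
proof -
  have "\<Union>E \<subseteq> verts F" "finite (verts F)" using F E(1) unfolding uniform_hypergraph_def by blast+
  then have finU: "finite (\<Union>E)" by (rule finite_subset)
  have "finite E" using E(2) by (intro card_ge_0_finite) linarith
  then obtain e e' where e: "e \<in> E" "e' \<in> E" "e \<noteq> e'"
    using E(2) card_le_Suc0_iff_eq[of E] by auto
  have c: "card e = k" "card e' = k" using e F E by (auto simp: uniform_hypergraph_def)
  have "e \<subset> \<Union>E"
  proof
    show "e \<subseteq> \<Union>E" using e by auto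
    show "e \<noteq> \<Union>E"
    proof
      assume "e = \<Union>E"
      then have "e' \<subseteq> e" "finite e" using e finU by auto
      then show False using card_subset_eq[of e e'] c e by auto
    qed
  qed
  then show ?thesis using psubset_card_mono[OF finU] c by auto
qed

text \<open>For a single edge both sides vanish; from two edges on this is the density of the
  subhypergraph spanned by \<open>E\<close>, cleared of its denominator.\<close>

lemma density_bound:
  assumes F: "uniform_hypergraph k F" and m: "max_k_dens k F \<le> m" "0 < m"
    and E: "E \<subseteq> edges F" "E \<noteq> {}"
  shows "(real (card E) - 1) / m \<le> real (card (\<Union>E)) - real k"
proof -
  have "finite E" using finite_edges[OF F] E finite_subset by blast
  then have "0 < card E" using E by (simp add: card_gt_0_iff)
  then consider "card E = 1" | "2 \<le> card E" by linarith
  then show ?thesis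
  proof cases
    case 1
    then obtain e where "E = {e}" by (auto simp: card_1_singleton_iff)
    then show ?thesis using 1 F E by (auto simp: uniform_hypergraph_def)
  next
    case 2
    have gt: "k < card (\<Union>E)" by (rule card_Union_edges_gt[OF F E(1) 2])
    have "k_dens k (Hypergraph (\<Union>E) E) \<le> max_k_dens k F"
      unfolding max_k_dens_def using finite_subhypergraphs[OF F] subhypergraph_spanned[OF E(1) F]
      by (intro Max_ge) auto
    then have "(real (card E) - 1) / (real (card (\<Union>E)) - real k) \<le> m"
      using 2 m gt by (simp add: k_dens_def)
    then show ?thesis using gt m by (simp add: field_simps)
  qed
qed

text \<open>Edges whose image is a set \<open>A\<close> of size \<open>j\<close> span at least
  \<open>k + (j - 1) / m\<close> vertices. At most a constant times
  \<open>n powr (v - k - (j - 1) / m)\<close> embeddings thus cover \<open>A\<close>,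
  \<open>v\<close> being the number of vertices of \<open>F\<close>; this is the codegree condition
  at density \<open>n powr (- 1 / m)\<close>. As \<open>m\<close> only has to dominate the density
  of \<open>F\<close>, a single \<open>m\<close> serves all colours.\<close>

lemma codegree_bounded_copies:
  fixes n :: nat
  assumes F: "uniform_hypergraph k F" and m: "max_k_dens k F \<le> m" "0 < m"
    and e: "1 \<le> card (edges F)" and n: "1 \<le> n"
  shows "codegree_bounded (k_subsets k n) (copy_weight F n) (card (edges F))
     (2 ^ card (edges F) * real (card (verts F)) ^ card (verts F)) (real n powr (- 1 / m))
     (real n ^ k) (real n ^ card (verts F))"
  unfolding codegree_bounded_def
proof (intro conjI allI impI)
  show "finite (k_subsets k n)" by (rule finite_k_subsets)
  show "real (card (k_subsets k n)) \<le> real n ^ k"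
    using card_k_subsets_le[of k n] by (metis of_nat_le_iff of_nat_power)
  show "0 \<le> copy_weight F n B" for B by (simp add: copy_weight_def)
  fix B assume "copy_weight F n B \<noteq> 0"
  then obtain \<phi> where \<phi>: "\<phi> \<in> embeddings F n" "copy \<phi> (edges F) = B"
    by (metis (mono_tags, lifting) card.empty copy_weight_def empty_Collect_eq of_nat_0)
  show "B \<subseteq> k_subsets k n" using copy_subset_k_subsets[OF F \<phi>(1)] \<phi>(2) by simp
  show "card B = card (edges F)" using card_copy[OF F \<phi>(1)] \<phi>(2) by auto
next
  fix A assume A: "A \<subseteq> k_subsets k n" "A \<noteq> {}"
  define v where "v = card (verts F)"
  let ?q = "real n powr (- 1 / m)"
  let ?E = "{E. E \<subseteq> edges F \<and> card E = card A}"
  have finV: "finite (verts F)" using F by (simp add: uniform_hypergraph_def)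
  have finA: "finite A" using A finite_k_subsets finite_subset by blast
  have finE: "finite ?E" using finite_edges[OF F] by auto
  have sub: "{\<phi>\<in>embeddings F n. A \<subseteq> copy \<phi> (edges F) \<and> copy \<phi> (edges F) \<subseteq> k_subsets k n}
      \<subseteq> (\<Union>E\<in>?E. {\<phi>\<in>embeddings F n. copy \<phi> E = A})"
  proof
    fix \<phi> assume "\<phi> \<in> {\<phi>\<in>embeddings F n. A \<subseteq> copy \<phi> (edges F) \<and> copy \<phi> (edges F) \<subseteq> k_subsets k n}"
    then have \<phi>: "\<phi> \<in> embeddings F n" "A \<subseteq> copy \<phi> (edges F)" by auto
    define E where "E = {e\<in>edges F. \<phi> ` e \<in> A}"
    have "copy \<phi> E = A" using \<phi>(2) by (auto simp: E_def)
    moreover have "card (copy \<phi> E) = card E" by (rule card_copy[OF F \<phi>(1)]) (auto simp: E_def)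
    ultimately show "\<phi> \<in> (\<Union>E\<in>?E. {\<phi>\<in>embeddings F n. copy \<phi> E = A})"
      using \<phi>(1) by (auto simp: E_def intro!: exI[of _ E])
  qed
  have "wdeg (k_subsets k n) (copy_weight F n) A \<le>
      real (card (\<Union>E\<in>?E. {\<phi>\<in>embeddings F n. copy \<phi> E = A}))"
    unfolding wdeg_copy_weight[OF F finite_k_subsets] of_nat_le_iff
    using finE finite_embeddings[OF finV] by (intro card_mono[OF _ sub]) auto
  also have "\<dots> \<le> real (\<Sum>E\<in>?E. card {\<phi>\<in>embeddings F n. copy \<phi> E = A})"
    unfolding of_nat_le_iff by (rule card_UN_le[OF finE])
  also have "\<dots> = (\<Sum>E\<in>?E. real (card {\<phi>\<in>embeddings F n. copy \<phi> E = A}))" by simp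
  also have "\<dots> \<le> (\<Sum>E\<in>?E. real v ^ v * (?q ^ (card A - 1) * real n ^ v / real n ^ k))"
  proof (rule sum_mono)
    fix E assume "E \<in> ?E"
    then have E: "E \<subseteq> edges F" "card E = card A" by auto
    have "0 < card A" using finA A by (simp add: card_gt_0_iff)
    then have "E \<noteq> {}" using E by auto
    have UV: "card (\<Union>E) \<le> v" unfolding v_def
      using E F by (intro card_mono[OF finV]) (auto simp: uniform_hypergraph_def)
    have "real (card {\<phi>\<in>embeddings F n. copy \<phi> E = A}) \<le> real (v ^ v * n ^ (v - card (\<Union>E)))"
      unfolding v_def of_nat_le_iff by (rule card_embeddings_fixed[OF F E(1)])
    also have "\<dots> = real v ^ v * real n powr (real v - real (card (\<Union>E)))"
      using n UV by (simp add: powr_realpow[symmetric] of_nat_diff)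
    also have "\<dots> \<le> real v ^ v * real n powr (real v - real k - (real (card A) - 1) / m)"
      using density_bound[OF F m E(1) \<open>E \<noteq> {}\<close>] E(2) n
      by (intro mult_left_mono powr_mono) auto
    also have "real n powr (real v - real k - (real (card A) - 1) / m) =
       ?q ^ (card A - 1) * real n ^ v / real n ^ k"
    proof -
      have "?q ^ (card A - 1) = real n powr (- 1 / m * real (card A - 1))"
        using n by (simp add: powr_realpow[symmetric] powr_powr)
      also have "real (card A - 1) = real (card A) - 1" using \<open>0 < card A\<close> by simp
      finally have q: "?q ^ (card A - 1) = real n powr (- 1 / m * (real (card A) - 1))" .
      have pow: "real n ^ j = real n powr real j" for j using n by (simp add: powr_realpow)
      show ?thesis
        unfolding q pow powr_add[symmetric] powr_diff[symmetric]
        by (rule arg_cong[where f = "\<lambda>x. real n powr x"]) (simp add: algebra_simps diff_divide_distrib)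
    qed
    finally show "real (card {\<phi>\<in>embeddings F n. copy \<phi> E = A}) \<le>
      real v ^ v * (?q ^ (card A - 1) * real n ^ v / real n ^ k)" .
  qed
  also have "\<dots> = real (card ?E) * (real v ^ v * (?q ^ (card A - 1) * real n ^ v / real n ^ k))"
    by simp
  also have "\<dots> \<le> 2 ^ card (edges F) * (real v ^ v * (?q ^ (card A - 1) * real n ^ v / real n ^ k))"
  proof (rule mult_right_mono)
    have "card ?E \<le> card (Pow (edges F))" using finite_edges[OF F] by (intro card_mono) auto
    then show "real (card ?E) \<le> 2 ^ card (edges F)"
      using finite_edges[OF F] by (simp add: card_Pow)
  qed auto
  finally show "wdeg (k_subsets k n) (copy_weight F n) A \<le>
      2 ^ card (edges F) * real (card (verts F)) ^ card (verts F) * ?q ^ (card A - 1) *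
      real n ^ card (verts F) / real n ^ k"
    by (simp add: v_def mult.assoc)
qed

section \<open>Supersaturation\<close>

text \<open>Double counting: by Ramsey's theorem every \<open>R\<close>-subset of the vertices
  contains a copy of some \<open>F i\<close> in colour \<open>i\<close>, while a copy on
  \<open>v i\<close> vertices lies in at most \<open>n ^ (R - v i)\<close> such subsets.\<close>

lemma ramsey_supersaturation:
  fixes F :: "nat \<Rightarrow> 'a hypergraph"
  assumes r: "1 \<le> r" and F: "\<And>i. i \<in> {1..r} \<Longrightarrow> uniform_hypergraph k (F i)"
  shows "\<exists>\<delta>>0. \<exists>n0. \<forall>n\<ge>n0. \<forall>c. (\<forall>e\<in>k_subsets k n. c e \<in> {1..r}) \<longrightarrow>
    (\<exists>i\<in>{1..r}. \<delta> * real n ^ card (verts (F i)) \<le>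
       real (card {\<phi>\<in>embeddings (F i) n. \<forall>e\<in>edges (F i). c (\<phi> ` e) = i}))"
proof -
  define v where "v = (\<lambda>i. card (verts (F i)))"
  \<comment> \<open>A monochromatic clique on \<open>Q\<close> vertices has room for every
    \<open>F i\<close>; adding \<open>Q\<close> to \<open>R\<close> below keeps
    \<open>R - v i\<close> free of truncation.\<close>
  define Q where "Q = (\<Sum>i\<in>{1..r}. v i)"
  have vQ: "v i \<le> Q" if "i \<in> {1..r}" for i unfolding Q_def using that by (intro member_le_sum) auto
  obtain N0 where N0: "partn_lst {..<N0::nat} (replicate r Q) k" using ramsey_full by blast
  define R where "R = N0 + Q + 1"
  have part: "partn_lst {..<R} (replicate r Q) k"
    using N0 by (rule partn_lst_greater_resource) (simp add: R_def)
  \<comment> \<open>With this value \<open>r\<close> colours of at most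
    \<open>\<delta> * n ^ v i\<close> copies each reach only half of the \<open>(n / R) ^ R\<close>
    or more subsets.\<close>
  define \<delta> where "\<delta> = 1 / (2 * real r * real R ^ R)"
  have "R > 0" by (simp add: R_def)
  have \<delta>: "0 < \<delta>" using r \<open>R > 0\<close> by (simp add: \<delta>_def)
  have "\<exists>i\<in>{1..r}. \<delta> * real n ^ v i \<le>
       real (card {\<phi>\<in>embeddings (F i) n. \<forall>e\<in>edges (F i). c (\<phi> ` e) = i})"
    if n: "R \<le> n" and c: "\<forall>e\<in>k_subsets k n. c e \<in> {1..r}" for n c
  proof (rule ccontr)
    define Mono where "Mono = (\<lambda>i. {\<phi>\<in>embeddings (F i) n. \<forall>e\<in>edges (F i). c (\<phi> ` e) = i})"
    assume "\<not> ?thesis"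
    then have few: "real (card (Mono i)) \<le> \<delta> * real n ^ v i" if "i \<in> {1..r}" for i
      using that by (force simp: Mono_def)
    define \<W> where "\<W> = {W. W \<subseteq> {..<n} \<and> card W = R}"
    have ex: "\<exists>i\<in>{1..r}. \<exists>\<phi>\<in>Mono i. \<phi> ` verts (F i) \<subseteq> W" if W: "W \<in> \<W>" for W
    proof -
      have finW: "finite W" "card W = R" "W \<subseteq> {..<n}"
        using W finite_subset[of W "{..<n}"] by (auto simp: \<W>_def)
      obtain h where "bij_betw h {0..<card W} W" using ex_bij_betw_nat_finite[OF finW(1)] by blast
      then have h: "bij_betw h {..<R} W" using finW(2) by (simp add: atLeast0LessThan)
      have hW: "h ` {..<R} = W" and hinj: "inj_on h {..<R}" using h by (auto simp: bij_betw_def)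
      have hk: "h ` e \<in> k_subsets k n" if "e \<in> nsets {..<R} k" for e
      proof -
        have e: "e \<subseteq> {..<R}" "card e = k" using that by (auto simp: nsets_def)
        have "card (h ` e) = k" using card_image[OF inj_on_subset[OF hinj e(1)]] e(2) by simp
        moreover have "h ` e \<subseteq> {..<n}" using e(1) hW finW(3) by auto
        ultimately show ?thesis by (simp add: k_subsets_def)
      qed
      \<comment> \<open>Colours start at 1 here, but at 0 in \<open>partn_lst\<close>.\<close>
      let ?f = "\<lambda>e. c (h ` e) - 1"
      have "?f \<in> nsets {..<R} k \<rightarrow> {..<r}"
      proof
        fix e assume "e \<in> nsets {..<R} k"
        then have "c (h ` e) \<in> {1..r}" using hk c by blast
        then show "?f e \<in> {..<r}" by auto
      qed
      then obtain i H where i: "i < r" and H: "H \<in> nsets {..<R} (replicate r Q ! i)"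
        and mono: "?f ` nsets H k \<subseteq> {i}"
        using partn_lstE[OF part, of ?f r] by auto
      have H': "H \<subseteq> {..<R}" "card H = Q" "finite H" using H i by (auto simp: nsets_def)
      define j where "j = Suc i"
      have j: "j \<in> {1..r}" using i by (auto simp: j_def)
      have finV: "finite (verts (F j))" using F[OF j] by (simp add: uniform_hypergraph_def)
      have "card (verts (F j)) \<le> card H" using vQ[OF j] H' by (simp add: v_def)
      then obtain g where g: "g ` verts (F j) \<subseteq> H" "inj_on g (verts (F j))"
        using card_le_inj[OF finV H'(3)] by blast
      define \<phi> where "\<phi> = restrict (h \<circ> g) (verts (F j))"
      have "inj_on (h \<circ> g) (verts (F j))"
        using g H' hinj by (intro comp_inj_on) (auto intro: inj_on_subset)
      then have inj: "inj_on \<phi> (verts (F j))" unfolding \<phi>_def by (simp add: inj_on_restrict_eq)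
      have img: "\<phi> ` verts (F j) \<subseteq> W" using g H' hW by (auto simp: \<phi>_def)
      have "\<phi> x \<in> {..<n}" if "x \<in> verts (F j)" for x using img finW(3) that by blast
      then have "\<phi> \<in> embeddings (F j) n"
        using inj by (auto simp: embeddings_def \<phi>_def)
      moreover have "c (\<phi> ` e) = j" if e: "e \<in> edges (F j)" for e
      proof -
        have eV: "e \<subseteq> verts (F j)" "card e = k" using F[OF j] e by (auto simp: uniform_hypergraph_def)
        have "g ` e \<in> nsets H k"
          using eV g inj_on_subset[OF g(2) eV(1)] finV finite_subset[OF eV(1) finV]
          by (auto simp: nsets_def card_image)
        then have "c (h ` g ` e) - 1 = i" and "g ` e \<in> nsets {..<R} k"
          using mono H' by (auto simp: nsets_def)
        moreover have "c (h ` g ` e) \<in> {1..r}" using hk[OF calculation(2)] c by blast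
        moreover have "\<phi> ` e = h ` g ` e" using eV by (auto simp: \<phi>_def image_image)
        ultimately show ?thesis by (auto simp: j_def)
      qed
      ultimately have "\<phi> \<in> Mono j" by (simp add: Mono_def)
      then show ?thesis using j img by blast
    qed
    have finMono: "finite (Mono i)" if "i \<in> {1..r}" for i
      using finite_embeddings[of "F i" n] F[OF that] by (simp add: Mono_def uniform_hypergraph_def)
    have ext: "card {W\<in>\<W>. \<phi> ` verts (F i) \<subseteq> W} \<le> n ^ (R - v i)"
      if i: "i \<in> {1..r}" and \<phi>: "\<phi> \<in> Mono i" for i \<phi>
    proof -
      define Y where "Y = \<phi> ` verts (F i)"
      have finV: "finite (verts (F i))" using F[OF i] by (simp add: uniform_hypergraph_def)
      have cY: "card Y = v i" and finY: "finite Y"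
        using \<phi> finV by (auto simp: Y_def v_def Mono_def embeddings_def card_image)
      have "inj_on (\<lambda>W. W - Y) {W\<in>\<W>. Y \<subseteq> W}" by (rule inj_onI) auto
      moreover have "(\<lambda>W. W - Y) ` {W\<in>\<W>. Y \<subseteq> W} \<subseteq> k_subsets (R - v i) n"
        using finY cY by (auto simp: \<W>_def k_subsets_def card_Diff_subset)
      ultimately have "card {W\<in>\<W>. Y \<subseteq> W} \<le> card (k_subsets (R - v i) n)"
        using finite_k_subsets by (rule card_inj_on_le)
      also have "\<dots> \<le> n ^ (R - v i)" by (rule card_k_subsets_le)
      finally show ?thesis by (simp add: Y_def)
    qed
    have vR: "v i \<le> R" if "i \<in> {1..r}" for i using vQ[OF that] by (simp add: R_def)
    have n0: "0 < n" using n \<open>R > 0\<close> by linarith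
    have fin\<W>: "finite \<W>" unfolding \<W>_def by (rule finite_subset[of _ "Pow {..<n}"]) auto
    have "(real n / real R) ^ R \<le> real (n choose R)" by (rule binomial_ge_n_over_k_pow_k[OF n])
    also have "n choose R = card \<W>" unfolding \<W>_def by (simp add: n_subsets)
    also have "real (card \<W>) \<le> real (card (\<Union>i\<in>{1..r}. \<Union>\<phi>\<in>Mono i. {W\<in>\<W>. \<phi> ` verts (F i) \<subseteq> W}))"
      unfolding of_nat_le_iff
    proof (rule card_mono)
      show "finite (\<Union>i\<in>{1..r}. \<Union>\<phi>\<in>Mono i. {W\<in>\<W>. \<phi> ` verts (F i) \<subseteq> W})"
        using fin\<W> finMono by auto
      show "\<W> \<subseteq> (\<Union>i\<in>{1..r}. \<Union>\<phi>\<in>Mono i. {W\<in>\<W>. \<phi> ` verts (F i) \<subseteq> W})"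
        using ex by blast
    qed
    also have "\<dots> \<le> real (\<Sum>i\<in>{1..r}. \<Sum>\<phi>\<in>Mono i. card {W\<in>\<W>. \<phi> ` verts (F i) \<subseteq> W})"
      unfolding of_nat_le_iff
      by (intro order_trans[OF card_UN_le] sum_mono card_UN_le finMono) auto
    also have "\<dots> \<le> real (\<Sum>i\<in>{1..r}. \<Sum>\<phi>\<in>Mono i. n ^ (R - v i))"
      unfolding of_nat_le_iff by (intro sum_mono ext)
    also have "\<dots> = (\<Sum>i\<in>{1..r}. real (card (Mono i)) * real n ^ (R - v i))" by simp
    also have "\<dots> \<le> (\<Sum>i\<in>{1..r}. \<delta> * real n ^ v i * real n ^ (R - v i))"
      by (intro sum_mono mult_right_mono few) auto
    also have "\<dots> = (\<Sum>i\<in>{1..r}. \<delta> * real n ^ R)"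
      using vR by (intro sum.cong) (auto simp: power_add[symmetric] mult.assoc)
    also have "\<dots> = (real n / real R) ^ R / 2" using r by (simp add: \<delta>_def power_divide)
    finally have "(real n / real R) ^ R \<le> 0" by simp
    moreover have "0 < (real n / real R) ^ R" using n0 \<open>R > 0\<close> by simp
    ultimately show False by linarith
  qed
  then show ?thesis using \<delta> unfolding v_def by blast
qed

section \<open>Containers for all colours but the first\<close>

lemma indep_set_copy_weight:
  assumes "\<And>\<phi>. \<phi> \<in> embeddings F n \<Longrightarrow> \<not> copy \<phi> (edges F) \<subseteq> I"
  shows "indep_set (copy_weight F n) I"
  unfolding indep_set_def
proof (intro allI impI)
  fix B assume "B \<subseteq> I"
  then have "{\<phi>\<in>embeddings F n. copy \<phi> (edges F) = B} = {}" using assms by blast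
  then show "copy_weight F n B = 0" by (simp only: copy_weight_def card.empty of_nat_0)
qed

text \<open>\<open>\<D> X\<close> consists of the complements of unions of containers, one for each colour \<open>i \<ge> 2\<close>, whose
  fingerprints are contained in \<open>X\<close>.\<close>

definition complement_family ::
  "nat \<Rightarrow> nat \<Rightarrow> (nat \<Rightarrow> 'a hypergraph) \<Rightarrow> nat \<Rightarrow> real \<Rightarrow> nat \<Rightarrow> real \<Rightarrow>
   (nat set set \<Rightarrow> nat set set set) \<Rightarrow> bool" where
  "complement_family r k F n \<delta> L s \<D> \<longleftrightarrow>
     (\<forall>X. finite X \<longrightarrow> finite (\<D> X) \<and> card (\<D> X) \<le> 2 ^ (L * card X)) \<and>
     (\<forall>X. \<forall>D\<in>\<D> X. \<delta> * real n ^ card (verts (F 1)) \<le>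
        real (card {\<phi>\<in>embeddings (F 1) n. copy \<phi> (edges (F 1)) \<subseteq> D})) \<and>
     (\<forall>I. (\<forall>i\<in>{2..r}. I i \<subseteq> k_subsets k n \<and>
             (\<forall>\<phi>\<in>embeddings (F i) n. \<not> copy \<phi> (edges (F i)) \<subseteq> I i)) \<longrightarrow>
        (\<exists>T. T \<subseteq> (\<Union>i\<in>{2..r}. I i) \<and> real (card T) \<le> s \<and>
           (\<forall>X. finite X \<and> T \<subseteq> X \<longrightarrow> (\<exists>D\<in>\<D> X. D \<inter> (\<Union>i\<in>{2..r}. I i) = {}))))"

text \<open>Colour an edge by the index of a container holding it, or by 1 if there is none, and
  apply supersaturation. The many monochromatic copies cannot have a colour
  \<open>i \<ge> 2\<close>, because the container for \<open>F i\<close> holds only half as many; so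
  they are copies of \<open>F 1\<close> outside all containers.\<close>

lemma colour_containers:
  fixes F :: "nat \<Rightarrow> 'a hypergraph"
  assumes r: "2 \<le> r"
    and F: "\<And>i. i \<in> {1..r} \<Longrightarrow> uniform_hypergraph k (F i)"
    and e: "\<And>i. i \<in> {1..r} \<Longrightarrow> 1 \<le> card (edges (F i))"
    and m: "\<And>i. i \<in> {2..r} \<Longrightarrow> max_k_dens k (F i) \<le> m" "0 < m"
  shows "\<exists>\<delta>>0. \<exists>L. \<exists>M>0. \<exists>n0. \<forall>n\<ge>n0. \<exists>\<D>. complement_family r k F n \<delta> L (M * real n powr (real k - 1 / m)) \<D>"
proof -
  have "1 \<le> r" using r by simp
  from ramsey_supersaturation[of r k F, OF this F] obtain \<delta> n1 where \<delta>: "0 < \<delta>" and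
    ss: "\<And>n c. n1 \<le> n \<Longrightarrow> (\<forall>e\<in>k_subsets k n. c e \<in> {1..r}) \<Longrightarrow>
      \<exists>i\<in>{1..r}. \<delta> * real n ^ card (verts (F i)) \<le>
       real (card {\<phi>\<in>embeddings (F i) n. \<forall>e\<in>edges (F i). c (\<phi> ` e) = i})"
    by blast
  define v where "v = (\<lambda>i. card (verts (F i)))"
  define K where "K = (\<lambda>i. 2 ^ card (edges (F i)) * real (v i) ^ v i)"
  have in1: "i \<in> {1..r}" if "i \<in> {2..r}" for i using that by auto
  have "\<exists>mm. \<exists>M>0. \<forall>(U::nat set set) N p w E.
           codegree_bounded U w (card (edges (F i))) (K i) p N E \<and> 0 < p \<and> p \<le> 1 / 4 \<and> 0 < E \<longrightarrow>
           has_containers U w mm (M * p * N) (\<lambda>C. wdeg C w {} \<le> \<delta> / 2 * E)" if i: "i \<in> {2..r}" for i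
  proof (rule containers)
    have "0 < real (v i) ^ v i" by (cases "v i = 0") auto
    then show "0 < K i" by (simp add: K_def)
    show "0 < card (edges (F i))" using e[OF in1[OF i]] by simp
  qed (use \<delta> in simp)
  then obtain mm MM where MM: "\<And>i. i \<in> {2..r} \<Longrightarrow> 0 < MM i" and
    cont: "\<And>i (U::nat set set) N p w E. i \<in> {2..r} \<Longrightarrow>
           codegree_bounded U w (card (edges (F i))) (K i) p N E \<Longrightarrow> 0 < p \<Longrightarrow> p \<le> 1 / 4 \<Longrightarrow> 0 < E \<Longrightarrow>
           has_containers U w (mm i) (MM i * p * N) (\<lambda>C. wdeg C w {} \<le> \<delta> / 2 * E)"
    by metis
  define L where "L = (\<Sum>i\<in>{2..r}. mm i)"
  \<comment> \<open>The summand 1 only ensures positivity.\<close>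
  define M where "M = (\<Sum>i\<in>{2..r}. real (mm i) * MM i) + 1"
  have "0 \<le> (\<Sum>i\<in>{2..r}. real (mm i) * MM i)" using MM by (intro sum_nonneg mult_nonneg_nonneg) (auto intro: less_imp_le)
  then have M: "0 < M" by (simp add: M_def)
  have "((\<lambda>n. real n powr (- 1 / m)) \<longlongrightarrow> 0) sequentially"
    using m(2) by real_asymp
  then have "\<forall>\<^sub>F n in sequentially. real n powr (- 1 / m) < 1 / 4"
    by (rule order_tendstoD) simp
  then obtain n2 where n2: "\<And>n. n2 \<le> n \<Longrightarrow> real n powr (- 1 / m) < 1 / 4"
    by (auto simp: eventually_sequentially)
  have main: "\<exists>\<D>. complement_family r k F n \<delta> L (M * real n powr (real k - 1 / m)) \<D>"
    if n: "max 1 (max n1 n2) \<le> n" for n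
  proof -
    have n: "1 \<le> n" "n1 \<le> n" "n2 \<le> n" using that by auto
    define q where "q = real n powr (- 1 / m)"
    define lam where "lam = real n powr (real k - 1 / m)"
    have q: "0 < q" "q \<le> 1 / 4" using n n2[OF n(3)] by (auto simp: q_def)
    have qN: "q * real n ^ k = lam"
      using n by (simp add: q_def lam_def powr_diff powr_minus powr_realpow field_simps)
    have lam0: "0 \<le> lam" by (simp add: lam_def)
    let ?V = "k_subsets k n"
    have "\<exists>f. \<forall>I\<subseteq>?V. indep_set (copy_weight (F i) n) I \<longrightarrow>
        (\<exists>Ts. length Ts = mm i \<and> (\<forall>T\<in>set Ts. T \<subseteq> I \<and> real (card T) \<le> MM i * q * real n ^ k) \<and>
              I \<subseteq> f Ts \<and> f Ts \<subseteq> ?V \<and> wdeg (f Ts) (copy_weight (F i) n) {} \<le> \<delta> / 2 * real n ^ v i)"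
      if i: "i \<in> {2..r}" for i
    proof -
      have "has_containers ?V (copy_weight (F i) n) (mm i) (MM i * q * real n ^ k)
         (\<lambda>C. wdeg C (copy_weight (F i) n) {} \<le> \<delta> / 2 * real n ^ v i)"
      proof (rule cont[OF i _ q])
        show "codegree_bounded ?V (copy_weight (F i) n) (card (edges (F i))) (K i) q
           (real n ^ k) (real n ^ v i)"
          unfolding K_def v_def q_def
          by (rule codegree_bounded_copies[OF F[OF in1[OF i]] m(1)[OF i] m(2) e[OF in1[OF i]] n(1)])
        show "0 < real n ^ v i" using n by simp
      qed
      then show ?thesis unfolding has_containers_def .
    qed
    then obtain f where f: "\<And>i I. i \<in> {2..r} \<Longrightarrow> I \<subseteq> ?V \<Longrightarrow> indep_set (copy_weight (F i) n) I \<Longrightarrow>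
        (\<exists>Ts. length Ts = mm i \<and> (\<forall>T\<in>set Ts. T \<subseteq> I \<and> real (card T) \<le> MM i * q * real n ^ k) \<and>
              I \<subseteq> f i Ts \<and> f i Ts \<subseteq> ?V \<and>
              wdeg (f i Ts) (copy_weight (F i) n) {} \<le> \<delta> / 2 * real n ^ v i)"
      by metis
    define Ls :: "nat set set \<Rightarrow> nat \<Rightarrow> nat set set list set"
      where "Ls = (\<lambda>X i. {Ts. set Ts \<subseteq> Pow X \<and> length Ts = mm i})"
    define comp where "comp = (\<lambda>Ts. ?V - (\<Union>i\<in>{2..r}. f i (Ts i)))"
    define good where "good = (\<lambda>D. \<delta> * real n ^ card (verts (F 1)) \<le>
        real (card {\<phi>\<in>embeddings (F 1) n. copy \<phi> (edges (F 1)) \<subseteq> D}))"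
    \<comment> \<open>A list need not be the fingerprint of anything; the filter secures the lower
      bound on copies of \<open>F 1\<close> for every member of the family.\<close>
    define \<D> where "\<D> = (\<lambda>X. {D \<in> comp ` (\<Pi>\<^sub>E i\<in>{2..r}. Ls X i). good D})"
    show ?thesis
      unfolding complement_family_def
    proof (intro exI[of _ \<D>] conjI allI impI ballI)
      fix X :: "nat set set" assume X: "finite X"
      have finL: "finite (Ls X i)" for i unfolding Ls_def using X by (simp add: finite_lists_length_eq)
      have fin: "finite (\<Pi>\<^sub>E i\<in>{2..r}. Ls X i)" using finL by (intro finite_PiE) auto
      then show "finite (\<D> X)" by (simp add: \<D>_def)
      have "card (\<D> X) \<le> card (comp ` (\<Pi>\<^sub>E i\<in>{2..r}. Ls X i))"
        using fin by (intro card_mono) (auto simp: \<D>_def)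
      also have "\<dots> \<le> card (\<Pi>\<^sub>E i\<in>{2..r}. Ls X i)" by (rule card_image_le[OF fin])
      also have "\<dots> = (\<Prod>i\<in>{2..r}. card (Ls X i))" by (simp add: card_PiE)
      also have "\<dots> = (\<Prod>i\<in>{2..r}. 2 ^ (card X * mm i))"
        unfolding Ls_def using X by (intro prod.cong) (auto simp: card_lists_length_eq card_Pow power_mult)
      also have "\<dots> = 2 ^ (L * card X)"
        by (simp add: power_sum[symmetric] L_def sum_distrib_left[symmetric] mult.commute)
      finally show "card (\<D> X) \<le> 2 ^ (L * card X)" .
    next
      fix X D assume "D \<in> \<D> X"
      then show "\<delta> * real n ^ card (verts (F 1)) \<le>
        real (card {\<phi>\<in>embeddings (F 1) n. copy \<phi> (edges (F 1)) \<subseteq> D})"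
        by (simp add: \<D>_def good_def)
    next
      fix I assume I: "\<forall>i\<in>{2..r}. I i \<subseteq> ?V \<and> (\<forall>\<phi>\<in>embeddings (F i) n. \<not> copy \<phi> (edges (F i)) \<subseteq> I i)"
      have "\<exists>Ts. length Ts = mm i \<and> (\<forall>T\<in>set Ts. T \<subseteq> I i \<and> real (card T) \<le> MM i * q * real n ^ k) \<and>
              I i \<subseteq> f i Ts \<and> f i Ts \<subseteq> ?V \<and>
              wdeg (f i Ts) (copy_weight (F i) n) {} \<le> \<delta> / 2 * real n ^ v i"
        if i: "i \<in> {2..r}" for i
        using I i by (intro f indep_set_copy_weight) auto
      then obtain Ts where Ts: "\<And>i. i \<in> {2..r} \<Longrightarrow> length (Ts i) = mm i"
        "\<And>i T. i \<in> {2..r} \<Longrightarrow> T \<in> set (Ts i) \<Longrightarrow> T \<subseteq> I i \<and> real (card T) \<le> MM i * q * real n ^ k"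
        "\<And>i. i \<in> {2..r} \<Longrightarrow> I i \<subseteq> f i (Ts i)" "\<And>i. i \<in> {2..r} \<Longrightarrow> f i (Ts i) \<subseteq> ?V"
        "\<And>i. i \<in> {2..r} \<Longrightarrow> wdeg (f i (Ts i)) (copy_weight (F i) n) {} \<le> \<delta> / 2 * real n ^ v i"
        by metis
      define T where "T = (\<Union>i\<in>{2..r}. \<Union>(set (Ts i)))"
      show "\<exists>T. T \<subseteq> (\<Union>i\<in>{2..r}. I i) \<and> real (card T) \<le> M * real n powr (real k - 1 / m) \<and>
           (\<forall>X. finite X \<and> T \<subseteq> X \<longrightarrow> (\<exists>D\<in>\<D> X. D \<inter> (\<Union>i\<in>{2..r}. I i) = {}))"
      proof (intro exI[of _ T] conjI allI impI)
        show "T \<subseteq> (\<Union>i\<in>{2..r}. I i)" using Ts(2) unfolding T_def by blast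
        have "real (card T) \<le> real (\<Sum>i\<in>{2..r}. \<Sum>T\<in>set (Ts i). card T)"
          unfolding T_def of_nat_le_iff
          by (intro order_trans[OF card_UN_le] sum_mono order_trans[OF card_Union_le_sum_card]) auto
        also have "\<dots> = (\<Sum>i\<in>{2..r}. \<Sum>T\<in>set (Ts i). real (card T))" by simp
        also have "\<dots> \<le> (\<Sum>i\<in>{2..r}. real (mm i) * (MM i * q * real n ^ k))"
        proof (rule sum_mono)
          fix i assume i: "i \<in> {2..r}"
          have "(\<Sum>T\<in>set (Ts i). real (card T)) \<le> real (card (set (Ts i))) * (MM i * q * real n ^ k)"
            using Ts(2)[OF i] by (intro sum_bounded_above) auto
          also have "\<dots> \<le> real (mm i) * (MM i * q * real n ^ k)"
            using card_length[of "Ts i"] Ts(1)[OF i] MM[OF i] q by (intro mult_right_mono) auto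
          finally show "(\<Sum>T\<in>set (Ts i). real (card T)) \<le> real (mm i) * (MM i * q * real n ^ k)" .
        qed
        also have "\<dots> = (\<Sum>i\<in>{2..r}. real (mm i) * MM i) * lam"
          by (simp add: qN[symmetric] sum_distrib_right mult.assoc)
        also have "\<dots> \<le> M * lam" using lam0 by (simp add: M_def distrib_right)
        finally show "real (card T) \<le> M * real n powr (real k - 1 / m)" by (simp add: lam_def)
      next
        fix X assume X: "finite X \<and> T \<subseteq> X"
        define D where "D = comp (restrict Ts {2..r})"
        have D: "D = ?V - (\<Union>i\<in>{2..r}. f i (Ts i))" by (simp add: D_def comp_def)
        have "restrict Ts {2..r} \<in> (\<Pi>\<^sub>E i\<in>{2..r}. Ls X i)"
          using X Ts(1) unfolding Ls_def T_def by (intro restrict_PiE_iff[THEN iffD2]) auto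
        then have DX: "D \<in> comp ` (\<Pi>\<^sub>E i\<in>{2..r}. Ls X i)" unfolding D_def by (rule imageI)
        define c where "c = (\<lambda>e. if \<exists>i\<in>{2..r}. e \<in> f i (Ts i) then SOME i. i \<in> {2..r} \<and> e \<in> f i (Ts i) else 1)"
        have c1: "c e \<in> {2..r} \<and> e \<in> f (c e) (Ts (c e))" if "\<exists>i\<in>{2..r}. e \<in> f i (Ts i)" for e
        proof -
          have "\<exists>i. i \<in> {2..r} \<and> e \<in> f i (Ts i)" using that by blast
          then have "(SOME i. i \<in> {2..r} \<and> e \<in> f i (Ts i)) \<in> {2..r} \<and>
             e \<in> f (SOME i. i \<in> {2..r} \<and> e \<in> f i (Ts i)) (Ts (SOME i. i \<in> {2..r} \<and> e \<in> f i (Ts i)))"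
            by (rule someI_ex)
          then show ?thesis using that by (simp add: c_def)
        qed
        have c2: "c e = 1" if "\<not> (\<exists>i\<in>{2..r}. e \<in> f i (Ts i))" for e using that unfolding c_def by (rule if_not_P)
        have "c e \<in> {1..r}" for e
          using c1[of e] c2[of e] r by (cases "\<exists>i\<in>{2..r}. e \<in> f i (Ts i)") auto
        then obtain i where i: "i \<in> {1..r}" and many: "\<delta> * real n ^ v i \<le>
          real (card {\<phi>\<in>embeddings (F i) n. \<forall>e\<in>edges (F i). c (\<phi> ` e) = i})"
          using ss[OF n(2), of c] unfolding v_def by blast
        have fin: "finite (embeddings (F i) n)"
          using F[OF i] by (intro finite_embeddings) (simp add: uniform_hypergraph_def)
        have "i = 1"
        proof (rule ccontr)
          assume "i \<noteq> 1"
          then have i2: "i \<in> {2..r}" using i by auto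
          have "\<phi> ` e \<in> f i (Ts i)" if "c (\<phi> ` e) = i" for e and \<phi> :: "'a \<Rightarrow> nat"
            using that c1[of "\<phi> ` e"] c2[of "\<phi> ` e"] \<open>i \<noteq> 1\<close> by metis
          then have "real (card {\<phi>\<in>embeddings (F i) n. \<forall>e\<in>edges (F i). c (\<phi> ` e) = i}) \<le>
            real (card {\<phi>\<in>embeddings (F i) n. {} \<subseteq> copy \<phi> (edges (F i)) \<and> copy \<phi> (edges (F i)) \<subseteq> f i (Ts i)})"
            unfolding of_nat_le_iff using fin by (intro card_mono) auto
          also have "\<dots> = wdeg (f i (Ts i)) (copy_weight (F i) n) {}"
            by (rule wdeg_copy_weight[OF F[OF i], symmetric])
               (rule finite_subset[OF Ts(4)[OF i2] finite_k_subsets])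
          also have "\<dots> \<le> \<delta> / 2 * real n ^ v i" by (rule Ts(5)[OF i2])
          finally have "\<delta> * real n ^ v i \<le> \<delta> / 2 * real n ^ v i" using many by linarith
          moreover have "0 < \<delta> * real n ^ v i" using \<delta> n by simp
          ultimately show False by simp
        qed
        have "{\<phi>\<in>embeddings (F 1) n. \<forall>e\<in>edges (F 1). c (\<phi> ` e) = 1}
            \<subseteq> {\<phi>\<in>embeddings (F 1) n. copy \<phi> (edges (F 1)) \<subseteq> D}"
        proof
          fix \<phi> assume "\<phi> \<in> {\<phi>\<in>embeddings (F 1) n. \<forall>e\<in>edges (F 1). c (\<phi> ` e) = 1}"
          then have \<phi>: "\<phi> \<in> embeddings (F 1) n" "\<And>e. e \<in> edges (F 1) \<Longrightarrow> c (\<phi> ` e) = 1" by auto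
          have "\<phi> ` e \<in> D" if "e \<in> edges (F 1)" for e
          proof -
            have "\<phi> ` e \<in> ?V"
              using copy_subset_k_subsets[OF F \<phi>(1)] that r by auto
            moreover have "\<not> (\<exists>i\<in>{2..r}. \<phi> ` e \<in> f i (Ts i))" using c1[of "\<phi> ` e"] \<phi>(2)[OF that] by auto
            ultimately show ?thesis unfolding D by blast
          qed
          then show "\<phi> \<in> {\<phi>\<in>embeddings (F 1) n. copy \<phi> (edges (F 1)) \<subseteq> D}" using \<phi>(1) by auto
        qed
        then have "real (card {\<phi>\<in>embeddings (F 1) n. \<forall>e\<in>edges (F 1). c (\<phi> ` e) = 1})
            \<le> real (card {\<phi>\<in>embeddings (F 1) n. copy \<phi> (edges (F 1)) \<subseteq> D})"
          using fin \<open>i = 1\<close> unfolding of_nat_le_iff by (intro card_mono) auto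
        then have "good D" using many \<open>i = 1\<close> unfolding good_def v_def by simp
        then have "D \<in> \<D> X" using DX by (simp add: \<D>_def)
        moreover have "D \<inter> (\<Union>i\<in>{2..r}. I i) = {}" unfolding D using Ts(3) by blast
        ultimately show "\<exists>D\<in>\<D> X. D \<inter> (\<Union>i\<in>{2..r}. I i) = {}" by blast
      qed
    qed
  qed
  show ?thesis
    by (rule exI[of _ \<delta>], intro conjI \<delta>, rule exI[of _ L], rule exI[of _ M], intro conjI M,
        rule exI[of _ "max 1 (max n1 n2)"], intro allI impI, rule main)
qed

section \<open>Random subsets\<close>

text \<open>The expectation over a \<open>p\<close>-random subset of \<open>E\<close>, as a finite
  sum so that inequalities can be proved by adding one element at a time.\<close>

definition bexp :: "'e set \<Rightarrow> real \<Rightarrow> ('e set \<Rightarrow> real) \<Rightarrow> real" where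
  "bexp E p f = (\<Sum>A\<in>Pow E. p ^ card A * (1 - p) ^ card (E - A) * f A)"

lemma bexp_empty [simp]: "bexp {} p f = f {}"
  by (simp add: bexp_def)

lemma bexp_insert:
  assumes "finite E" "x \<notin> E"
  shows "bexp (insert x E) p f = p * bexp E p (\<lambda>A. f (insert x A)) + (1 - p) * bexp E p f"
proof -
  have inj: "inj_on (insert x) (Pow E)" using assms(2) by (auto simp: inj_on_def)
  let ?t = "\<lambda>A. p ^ card A * (1 - p) ^ card (insert x E - A) * f A"
  have "bexp (insert x E) p f = (\<Sum>A\<in>Pow E. ?t A) + (\<Sum>A\<in>insert x ` Pow E. ?t A)"
    unfolding bexp_def Pow_insert using assms by (intro sum.union_disjoint) auto
  also have "(\<Sum>A\<in>Pow E. ?t A) = (1 - p) * bexp E p f"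
    unfolding bexp_def sum_distrib_left
  proof (rule sum.cong[OF refl])
    fix A assume A: "A \<in> Pow E"
    then have "insert x E - A = insert x (E - A)" "x \<notin> E - A" "finite (E - A)" using assms by auto
    then have "card (insert x E - A) = Suc (card (E - A))" by simp
    then show "?t A = (1 - p) * (p ^ card A * (1 - p) ^ card (E - A) * f A)" by simp
  qed
  also have "(\<Sum>A\<in>insert x ` Pow E. ?t A) = p * bexp E p (\<lambda>A. f (insert x A))"
    unfolding bexp_def sum_distrib_left sum.reindex[OF inj] o_def
  proof (rule sum.cong[OF refl])
    fix A assume A: "A \<in> Pow E"
    then have "insert x E - insert x A = E - A" "x \<notin> A" "finite A"
      using assms by (auto intro: finite_subset)
    then show "?t (insert x A) = p * (p ^ card A * (1 - p) ^ card (E - A) * f (insert x A))"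
      by simp
  qed
  finally show ?thesis by simp
qed

lemma bexp_mono:
  assumes "0 \<le> p" "p \<le> 1" "\<And>A. A \<subseteq> E \<Longrightarrow> f A \<le> g A"
  shows "bexp E p f \<le> bexp E p g"
  unfolding bexp_def using assms by (intro sum_mono mult_left_mono) auto

lemma bexp_cong: "(\<And>A. A \<subseteq> E \<Longrightarrow> f A = g A) \<Longrightarrow> bexp E p f = bexp E p g"
  unfolding bexp_def by (intro sum.cong) auto

lemma bexp_const: "finite E \<Longrightarrow> bexp E p (\<lambda>_. c) = c"
  by (induction E rule: finite_induct) (auto simp: bexp_insert algebra_simps)

lemma bexp_add: "bexp E p (\<lambda>A. f A + g A) = bexp E p f + bexp E p g"
  by (simp add: bexp_def distrib_left sum.distrib)

lemma bexp_diff: "bexp E p (\<lambda>A. f A - g A) = bexp E p f - bexp E p g"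
  by (simp add: bexp_def right_diff_distrib sum_subtractf)

lemma bexp_cmult: "bexp E p (\<lambda>A. c * f A) = c * bexp E p f"
  by (simp add: bexp_def sum_distrib_left algebra_simps)

lemma bexp_sum: "bexp E p (\<lambda>A. \<Sum>i\<in>J. f i A) = (\<Sum>i\<in>J. bexp E p (f i))"
  unfolding bexp_def sum_distrib_left by (rule sum.swap)

lemma bexp_nonneg:
  assumes "0 \<le> p" "p \<le> 1" "\<And>A. A \<subseteq> E \<Longrightarrow> 0 \<le> f A"
  shows "0 \<le> bexp E p f"
  unfolding bexp_def using assms by (intro sum_nonneg) auto

section \<open>Correlation inequalities\<close>

lemma mono_comp_insert:
  fixes f :: "'e set \<Rightarrow> real"
  assumes "mono f"
  shows "mono (\<lambda>A. f (insert x A))"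
proof (rule monoI)
  fix A B :: "'e set" assume "A \<subseteq> B"
  then have "insert x A \<subseteq> insert x B" by blast
  then show "f (insert x A) \<le> f (insert x B)" by (rule monoD[OF assms])
qed

lemma antimono_comp_insert:
  fixes f :: "'e set \<Rightarrow> real"
  assumes "antimono f"
  shows "antimono (\<lambda>A. f (insert x A))"
proof (rule antimonoI)
  fix A B :: "'e set" assume "A \<subseteq> B"
  then have "insert x A \<subseteq> insert x B" by blast
  then show "f (insert x B) \<le> f (insert x A)" by (rule antimonoD[OF assms])
qed

text \<open>Condition on the element \<open>x\<close> added last. The conditional expectations are
  covered by induction, and averaging them discards only the nonnegative term
  \<open>p * (1 - p) * ((a1 - a0) * (b0 - b1))\<close>.\<close>

lemma harris:
  fixes f g :: "'e set \<Rightarrow> real"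
  assumes "finite E" "0 \<le> p" "p \<le> 1" "mono f" "antimono g"
  shows "bexp E p (\<lambda>A. f A * g A) \<le> bexp E p f * bexp E p g"
  using assms
proof (induction E arbitrary: f g rule: finite_induct)
  case (insert x E)
  define a1 a0 b1 b0 where "a1 = bexp E p (\<lambda>A. f (insert x A))" and "a0 = bexp E p f"
    and "b1 = bexp E p (\<lambda>A. g (insert x A))" and "b0 = bexp E p g"
  have a: "a0 \<le> a1" unfolding a1_def a0_def
    using insert.prems by (intro bexp_mono) (auto dest: monoD)
  have b: "b1 \<le> b0" unfolding b1_def b0_def
    using insert.prems by (intro bexp_mono) (auto dest: antimonoD)
  have "bexp (insert x E) p (\<lambda>A. f A * g A) =
      p * bexp E p (\<lambda>A. f (insert x A) * g (insert x A)) + (1 - p) * bexp E p (\<lambda>A. f A * g A)"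
    using insert.hyps by (rule bexp_insert)
  also have "\<dots> \<le> p * (a1 * b1) + (1 - p) * (a0 * b0)"
    unfolding a1_def a0_def b1_def b0_def using insert.prems
    by (intro add_mono mult_left_mono insert.IH mono_comp_insert antimono_comp_insert) auto
  also have "\<dots> = (p * a1 + (1 - p) * a0) * (p * b1 + (1 - p) * b0) - p * (1 - p) * ((a1 - a0) * (b0 - b1))"
    by (simp add: algebra_simps)
  also have "\<dots> \<le> (p * a1 + (1 - p) * a0) * (p * b1 + (1 - p) * b0)"
    using a b insert.prems by simp
  also have "\<dots> = bexp (insert x E) p f * bexp (insert x E) p g"
    using insert.hyps by (simp add: bexp_insert a1_def a0_def b1_def b0_def)
  finally show ?case .
qed simp

text \<open>An induction in place of the usual coupling of the two random subsets.\<close>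

lemma bexp_mono_prob:
  assumes "finite E" "0 \<le> p" "p \<le> q" "q \<le> 1" "mono f"
  shows "bexp E p f \<le> bexp E q f"
  using assms
proof (induction E arbitrary: f rule: finite_induct)
  case (insert x E)
  let ?f = "\<lambda>A. f (insert x A)"
  have le: "bexp E q f \<le> bexp E q ?f"
    using insert.prems by (intro bexp_mono) (auto dest: monoD)
  have "bexp (insert x E) p f = p * bexp E p ?f + (1 - p) * bexp E p f"
    using insert.hyps by (rule bexp_insert)
  also have "\<dots> \<le> p * bexp E q ?f + (1 - p) * bexp E q f"
    using insert.prems by (intro add_mono mult_left_mono insert.IH mono_comp_insert) auto
  also have "\<dots> = bexp E q f + p * (bexp E q ?f - bexp E q f)" by (simp add: algebra_simps)
  also have "\<dots> \<le> bexp E q f + q * (bexp E q ?f - bexp E q f)"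
    using le insert.prems by (intro add_left_mono mult_right_mono) auto
  also have "\<dots> = bexp (insert x E) q f"
    using insert.hyps by (simp add: bexp_insert algebra_simps)
  finally show ?case .
qed simp

lemma bexp_mem_indep:
  assumes "finite E" "x \<in> E" "\<And>A. h (insert x A) = h A"
  shows "bexp E p (\<lambda>A. of_bool (x \<in> A) * h A) = p * bexp E p h"
proof -
  have E: "E = insert x (E - {x})" using assms(2) by auto
  have fin: "finite (E - {x})" "x \<notin> E - {x}" using assms(1) by auto
  have 0: "bexp (E - {x}) p (\<lambda>A. of_bool (x \<in> A) * h A) = 0"
    unfolding bexp_def by (rule sum.neutral) auto
  show ?thesis
    by (subst (1 2) E, subst (1 2) bexp_insert[OF fin])
       (simp add: assms(3) 0 bexp_const fin, simp add: algebra_simps)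
qed

lemma bexp_superset_indep:
  assumes "finite E" "S \<subseteq> E" "\<And>A x. x \<in> S \<Longrightarrow> h (insert x A) = h A"
  shows "bexp E p (\<lambda>A. of_bool (S \<subseteq> A) * h A) = p ^ card S * bexp E p h"
proof -
  have "finite S" using assms finite_subset by blast
  then show ?thesis using assms(2,3)
  proof (induction S rule: finite_induct)
    case (insert x S)
    have "bexp E p (\<lambda>A. of_bool (insert x S \<subseteq> A) * h A) =
        bexp E p (\<lambda>A. of_bool (x \<in> A) * (of_bool (S \<subseteq> A) * h A))"
      by (rule bexp_cong) auto
    also have "\<dots> = p * bexp E p (\<lambda>A. of_bool (S \<subseteq> A) * h A)"
    proof (rule bexp_mem_indep[OF assms(1)])
      fix A
      have "S \<subseteq> insert x A \<longleftrightarrow> S \<subseteq> A" using insert.hyps by auto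
      then show "of_bool (S \<subseteq> insert x A) * h (insert x A) = of_bool (S \<subseteq> A) * h A"
        using insert.prems by simp
    qed (use insert.prems in auto)
    also have "\<dots> = p ^ card (insert x S) * bexp E p h"
      using insert by simp
    finally show ?case .
  qed simp
qed

lemma bexp_superset:
  assumes "finite E" "S \<subseteq> E"
  shows "bexp E p (\<lambda>A. of_bool (S \<subseteq> A)) = p ^ card S"
  using bexp_superset_indep[OF assms, of "\<lambda>_. 1" p] assms by (simp add: bexp_const)

lemma mono_superset: "mono (\<lambda>A. of_bool (S \<subseteq> A) :: real)"
  by (auto simp: mono_def)

lemma antimono_avoids: "antimono (\<lambda>A. of_bool (\<forall>S\<in>\<S>. \<not> S \<subseteq> A) :: real)"
  by (auto simp: antimono_def)

text \<open>The sets are added one by one. The presence of \<open>S\<close> is independent of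
  avoiding the sets disjoint from it, and the sets meeting \<open>S\<close> are handled by a union
  bound with Harris' inequality. So \<open>S\<close> changes the avoidance probability by a factor
  of at most \<open>exp (- (p ^ card S) + \<sigma>)\<close>. The overlap sum runs over ordered
  pairs, whereas each unordered pair arises once.\<close>

lemma janson:
  assumes E: "finite E" and p: "0 \<le> p" "p \<le> 1"
    and "finite \<S>" "\<And>S. S \<in> \<S> \<Longrightarrow> S \<subseteq> E"
  shows "bexp E p (\<lambda>A. of_bool (\<forall>S\<in>\<S>. \<not> S \<subseteq> A)) \<le>
    exp (- (\<Sum>S\<in>\<S>. p ^ card S) +
         (\<Sum>S\<in>\<S>. \<Sum>S' | S' \<in> \<S> \<and> S' \<noteq> S \<and> S \<inter> S' \<noteq> {}. p ^ card (S \<union> S')))"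
  using assms(4,5)
proof (induction \<S> rule: finite_induct)
  case empty
  then show ?case using E by (simp add: bexp_const)
next
  case (insert S \<S>)
  define none :: "'a set set \<Rightarrow> 'a set \<Rightarrow> real" where "none = (\<lambda>\<T> A. of_bool (\<forall>S\<in>\<T>. \<not> S \<subseteq> A))"
  define \<D> where "\<D> = {S'\<in>\<S>. S \<inter> S' = {}}"
  define \<N> where "\<N> = {S'\<in>\<S>. S \<inter> S' \<noteq> {}}"
  define \<sigma> where "\<sigma> = (\<Sum>S'\<in>\<N>. p ^ card (S \<union> S'))"
  have fin: "finite \<N>" using insert.hyps by (simp add: \<N>_def)
  have SE: "S \<subseteq> E" using insert.prems by auto
  have nn: "0 \<le> none \<T> A" for \<T> A by (simp add: none_def)
  \<comment> \<open>If \<open>S\<close> is present and the sets disjoint from it are avoided, a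
    violation of \<open>none \<S>\<close> can only come from a member of
    \<open>\<N>\<close>.\<close>
  have union: "of_bool (S \<subseteq> A) * none \<D> A - (\<Sum>S'\<in>\<N>. of_bool (S \<union> S' \<subseteq> A) * none \<D> A)
      \<le> of_bool (S \<subseteq> A) * none \<S> A" for A
  proof (cases "S \<subseteq> A \<and> none \<D> A = 1 \<and> none \<S> A \<noteq> 1")
    case True
    then obtain S' where S': "S' \<in> \<S>" "S' \<subseteq> A" by (auto simp: none_def split: if_splits)
    have "S' \<notin> \<D>" using True S' by (auto simp: none_def)
    then have "S' \<in> \<N>" using S' by (auto simp: \<D>_def \<N>_def)
    have "1 = of_bool (S \<union> S' \<subseteq> A) * none \<D> A" using True S' by simp
    also have "\<dots> \<le> (\<Sum>S'\<in>\<N>. of_bool (S \<union> S' \<subseteq> A) * none \<D> A)"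
      using \<open>S' \<in> \<N>\<close> fin nn by (intro member_le_sum) auto
    finally show ?thesis using True nn[of \<S> A] by simp
  next
    case False
    have "none \<D> A = 0 \<or> none \<D> A = 1" by (auto simp: none_def)
    moreover have "0 \<le> (\<Sum>S'\<in>\<N>. of_bool (S \<union> S' \<subseteq> A) * none \<D> A)"
      using nn by (intro sum_nonneg) auto
    ultimately show ?thesis using False nn by auto
  qed
  define P where "P = (\<lambda>\<T>. bexp E p (none \<T>))"
  have P0: "0 \<le> P \<T>" for \<T> unfolding P_def using p nn by (intro bexp_nonneg)
  have PD: "P \<S> \<le> P \<D>"
    unfolding P_def using p by (intro bexp_mono) (auto simp: none_def \<D>_def)
  have anti: "antimono (none \<T>)" for \<T> unfolding none_def by (rule antimono_avoids)
  have "P \<D> * (p ^ card S - \<sigma>) = p ^ card S * P \<D> - (\<Sum>S'\<in>\<N>. p ^ card (S \<union> S') * P \<D>)"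
    by (simp add: \<sigma>_def algebra_simps sum_distrib_left)
  also have "p ^ card S * P \<D> = bexp E p (\<lambda>A. of_bool (S \<subseteq> A) * none \<D> A)"
    unfolding P_def
  proof (rule bexp_superset_indep[OF E SE, symmetric])
    fix A x assume "x \<in> S"
    then have "T \<subseteq> insert x A \<longleftrightarrow> T \<subseteq> A" if "T \<in> \<D>" for T using that by (auto simp: \<D>_def)
    then show "none \<D> (insert x A) = none \<D> A" by (simp add: none_def)
  qed
  also have "bexp E p (\<lambda>A. of_bool (S \<subseteq> A) * none \<D> A) - (\<Sum>S'\<in>\<N>. p ^ card (S \<union> S') * P \<D>)
     \<le> bexp E p (\<lambda>A. of_bool (S \<subseteq> A) * none \<D> A) -
        (\<Sum>S'\<in>\<N>. bexp E p (\<lambda>A. of_bool (S \<union> S' \<subseteq> A) * none \<D> A))"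
  proof (intro diff_left_mono sum_mono)
    fix S' assume "S' \<in> \<N>"
    then have sub: "S \<union> S' \<subseteq> E" using insert.prems by (auto simp: \<N>_def)
    have "bexp E p (\<lambda>A. of_bool (S \<union> S' \<subseteq> A) * none \<D> A)
        \<le> bexp E p (\<lambda>A. of_bool (S \<union> S' \<subseteq> A)) * bexp E p (none \<D>)"
      by (rule harris[OF E p mono_superset anti])
    then show "bexp E p (\<lambda>A. of_bool (S \<union> S' \<subseteq> A) * none \<D> A) \<le> p ^ card (S \<union> S') * P \<D>"
      unfolding bexp_superset[OF E sub] by (simp add: P_def)
  qed
  also have "\<dots> = bexp E p (\<lambda>A. of_bool (S \<subseteq> A) * none \<D> A -
      (\<Sum>S'\<in>\<N>. of_bool (S \<union> S' \<subseteq> A) * none \<D> A))"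
    by (simp add: bexp_diff bexp_sum)
  also have "\<dots> \<le> bexp E p (\<lambda>A. of_bool (S \<subseteq> A) * none \<S> A)"
    using p union by (intro bexp_mono)
  finally have key: "P \<D> * (p ^ card S - \<sigma>) \<le> bexp E p (\<lambda>A. of_bool (S \<subseteq> A) * none \<S> A)" .
  have "P (insert S \<S>) = bexp E p (\<lambda>A. none \<S> A - of_bool (S \<subseteq> A) * none \<S> A)"
    unfolding P_def by (rule bexp_cong) (auto simp: none_def)
  also have "\<dots> = P \<S> - bexp E p (\<lambda>A. of_bool (S \<subseteq> A) * none \<S> A)"
    by (simp add: bexp_diff P_def)
  finally have new: "P (insert S \<S>) = P \<S> - bexp E p (\<lambda>A. of_bool (S \<subseteq> A) * none \<S> A)" .
  \<comment> \<open>If \<open>\<sigma>\<close> is at least \<open>p ^ card S\<close>, the factor is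
    at least 1 and monotonicity suffices. Otherwise the coefficient of \<open>P \<D>\<close> is
    positive, so \<open>P \<D>\<close> can be replaced by the smaller \<open>P \<S>\<close>.\<close>
  have "P (insert S \<S>) \<le> P \<S> * exp (- (p ^ card S) + \<sigma>)"
  proof (cases "p ^ card S - \<sigma> \<le> 0")
    case True
    have "0 \<le> bexp E p (\<lambda>A. of_bool (S \<subseteq> A) * none \<S> A)"
      using p nn by (intro bexp_nonneg) auto
    then have "P (insert S \<S>) \<le> P \<S> * 1" using new by simp
    also have "\<dots> \<le> P \<S> * exp (- (p ^ card S) + \<sigma>)"
      using True P0 by (intro mult_left_mono) auto
    finally show ?thesis .
  next
    case False
    have "P \<S> * (p ^ card S - \<sigma>) \<le> P \<D> * (p ^ card S - \<sigma>)"
      using False PD by (intro mult_right_mono) auto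
    then have "P (insert S \<S>) \<le> P \<S> * (1 + (- (p ^ card S) + \<sigma>))"
      using new key by (simp add: algebra_simps)
    also have "\<dots> \<le> P \<S> * exp (- (p ^ card S) + \<sigma>)"
      using P0 by (intro mult_left_mono exp_ge_add_one_self)
    finally show ?thesis .
  qed
  also have "\<dots> \<le> exp (- (\<Sum>S\<in>\<S>. p ^ card S) +
         (\<Sum>S\<in>\<S>. \<Sum>S' | S' \<in> \<S> \<and> S' \<noteq> S \<and> S \<inter> S' \<noteq> {}. p ^ card (S \<union> S'))) *
      exp (- (p ^ card S) + \<sigma>)"
    using insert unfolding P_def none_def by (intro mult_right_mono) auto
  also have "\<dots> = exp (- (\<Sum>S\<in>insert S \<S>. p ^ card S) + (\<sigma> +
         (\<Sum>S\<in>\<S>. \<Sum>S' | S' \<in> \<S> \<and> S' \<noteq> S \<and> S \<inter> S' \<noteq> {}. p ^ card (S \<union> S'))))"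
    using insert.hyps by (simp add: exp_add[symmetric] algebra_simps)
  also have "\<dots> \<le> exp (- (\<Sum>S\<in>insert S \<S>. p ^ card S) +
     (\<Sum>T\<in>insert S \<S>. \<Sum>S' | S' \<in> insert S \<S> \<and> S' \<noteq> T \<and> T \<inter> S' \<noteq> {}. p ^ card (T \<union> S')))"
  proof -
    have "{S'. S' \<in> insert S \<S> \<and> S' \<noteq> S \<and> S \<inter> S' \<noteq> {}} = \<N>"
      using insert.hyps by (auto simp: \<N>_def)
    moreover have "(\<Sum>T\<in>\<S>. \<Sum>S' | S' \<in> \<S> \<and> S' \<noteq> T \<and> T \<inter> S' \<noteq> {}. p ^ card (T \<union> S')) \<le>
      (\<Sum>T\<in>\<S>. \<Sum>S' | S' \<in> insert S \<S> \<and> S' \<noteq> T \<and> T \<inter> S' \<noteq> {}. p ^ card (T \<union> S'))"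
      using insert.hyps p by (intro sum_mono sum_mono2) auto
    ultimately show ?thesis using insert.hyps by (simp add: \<sigma>_def)
  qed
  finally show ?case unfolding P_def none_def .
qed

section \<open>Encoding fingerprints and the union bound\<close>

lemma card_subsets_le:
  assumes "finite E"
  shows "card {R. R \<subseteq> E \<and> card R \<le> q} \<le> (card E + 1) ^ q"
proof -
  let ?N = "card E"
  have "{R. R \<subseteq> E \<and> card R \<le> q} = (\<Union>s\<in>{..q}. {R. R \<subseteq> E \<and> card R = s})" by auto
  then have "card {R. R \<subseteq> E \<and> card R \<le> q} \<le> (\<Sum>s\<in>{..q}. card {R. R \<subseteq> E \<and> card R = s})"
    using card_UN_le[of "{..q}" "\<lambda>s. {R. R \<subseteq> E \<and> card R = s}"] by simp
  also have "\<dots> = (\<Sum>s\<in>{..q}. ?N choose s)" using assms by (simp add: n_subsets)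
  \<comment> \<open>Inserting \<open>q choose s\<close> turns the sum into the binomial expansion of
    \<open>(?N + 1) ^ q\<close>.\<close>
  also have "\<dots> \<le> (\<Sum>s\<in>{..q}. (q choose s) * ?N ^ s * 1 ^ (q - s))"
  proof (rule sum_mono)
    fix s assume "s \<in> {..q}"
    then have "1 \<le> q choose s" by (simp add: Suc_leI)
    have "?N choose s \<le> 1 * ?N ^ s"
      by (cases "s \<le> ?N") (auto intro: binomial_le_pow simp: binomial_eq_0)
    also have "\<dots> \<le> (q choose s) * ?N ^ s" using \<open>1 \<le> q choose s\<close> by (intro mult_right_mono) auto
    finally show "?N choose s \<le> (q choose s) * ?N ^ s * 1 ^ (q - s)" by simp
  qed
  also have "\<dots> = (?N + 1) ^ q" by (subst binomial) simp
  finally show ?thesis .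
qed

lemma sum_subfamilies_le:
  fixes x :: real
  assumes "finite \<C>" "0 \<le> x"
  shows "(\<Sum>\<S> | \<S> \<subseteq> \<C> \<and> card \<S> \<le> t. x ^ card \<S>) \<le> (\<Sum>s\<le>t. (real (card \<C>) * x) ^ s / fact s)"
proof -
  let ?P = "{\<S>. \<S> \<subseteq> \<C> \<and> card \<S> \<le> t}"
  have "(\<Sum>\<S>\<in>?P. x ^ card \<S>) = (\<Sum>s\<in>{..t}. \<Sum>\<S> | \<S> \<in> ?P \<and> card \<S> = s. x ^ card \<S>)"
    by (rule sum.group[symmetric]) (use assms in auto)
  also have "\<dots> = (\<Sum>s\<in>{..t}. real (card \<C> choose s) * x ^ s)"
  proof (rule sum.cong[OF refl])
    fix s assume "s \<in> {..t}"
    then have "{\<S>. \<S> \<in> ?P \<and> card \<S> = s} = {\<S>. \<S> \<subseteq> \<C> \<and> card \<S> = s}" by auto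
    then show "(\<Sum>\<S> | \<S> \<in> ?P \<and> card \<S> = s. x ^ card \<S>) = real (card \<C> choose s) * x ^ s"
      using assms by (simp add: n_subsets)
  qed
  also have "\<dots> \<le> (\<Sum>s\<le>t. (real (card \<C>) * x) ^ s / fact s)"
  proof (rule sum_mono)
    fix s
    have "real ((card \<C> choose s) * fact s) \<le> real (card \<C> ^ s)"
      unfolding of_nat_le_iff by (rule binomial_fact_pow)
    then have "real (card \<C> choose s) \<le> real (card \<C>) ^ s / fact s"
      by (simp add: pos_le_divide_eq)
    then have "real (card \<C> choose s) * x ^ s \<le> real (card \<C>) ^ s / fact s * x ^ s"
      using assms by (intro mult_right_mono) auto
    then show "real (card \<C> choose s) * x ^ s \<le> (real (card \<C>) * x) ^ s / fact s"
      by (simp add: power_mult_distrib)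
  qed
  finally show ?thesis .
qed

text \<open>The full series gives \<open>exp (a * x)\<close>, whose exponent is of the same order as
  the gain from Janson's inequality. Truncation at \<open>t\<close> replaces the exponent by
  \<open>t * ln a + x\<close>, which for \<open>t\<close> of order \<open>x\<close> is only
  logarithmic in \<open>a\<close>.\<close>

lemma exp_partial_sum_le:
  fixes a x :: real
  assumes "1 \<le> a" "0 \<le> x"
  shows "(\<Sum>s\<le>t. (a * x) ^ s / fact s) \<le> a ^ t * exp x"
proof -
  have "(\<Sum>s\<le>t. (a * x) ^ s / fact s) \<le> (\<Sum>s\<le>t. a ^ t * (x ^ s / fact s))"
  proof (rule sum_mono)
    fix s assume "s \<in> {..t}"
    then have "a ^ s \<le> a ^ t" using assms by (intro power_increasing) auto
    then have "a ^ s * (x ^ s / fact s) \<le> a ^ t * (x ^ s / fact s)"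
      using assms by (intro mult_right_mono) auto
    then show "(a * x) ^ s / fact s \<le> a ^ t * (x ^ s / fact s)" by (simp add: power_mult_distrib)
  qed
  also have "\<dots> = a ^ t * (\<Sum>s\<le>t. x ^ s / fact s)" by (simp add: sum_distrib_left)
  also have "(\<Sum>s\<le>t. x ^ s / fact s) \<le> exp x"
  proof -
    have "(\<Sum>s\<le>t. x ^ s / fact s) \<le> (\<Sum>s. x ^ s / fact s)"
      using summable_exp[of x] assms by (intro sum_le_suminf) (auto simp: field_simps)
    also have "\<dots> = exp x" by (simp add: exp_def divide_inverse mult.commute scaleR_conv_of_real)
    finally show ?thesis .
  qed
  finally show ?thesis using assms by (simp add: mult_left_mono)
qed

definition overlapping :: "'e set set \<Rightarrow> ('e set \<times> 'e set) set" where
  "overlapping \<C> = {(B, B'). B \<in> \<C> \<and> B' \<in> \<C> \<and> B' \<noteq> B \<and> B \<inter> B' \<noteq> {}}"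

lemma sum_overlapping:
  assumes "finite \<C>"
  shows "(\<Sum>B\<in>\<C>. \<Sum>B' | B' \<in> \<C> \<and> B' \<noteq> B \<and> B \<inter> B' \<noteq> {}. g (B \<union> B')) =
         (\<Sum>(B, B')\<in>overlapping \<C>. g (B \<union> B'))"
proof -
  have "overlapping \<C> = (SIGMA B:\<C>. {B'. B' \<in> \<C> \<and> B' \<noteq> B \<and> B \<inter> B' \<noteq> {}})"
    by (auto simp: overlapping_def)
  then show ?thesis using assms by (simp add: sum.Sigma)
qed

text \<open>A set \<open>T\<close> covered by copies inside \<open>A\<close> is encoded by the isolated copies meeting it, which are
  pairwise disjoint, and the few elements whose copy overlaps another one.\<close>

lemma certificate:
  assumes \<C>: "finite \<C>" "\<And>B. B \<in> \<C> \<Longrightarrow> finite B \<and> card B = b"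
    and T: "finite T" "\<And>e. e \<in> T \<Longrightarrow> \<exists>B\<in>\<C>. e \<in> B \<and> B \<subseteq> A"
  shows "\<exists>\<S> R. \<S> \<subseteq> \<C> \<and> card \<S> \<le> card T \<and> disjoint \<S> \<and> \<Union>\<S> \<subseteq> A \<and> R \<subseteq> T \<and> T \<subseteq> \<Union>\<S> \<union> R \<and>
     card R \<le> b * card {(B, B')\<in>overlapping \<C>. B \<union> B' \<subseteq> A}"
proof -
  let ?O = "{(B, B')\<in>overlapping \<C>. B \<union> B' \<subseteq> A}"
  obtain B where B: "\<And>e. e \<in> T \<Longrightarrow> B e \<in> \<C> \<and> e \<in> B e \<and> B e \<subseteq> A" using T(2) by metis
  define isolated where "isolated = (\<lambda>C. \<forall>C'\<in>\<C>. C' \<noteq> C \<and> C' \<subseteq> A \<longrightarrow> C \<inter> C' = {})"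
  define \<S> where "\<S> = B ` {e\<in>T. isolated (B e)}"
  define R where "R = {e\<in>T. \<not> isolated (B e)}"
  have finO: "finite ?O"
    by (rule finite_subset[of _ "\<C> \<times> \<C>"]) (use \<C> in \<open>auto simp: overlapping_def\<close>)
  have "card \<S> \<le> card {e\<in>T. isolated (B e)}" unfolding \<S>_def using T by (intro card_image_le) auto
  also have "\<dots> \<le> card T" using T by (intro card_mono) auto
  finally have 1: "card \<S> \<le> card T" .
  have 2: "disjoint \<S>"
  proof (rule disjointI)
    fix C C' assume "C \<in> \<S>" "C' \<in> \<S>" "C \<noteq> C'"
    then have "isolated C" "C' \<in> \<C>" "C' \<subseteq> A" using B by (auto simp: \<S>_def)
    then show "C \<inter> C' = {}" using \<open>C \<noteq> C'\<close> unfolding isolated_def by blast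
  qed
  \<comment> \<open>A copy inside \<open>A\<close> that is not isolated is the first component of an
    overlapping pair inside \<open>A\<close>, and it accounts for at most \<open>b\<close>
    elements.\<close>
  have "R \<subseteq> \<Union>(fst ` ?O)"
  proof
    fix e assume e: "e \<in> R"
    then have eT: "e \<in> T" and "\<not> isolated (B e)" by (auto simp: R_def)
    then obtain C' where "C' \<in> \<C>" "C' \<noteq> B e" "C' \<subseteq> A" "B e \<inter> C' \<noteq> {}" by (auto simp: isolated_def)
    then have "(B e, C') \<in> ?O" using B[OF eT] by (auto simp: overlapping_def)
    then show "e \<in> \<Union>(fst ` ?O)" using B[OF eT] by force
  qed
  moreover have "finite (\<Union>(fst ` ?O))"
    using finO \<C>(2) by (auto simp: overlapping_def)
  ultimately have "card R \<le> card (\<Union>(fst ` ?O))" by (intro card_mono)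
  also have "\<dots> \<le> (\<Sum>C\<in>fst ` ?O. card C)"
    using \<C>(2) by (intro card_Union_le_sum_card_weak) (auto simp: overlapping_def)
  also have "\<dots> = (\<Sum>C\<in>fst ` ?O. b)" using \<C>(2) by (intro sum.cong) (auto simp: overlapping_def)
  also have "\<dots> = b * card (fst ` ?O)" by simp
  also have "\<dots> \<le> b * card ?O" using card_image_le[OF finO, of fst] by (intro mult_left_mono) auto
  finally have 3: "card R \<le> b * card ?O" .
  have "\<S> \<subseteq> \<C>" "\<Union>\<S> \<subseteq> A" "R \<subseteq> T" "T \<subseteq> \<Union>\<S> \<union> R" using B by (auto simp: \<S>_def R_def)
  then show ?thesis using 1 2 3 by blast
qed

text \<open>Markov's inequality disposes of the event of at least \<open>y\<close> overlapping
  pairs, at cost \<open>\<nu> / y\<close>. Otherwise the certificate provides a disjoint family of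
  copies, at most \<open>q\<close> further elements, and a set \<open>D\<close> for their union. The
  factors of the second term count these: \<open>a ^ t * exp x\<close> for the families weighted by
  their probabilities, the power of \<open>card E + 1\<close> for the further elements, the power of
  2 for \<open>D\<close>; the last one is Janson's bound.\<close>

lemma union_bound:
  fixes \<D> :: "'e set \<Rightarrow> 'e set set"
  assumes E: "finite E" and p: "0 \<le> p" "p \<le> 1"
    and \<C>: "\<And>B. B \<in> \<C> \<Longrightarrow> B \<subseteq> E \<and> card B = b"
    and D_card: "\<And>X. finite X \<Longrightarrow> finite (\<D> X) \<and> card (\<D> X) \<le> 2 ^ (L * card X)"
    and D_many: "\<And>X D. D \<in> \<D> X \<Longrightarrow> \<mu> \<le> real (card {B\<in>\<C>. B \<subseteq> D}) * p ^ b"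
    and \<nu>: "(\<Sum>(B, B')\<in>overlapping \<C>. p ^ card (B \<union> B')) \<le> \<nu>"
    and a: "1 \<le> a" "0 \<le> x" "real (card \<C>) * p ^ b \<le> a * x"
    and y: "0 < y" "real b * y \<le> real q"
    and bad: "\<And>A. A \<subseteq> E \<Longrightarrow> bad A \<Longrightarrow> \<exists>T. finite T \<and> card T \<le> t \<and>
        (\<forall>e\<in>T. \<exists>B\<in>\<C>. e \<in> B \<and> B \<subseteq> A) \<and>
        (\<forall>X. finite X \<and> T \<subseteq> X \<longrightarrow> (\<exists>D\<in>\<D> X. \<forall>B\<in>\<C>. \<not> B \<subseteq> A \<inter> D))"
  shows "bexp E p (\<lambda>A. of_bool (bad A)) \<le>
    \<nu> / y + a ^ t * exp x * (real (card E) + 1) ^ q * 2 ^ (L * (b * t + q)) * exp (- \<mu> + \<nu>)"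
proof -
  have fin\<C>: "finite \<C>" by (rule finite_subset[of _ "Pow E"]) (use \<C> E in auto)
  have finB: "finite B" if "B \<in> \<C>" for B using \<C>[OF that] E finite_subset by blast
  have finO: "finite (overlapping \<C>)"
    by (rule finite_subset[of _ "\<C> \<times> \<C>"]) (use fin\<C> in \<open>auto simp: overlapping_def\<close>)
  define pairs where "pairs = (\<lambda>A. \<Sum>(B, B')\<in>overlapping \<C>. of_bool (B \<union> B' \<subseteq> A) :: real)"
  have pairs_card: "pairs A = real (card {(B, B')\<in>overlapping \<C>. B \<union> B' \<subseteq> A})" for A
  proof -
    have "pairs A = (\<Sum>P\<in>overlapping \<C>. if (case P of (B, B') \<Rightarrow> B \<union> B' \<subseteq> A) then 1 else 0)"
      unfolding pairs_def by (intro sum.cong) auto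
    also have "\<dots> = real (card {P\<in>overlapping \<C>. case P of (B, B') \<Rightarrow> B \<union> B' \<subseteq> A})"
      using finO by (simp add: sum.inter_filter[symmetric])
    also have "{P\<in>overlapping \<C>. case P of (B, B') \<Rightarrow> B \<union> B' \<subseteq> A} =
       {(B, B')\<in>overlapping \<C>. B \<union> B' \<subseteq> A}" by auto
    finally show ?thesis .
  qed
  define SS where "SS = {\<S>. \<S> \<subseteq> \<C> \<and> card \<S> \<le> t \<and> disjoint \<S>}"
  define RR where "RR = {R. R \<subseteq> E \<and> card R \<le> q}"
  define none where "none = (\<lambda>D A. of_bool (\<forall>B\<in>{B\<in>\<C>. B \<subseteq> D}. \<not> B \<subseteq> A) :: real)"
  have finSS: "finite SS" unfolding SS_def using fin\<C> by auto
  have finRR: "finite RR" unfolding RR_def using E by auto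
  have finX: "finite (\<Union>\<S> \<union> R)" if "\<S> \<in> SS" "R \<in> RR" for \<S> R
    using that finB E fin\<C> finite_subset[of \<S> \<C>] finite_subset[of R E] by (auto simp: SS_def RR_def)
  define cost where "cost = (\<lambda>A. \<Sum>\<S>\<in>SS. \<Sum>R\<in>RR. \<Sum>D\<in>\<D> (\<Union>\<S> \<union> R). of_bool (\<Union>\<S> \<subseteq> A) * none D A)"
  \<comment> \<open>The restriction to few overlapping pairs disappears pointwise, before
    expectations are taken. What is left are products of an increasing and a decreasing event, as
    Harris' inequality requires.\<close>
  have pw: "of_bool (bad A) \<le> 1 / y * pairs A + cost A" if A: "A \<subseteq> E" for A
  proof (cases "bad A \<and> pairs A < y")
    case False
    have "0 \<le> cost A" unfolding cost_def none_def by (intro sum_nonneg) auto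
    moreover have "0 \<le> 1 / y * pairs A" unfolding pairs_card using y by simp
    moreover have "1 \<le> 1 / y * pairs A" if "bad A"
    proof -
      have "y \<le> pairs A" using that False by simp
      then show ?thesis using y by (simp add: field_simps)
    qed
    ultimately show ?thesis by (cases "bad A") auto
  next
    case True
    from bad[OF A] True obtain T where T: "finite T" "card T \<le> t" "\<forall>e\<in>T. \<exists>B\<in>\<C>. e \<in> B \<and> B \<subseteq> A"
      "\<forall>X. finite X \<and> T \<subseteq> X \<longrightarrow> (\<exists>D\<in>\<D> X. \<forall>B\<in>\<C>. \<not> B \<subseteq> A \<inter> D)" by blast
    have "\<exists>\<S> R. \<S> \<subseteq> \<C> \<and> card \<S> \<le> card T \<and> disjoint \<S> \<and> \<Union>\<S> \<subseteq> A \<and> R \<subseteq> T \<and> T \<subseteq> \<Union>\<S> \<union> R \<and>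
       card R \<le> b * card {(B, B')\<in>overlapping \<C>. B \<union> B' \<subseteq> A}"
      by (rule certificate[OF fin\<C> _ T(1)]) (use T(3) finB \<C> in auto)
    then obtain \<S> R where SR: "\<S> \<subseteq> \<C>" "card \<S> \<le> card T" "disjoint \<S>" "\<Union>\<S> \<subseteq> A" "R \<subseteq> T" "T \<subseteq> \<Union>\<S> \<union> R"
       "card R \<le> b * card {(B, B')\<in>overlapping \<C>. B \<union> B' \<subseteq> A}" by blast
    have "real (card R) \<le> real b * pairs A"
      unfolding pairs_card of_nat_mult[symmetric] of_nat_le_iff by (rule SR(7))
    also have "\<dots> \<le> real b * y" using True by (intro mult_left_mono) auto
    finally have "card R \<le> q" using y by linarith
    moreover have "R \<subseteq> E" using SR(5) T(3) A by blast
    ultimately have R: "R \<in> RR" by (simp add: RR_def)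
    have S: "\<S> \<in> SS" using SR T(2) by (simp add: SS_def)
    obtain D where D: "D \<in> \<D> (\<Union>\<S> \<union> R)" "\<forall>B\<in>\<C>. \<not> B \<subseteq> A \<inter> D"
      using T(4) finX[OF S R] SR(6) by blast
    have "1 = of_bool (\<Union>\<S> \<subseteq> A) * none D A" using SR(4) D(2) by (auto simp: none_def)
    also have "\<dots> \<le> (\<Sum>D\<in>\<D> (\<Union>\<S> \<union> R). of_bool (\<Union>\<S> \<subseteq> A) * none D A)"
      using D(1) D_card[OF finX[OF S R]] by (intro member_le_sum) (auto simp: none_def)
    also have "\<dots> \<le> (\<Sum>R\<in>RR. \<Sum>D\<in>\<D> (\<Union>\<S> \<union> R). of_bool (\<Union>\<S> \<subseteq> A) * none D A)"
      using R finRR by (intro member_le_sum[where f = "\<lambda>R. \<Sum>D\<in>\<D> (\<Union>\<S> \<union> R). of_bool (\<Union>\<S> \<subseteq> A) * none D A"])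
        (auto simp: none_def intro!: sum_nonneg)
    also have "\<dots> \<le> cost A" unfolding cost_def
      using S finSS by (intro member_le_sum[where
          f = "\<lambda>\<S>. \<Sum>R\<in>RR. \<Sum>D\<in>\<D> (\<Union>\<S> \<union> R). of_bool (\<Union>\<S> \<subseteq> A) * none D A"])
        (auto simp: none_def intro!: sum_nonneg)
    finally have "1 \<le> cost A" .
    moreover have "0 \<le> 1 / y * pairs A" using y unfolding pairs_card by simp
    ultimately show ?thesis by (simp add: True)
  qed
  have "bexp E p (\<lambda>A. of_bool (bad A)) \<le> bexp E p (\<lambda>A. 1 / y * pairs A + cost A)"
    by (rule bexp_mono[OF p pw])
  also have "\<dots> = 1 / y * bexp E p pairs + bexp E p cost" by (simp only: bexp_add bexp_cmult)
  also have "bexp E p pairs = (\<Sum>(B, B')\<in>overlapping \<C>. p ^ card (B \<union> B'))"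
    unfolding pairs_def bexp_sum case_prod_unfold
  proof (intro sum.cong refl bexp_superset[OF E])
    fix P assume "P \<in> overlapping \<C>"
    then have "fst P \<in> \<C>" "snd P \<in> \<C>" by (auto simp: overlapping_def)
    then show "fst P \<union> snd P \<subseteq> E" using \<C> by blast
  qed
  also have "bexp E p cost = (\<Sum>\<S>\<in>SS. \<Sum>R\<in>RR. \<Sum>D\<in>\<D> (\<Union>\<S> \<union> R).
      bexp E p (\<lambda>A. of_bool (\<Union>\<S> \<subseteq> A) * none D A))"
    unfolding cost_def bexp_sum ..
  finally have 1: "bexp E p (\<lambda>A. of_bool (bad A)) \<le>
      1 / y * (\<Sum>(B, B')\<in>overlapping \<C>. p ^ card (B \<union> B')) +
      (\<Sum>\<S>\<in>SS. \<Sum>R\<in>RR. \<Sum>D\<in>\<D> (\<Union>\<S> \<union> R). bexp E p (\<lambda>A. of_bool (\<Union>\<S> \<subseteq> A) * none D A))" .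
  have "1 / y * (\<Sum>(B, B')\<in>overlapping \<C>. p ^ card (B \<union> B')) \<le> 1 / y * \<nu>"
    using \<nu> y by (intro mult_left_mono) auto
  then have 2: "1 / y * (\<Sum>(B, B')\<in>overlapping \<C>. p ^ card (B \<union> B')) \<le> \<nu> / y" by simp
  define G where "G = 2 ^ (L * (b * t + q)) * exp (- \<mu> + \<nu>)"
  have G0: "0 \<le> G" by (simp add: G_def)
  \<comment> \<open>Disjointness makes the presence of the family cost exactly \<open>p ^ b\<close>
    per copy.\<close>
  have one: "bexp E p (\<lambda>A. of_bool (\<Union>\<S> \<subseteq> A) * none D A) \<le> (p ^ b) ^ card \<S> * exp (- \<mu> + \<nu>)"
    if S: "\<S> \<in> SS" and D: "D \<in> \<D> X" for \<S> D X
  proof -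
    let ?CD = "{B\<in>\<C>. B \<subseteq> D}"
    have SE: "\<Union>\<S> \<subseteq> E" using S \<C> by (auto simp: SS_def)
    have "card (\<Union>\<S>) = (\<Sum>B\<in>\<S>. card B)"
      using S finB by (intro card_Union_disjoint) (auto simp: SS_def)
    also have "\<dots> = (\<Sum>B\<in>\<S>. b)" using S \<C> by (intro sum.cong) (auto simp: SS_def)
    finally have cS: "card (\<Union>\<S>) = b * card \<S>" by simp
    have "bexp E p (none D) \<le> exp (- (\<Sum>B\<in>?CD. p ^ card B) +
         (\<Sum>B\<in>?CD. \<Sum>B' | B' \<in> ?CD \<and> B' \<noteq> B \<and> B \<inter> B' \<noteq> {}. p ^ card (B \<union> B')))"
      unfolding none_def by (rule janson[OF E p]) (use fin\<C> \<C> in auto)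
    also have "\<dots> \<le> exp (- \<mu> + \<nu>)"
    proof -
      have "(\<Sum>B\<in>?CD. p ^ card B) = (\<Sum>B\<in>?CD. p ^ b)" using \<C> by (intro sum.cong) auto
      then have "\<mu> \<le> (\<Sum>B\<in>?CD. p ^ card B)" using D_many[OF D] by simp
      moreover have "(\<Sum>B\<in>?CD. \<Sum>B' | B' \<in> ?CD \<and> B' \<noteq> B \<and> B \<inter> B' \<noteq> {}. p ^ card (B \<union> B'))
          = (\<Sum>(B, B')\<in>overlapping ?CD. p ^ card (B \<union> B'))"
        using fin\<C> by (intro sum_overlapping) auto
      moreover have "\<dots> \<le> (\<Sum>(B, B')\<in>overlapping \<C>. p ^ card (B \<union> B'))"
        using finO p by (intro sum_mono2) (auto simp: overlapping_def)
      ultimately show ?thesis using \<nu> by simp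
    qed
    finally have j: "bexp E p (none D) \<le> exp (- \<mu> + \<nu>)" .
    have "bexp E p (\<lambda>A. of_bool (\<Union>\<S> \<subseteq> A) * none D A) \<le>
        bexp E p (\<lambda>A. of_bool (\<Union>\<S> \<subseteq> A)) * bexp E p (none D)"
      unfolding none_def by (rule harris[OF E p mono_superset antimono_avoids])
    also have "\<dots> = (p ^ b) ^ card \<S> * bexp E p (none D)"
      by (simp add: bexp_superset[OF E SE] cS power_mult)
    also have "\<dots> \<le> (p ^ b) ^ card \<S> * exp (- \<mu> + \<nu>)" using j p by (intro mult_left_mono) auto
    finally show ?thesis .
  qed
  have "(\<Sum>\<S>\<in>SS. \<Sum>R\<in>RR. \<Sum>D\<in>\<D> (\<Union>\<S> \<union> R). bexp E p (\<lambda>A. of_bool (\<Union>\<S> \<subseteq> A) * none D A))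
     \<le> (\<Sum>\<S>\<in>SS. \<Sum>R\<in>RR. (p ^ b) ^ card \<S> * G)"
  proof (intro sum_mono)
    fix \<S> R assume S: "\<S> \<in> SS" and R: "R \<in> RR"
    let ?X = "\<Union>\<S> \<union> R"
    have "card ?X \<le> card (\<Union>\<S>) + card R" by (rule card_Un_le)
    moreover have "card (\<Union>\<S>) \<le> (\<Sum>B\<in>\<S>. card B)"
      using S finB by (intro card_Union_le_sum_card_weak) (auto simp: SS_def)
    moreover have "(\<Sum>B\<in>\<S>. card B) = (\<Sum>B\<in>\<S>. b)" using S \<C> by (intro sum.cong) (auto simp: SS_def)
    moreover have "(\<Sum>B\<in>\<S>. b) \<le> b * t" using S by (simp add: SS_def)
    moreover have "card R \<le> q" using R by (simp add: RR_def)
    ultimately have X: "card ?X \<le> b * t + q" by linarith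
    have "(\<Sum>D\<in>\<D> ?X. bexp E p (\<lambda>A. of_bool (\<Union>\<S> \<subseteq> A) * none D A)) \<le>
        real (card (\<D> ?X)) * ((p ^ b) ^ card \<S> * exp (- \<mu> + \<nu>))"
      using one[OF S] by (intro sum_bounded_above)
    also have "\<dots> \<le> 2 ^ (L * (b * t + q)) * ((p ^ b) ^ card \<S> * exp (- \<mu> + \<nu>))"
    proof (rule mult_right_mono)
      have "card (\<D> ?X) \<le> 2 ^ (L * card ?X)" using D_card[OF finX[OF S R]] by blast
      also have "\<dots> \<le> 2 ^ (L * (b * t + q))" using X by (intro power_increasing mult_left_mono) auto
      finally show "real (card (\<D> ?X)) \<le> 2 ^ (L * (b * t + q))"
        by (metis of_nat_le_iff of_nat_numeral of_nat_power)
    qed (use p in auto)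
    finally show "(\<Sum>D\<in>\<D> ?X. bexp E p (\<lambda>A. of_bool (\<Union>\<S> \<subseteq> A) * none D A)) \<le> (p ^ b) ^ card \<S> * G"
      by (simp add: G_def mult_ac)
  qed
  also have "\<dots> = real (card RR) * G * (\<Sum>\<S>\<in>SS. (p ^ b) ^ card \<S>)"
    by (simp add: sum_distrib_left mult_ac)
  also have "\<dots> \<le> (real (card E) + 1) ^ q * G * (a ^ t * exp x)"
  proof (intro mult_mono mult_right_mono G0)
    have "real (card RR) \<le> real ((card E + 1) ^ q)"
      unfolding of_nat_le_iff RR_def by (rule card_subsets_le[OF E])
    then show "real (card RR) \<le> (real (card E) + 1) ^ q" by (simp add: add.commute)
    have "(\<Sum>\<S>\<in>SS. (p ^ b) ^ card \<S>) \<le> (\<Sum>\<S> | \<S> \<subseteq> \<C> \<and> card \<S> \<le> t. (p ^ b) ^ card \<S>)"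
      unfolding SS_def using fin\<C> p by (intro sum_mono2) auto
    also have "\<dots> \<le> (\<Sum>s\<le>t. (real (card \<C>) * p ^ b) ^ s / fact s)"
      using fin\<C> p by (intro sum_subfamilies_le) auto
    also have "\<dots> \<le> (\<Sum>s\<le>t. (a * x) ^ s / fact s)"
      using a p by (intro sum_mono divide_right_mono power_mono) auto
    also have "\<dots> \<le> a ^ t * exp x" by (rule exp_partial_sum_le[OF a(1,2)])
    finally show "(\<Sum>\<S>\<in>SS. (p ^ b) ^ card \<S>) \<le> a ^ t * exp x" .
    show "0 \<le> (real (card E) + 1) ^ q * G" using G0 by simp
    show "0 \<le> (\<Sum>\<S>\<in>SS. (p ^ b) ^ card \<S>)" using p by (intro sum_nonneg) auto
  qed auto
  finally have 3: "(\<Sum>\<S>\<in>SS. \<Sum>R\<in>RR. \<Sum>D\<in>\<D> (\<Union>\<S> \<union> R). bexp E p (\<lambda>A. of_bool (\<Union>\<S> \<subseteq> A) * none D A))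
     \<le> (real (card E) + 1) ^ q * G * (a ^ t * exp x)" .
  have "(real (card E) + 1) ^ q * G * (a ^ t * exp x) =
    a ^ t * exp x * (real (card E) + 1) ^ q * 2 ^ (L * (b * t + q)) * exp (- \<mu> + \<nu>)"
    by (simp add: G_def mult_ac)
  then show ?thesis using 1 2 3 by linarith
qed

section \<open>Overlapping copies\<close>

definition copies :: "'a hypergraph \<Rightarrow> nat \<Rightarrow> nat set set set" where
  "copies F n = (\<lambda>\<phi>. copy \<phi> (edges F)) ` embeddings F n"

lemma finite_copies: "uniform_hypergraph k F \<Longrightarrow> finite (copies F n)"
  unfolding copies_def by (intro finite_imageI finite_embeddings) (simp add: uniform_hypergraph_def)

lemma card_copies_le: "uniform_hypergraph k F \<Longrightarrow> card (copies F n) \<le> n ^ card (verts F)"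
  unfolding copies_def
  by (rule order_trans[OF card_image_le card_embeddings_le])
     (auto simp: uniform_hypergraph_def intro: finite_embeddings)

text \<open>For a fixed copy \<open>B\<close>, the edges that another copy's embedding sends into
  \<open>B\<close> form a nonempty proper subset \<open>E'\<close> of \<open>edges F\<close>.
  Summing over \<open>E'\<close> and over its possible images in \<open>B\<close>, at most
  \<open>2 ^ card (edges F)\<close> many, leaves embeddings with a prescribed image of
  \<open>E'\<close>.\<close>

lemma overlap_sum_le:
  assumes F: "uniform_hypergraph k F" and p: "0 \<le> p" "p \<le> 1"
  shows "(\<Sum>(B, B')\<in>overlapping (copies F n). p ^ card (B \<union> B')) \<le>
    real n ^ card (verts F) * p ^ card (edges F) *
    (\<Sum>E' | E' \<subset> edges F \<and> E' \<noteq> {}. 2 ^ card (edges F) * real (card (verts F)) ^ card (verts F) *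
       (real n ^ (card (verts F) - card (\<Union>E')) * p ^ (card (edges F) - card E')))"
proof -
  define v b where "v = card (verts F)" and "b = card (edges F)"
  let ?\<C> = "copies F n" and ?P = "{E'. E' \<subset> edges F \<and> E' \<noteq> {}}"
  define inner where "inner = (\<Sum>E'\<in>?P. 2 ^ b * real v ^ v * (real n ^ (v - card (\<Union>E')) * p ^ (b - card E')))"
  have fin: "finite (embeddings F n)" using F by (intro finite_embeddings) (simp add: uniform_hypergraph_def)
  have finE: "finite (edges F)" by (rule finite_edges[OF F])
  have finP: "finite ?P" by (rule finite_subset[of _ "Pow (edges F)"]) (use finE in auto)
  have Bcard: "card B = b" "finite B" if "B \<in> ?\<C>" for B
    using that card_copy[OF F] finE by (auto simp: copies_def b_def)
  have inner0: "0 \<le> inner" unfolding inner_def using p by (intro sum_nonneg) auto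
  have per: "(\<Sum>B' | B' \<in> ?\<C> \<and> B' \<noteq> B \<and> B \<inter> B' \<noteq> {}. p ^ card (B \<union> B')) \<le> p ^ b * inner"
    if B: "B \<in> ?\<C>" for B
  proof -
    let ?S = "{\<phi>\<in>embeddings F n. copy \<phi> (edges F) \<noteq> B \<and> B \<inter> copy \<phi> (edges F) \<noteq> {}}"
    let ?N = "{B'. B' \<in> ?\<C> \<and> B' \<noteq> B \<and> B \<inter> B' \<noteq> {}}"
    have finS: "finite ?S" using fin by auto
    have N: "?N = (\<lambda>\<phi>. copy \<phi> (edges F)) ` ?S" unfolding copies_def by (rule Compr_image_eq)
    have "(\<Sum>B'\<in>?N. p ^ card (B \<union> B')) = (\<Sum>B'\<in>?N. p ^ b * p ^ (b - card (B \<inter> B')))"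
    proof (rule sum.cong[OF refl])
      fix B' assume "B' \<in> ?N"
      then have B': "card B' = b" "finite B'" using Bcard by auto
      have "card (B \<union> B') + card (B \<inter> B') = b + b"
        using card_Un_Int[of B B'] Bcard[OF B] B' by simp
      moreover have "card (B \<inter> B') \<le> b" using card_mono[of B "B \<inter> B'"] Bcard[OF B] by auto
      ultimately have "card (B \<union> B') = b + (b - card (B \<inter> B'))" by linarith
      then show "p ^ card (B \<union> B') = p ^ b * p ^ (b - card (B \<inter> B'))" by (simp add: power_add)
    qed
    also have "\<dots> = p ^ b * (\<Sum>B'\<in>?N. p ^ (b - card (B \<inter> B')))" by (simp add: sum_distrib_left)
    also have "(\<Sum>B'\<in>?N. p ^ (b - card (B \<inter> B'))) \<le>
        (\<Sum>\<phi>\<in>?S. p ^ (b - card (B \<inter> copy \<phi> (edges F))))"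
      unfolding N using sum_image_le[OF finS, of "\<lambda>B'. p ^ (b - card (B \<inter> B'))" "\<lambda>\<phi>. copy \<phi> (edges F)"] p
      by (simp add: o_def)
    \<comment> \<open>Some pair \<open>E'\<close>, \<open>J\<close> describes the overlap of
      \<open>\<phi>\<close> with \<open>B\<close>; summing over all pairs allows the order of
      summation to be exchanged.\<close>
    also have "\<dots> \<le> (\<Sum>\<phi>\<in>?S. \<Sum>E'\<in>?P. \<Sum>J\<in>Pow B. if copy \<phi> E' = J then p ^ (b - card E') else 0)"
    proof (rule sum_mono)
      fix \<phi> assume "\<phi> \<in> ?S"
      then have \<phi>: "\<phi> \<in> embeddings F n" "copy \<phi> (edges F) \<noteq> B" "B \<inter> copy \<phi> (edges F) \<noteq> {}" by auto
      define E' where "E' = {e\<in>edges F. \<phi> ` e \<in> B}"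
      have J: "copy \<phi> E' = B \<inter> copy \<phi> (edges F)" by (auto simp: E'_def)
      have cE: "card (B \<inter> copy \<phi> (edges F)) = card E'"
        unfolding J[symmetric] by (rule card_copy[OF F \<phi>(1)]) (auto simp: E'_def)
      \<comment> \<open>All copies have equally many edges, so one contained in \<open>B\<close>
        would equal \<open>B\<close>.\<close>
      have "E' \<noteq> edges F"
      proof
        assume "E' = edges F"
        then have "copy \<phi> (edges F) \<subseteq> B" using J by auto
        moreover have "card (copy \<phi> (edges F)) = card B"
          using card_copy[OF F \<phi>(1)] Bcard(1)[OF B] by (simp add: b_def)
        ultimately show False using card_subset_eq[OF Bcard(2)[OF B]] \<phi>(2) by blast
      qed
      then have E': "E' \<in> ?P" using \<phi>(3) by (auto simp: E'_def)
      have "p ^ (b - card (B \<inter> copy \<phi> (edges F))) = (if copy \<phi> E' = copy \<phi> E' then p ^ (b - card E') else 0)"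
        by (simp add: cE)
      also have "\<dots> \<le> (\<Sum>J\<in>Pow B. if copy \<phi> E' = J then p ^ (b - card E') else 0)"
        using J Bcard(2)[OF B] p by (intro member_le_sum) auto
      also have "\<dots> \<le> (\<Sum>E'\<in>?P. \<Sum>J\<in>Pow B. if copy \<phi> E' = J then p ^ (b - card E') else 0)"
        by (intro member_le_sum[where f = "\<lambda>E'. \<Sum>J\<in>Pow B. if copy \<phi> E' = J then p ^ (b - card E') else 0"]
              E' finP sum_nonneg) (simp add: p)
      finally show "p ^ (b - card (B \<inter> copy \<phi> (edges F))) \<le>
        (\<Sum>E'\<in>?P. \<Sum>J\<in>Pow B. if copy \<phi> E' = J then p ^ (b - card E') else 0)" .
    qed
    also have "\<dots> = (\<Sum>E'\<in>?P. \<Sum>\<phi>\<in>?S. \<Sum>J\<in>Pow B. if copy \<phi> E' = J then p ^ (b - card E') else 0)"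
      by (rule sum.swap)
    also have "\<dots> = (\<Sum>E'\<in>?P. \<Sum>J\<in>Pow B. \<Sum>\<phi>\<in>?S. if copy \<phi> E' = J then p ^ (b - card E') else 0)"
      by (intro sum.cong refl sum.swap)
    also have "\<dots> \<le> (\<Sum>E'\<in>?P. \<Sum>J\<in>Pow B. real v ^ v * real n ^ (v - card (\<Union>E')) * p ^ (b - card E'))"
    proof (intro sum_mono)
      fix E' J assume "E' \<in> ?P"
      then have E': "E' \<subseteq> edges F" by auto
      have "(\<Sum>\<phi>\<in>?S. if copy \<phi> E' = J then p ^ (b - card E') else 0) =
          real (card {\<phi>\<in>?S. copy \<phi> E' = J}) * p ^ (b - card E')"
        using finS by (simp add: sum.inter_filter[symmetric])
      also have "\<dots> \<le> real (v ^ v * n ^ (v - card (\<Union>E'))) * p ^ (b - card E')"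
      proof (intro mult_right_mono)
        have "card {\<phi>\<in>?S. copy \<phi> E' = J} \<le> card {\<phi>\<in>embeddings F n. copy \<phi> E' = J}"
          using fin by (intro card_mono) auto
        also have "\<dots> \<le> v ^ v * n ^ (v - card (\<Union>E'))"
          unfolding v_def by (rule card_embeddings_fixed[OF F E'])
        finally show "real (card {\<phi>\<in>?S. copy \<phi> E' = J}) \<le> real (v ^ v * n ^ (v - card (\<Union>E')))"
          unfolding of_nat_le_iff .
      qed (use p in auto)
      finally show "(\<Sum>\<phi>\<in>?S. if copy \<phi> E' = J then p ^ (b - card E') else 0) \<le>
         real v ^ v * real n ^ (v - card (\<Union>E')) * p ^ (b - card E')" by simp
    qed
    also have "\<dots> = inner"
      using Bcard[OF B] by (simp add: inner_def card_Pow mult_ac)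
    finally show ?thesis using p by (simp add: mult_left_mono)
  qed
  have "(\<Sum>(B, B')\<in>overlapping ?\<C>. p ^ card (B \<union> B')) =
      (\<Sum>B\<in>?\<C>. \<Sum>B' | B' \<in> ?\<C> \<and> B' \<noteq> B \<and> B \<inter> B' \<noteq> {}. p ^ card (B \<union> B'))"
    by (rule sum_overlapping[OF finite_copies[OF F], symmetric])
  also have "\<dots> \<le> real (card ?\<C>) * (p ^ b * inner)" by (rule sum_bounded_above[OF per])
  also have "\<dots> \<le> real n ^ v * (p ^ b * inner)"
    using card_copies_le[OF F, of n] inner0 p
    by (intro mult_right_mono) (auto simp: v_def simp flip: of_nat_power)
  finally show ?thesis by (simp add: v_def b_def inner_def mult.assoc)
qed

text \<open>Converts counts of embeddings into counts of copies: as the edges span all vertices, the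
  edge set of a copy determines its vertex set, so boundedly many embeddings share it.\<close>

lemma card_copies_ge:
  assumes F: "uniform_hypergraph k F" and span: "\<Union>(edges F) = verts F"
  shows "card {\<phi>\<in>embeddings F n. copy \<phi> (edges F) \<subseteq> D} \<le>
    card (verts F) ^ card (verts F) * card {B\<in>copies F n. B \<subseteq> D}"
proof -
  let ?\<C> = "{B\<in>copies F n. B \<subseteq> D}"
  have fin: "finite (embeddings F n)" using F by (intro finite_embeddings) (simp add: uniform_hypergraph_def)
  have finC: "finite ?\<C>" using finite_copies[OF F] by auto
  have "card {\<phi>\<in>embeddings F n. copy \<phi> (edges F) \<subseteq> D} \<le>
      card (\<Union>B\<in>?\<C>. {\<phi>\<in>embeddings F n. copy \<phi> (edges F) = B})"
    using fin finC by (intro card_mono) (auto simp: copies_def)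
  also have "\<dots> \<le> (\<Sum>B\<in>?\<C>. card {\<phi>\<in>embeddings F n. copy \<phi> (edges F) = B})"
    by (rule card_UN_le[OF finC])
  also have "\<dots> \<le> (\<Sum>B\<in>?\<C>. card (verts F) ^ card (verts F))"
    using card_embeddings_fixed[OF F subset_refl, of n] span by (intro sum_mono) simp
  finally show ?thesis by (simp add: mult.commute)
qed

section \<open>From finite sums to the random hypergraph\<close>

lemma prob_Pi_pmf_bernoulli:
  assumes E: "finite E" and p: "0 \<le> p" "p \<le> 1"
  shows "measure_pmf.prob (Pi_pmf E False (\<lambda>_. bernoulli_pmf p)) {f. Q {e\<in>E. f e}} =
    bexp E p (\<lambda>A. of_bool (Q A))"
proof -
  let ?M = "Pi_pmf E False (\<lambda>_. bernoulli_pmf p)"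
  let ?X = "(\<lambda>A e. e \<in> A) ` {A\<in>Pow E. Q A}"
  have inj: "inj_on (\<lambda>A (e::'a). e \<in> A) \<A>" for \<A> by (rule inj_onI) (auto simp: fun_eq_iff)
  have sub: "?X \<subseteq> {f. Q {e\<in>E. f e}}"
  proof
    fix f assume "f \<in> ?X"
    then obtain A where A: "A \<subseteq> E" "Q A" "f = (\<lambda>e. e \<in> A)" by auto
    then have "{e\<in>E. f e} = A" by auto
    then show "f \<in> {f. Q {e\<in>E. f e}}" using A by simp
  qed
  have sup: "f \<in> ?X" if "f \<in> {f. Q {e\<in>E. f e}}" "f \<in> set_pmf ?M" for f
  proof -
    have "f e = False" if "e \<notin> E" for e
      using \<open>f \<in> set_pmf ?M\<close> set_Pi_pmf_subset[OF E, of False "\<lambda>_. bernoulli_pmf p"] that by auto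
    then have "f = (\<lambda>e. e \<in> {e\<in>E. f e})" by auto
    moreover have "{e\<in>E. f e} \<in> {A\<in>Pow E. Q A}" using that(1) by simp
    ultimately show ?thesis by (rule image_eqI)
  qed
  have "measure_pmf.prob ?M {f. Q {e\<in>E. f e}} = measure_pmf.prob ?M ({f. Q {e\<in>E. f e}} \<inter> set_pmf ?M)"
    by (rule measure_Int_set_pmf[symmetric])
  also have "{f. Q {e\<in>E. f e}} \<inter> set_pmf ?M = ?X \<inter> set_pmf ?M" using sub sup by blast
  also have "measure_pmf.prob ?M (?X \<inter> set_pmf ?M) = measure_pmf.prob ?M ?X" by (rule measure_Int_set_pmf)
  also have "\<dots> = sum (pmf ?M) ?X" using E by (intro measure_measure_pmf_finite) auto
  also have "\<dots> = (\<Sum>A | A \<in> Pow E \<and> Q A. pmf ?M (\<lambda>e. e \<in> A))"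
    by (subst sum.reindex[OF inj]) (simp add: o_def)
  also have "\<dots> = (\<Sum>A | A \<in> Pow E \<and> Q A. p ^ card A * (1 - p) ^ card (E - A))"
  proof (rule sum.cong[OF refl])
    fix A assume "A \<in> {A. A \<in> Pow E \<and> Q A}"
    then have A: "A \<subseteq> E" by auto
    have "pmf ?M (\<lambda>e. e \<in> A) = (\<Prod>e\<in>E. pmf (bernoulli_pmf p) (e \<in> A))"
      using A E by (subst pmf_Pi') auto
    also have "\<dots> = (\<Prod>e\<in>E. if e \<in> A then p else 1 - p)"
      using p by (intro prod.cong) auto
    also have "\<dots> = p ^ card (E \<inter> A) * (1 - p) ^ card (E \<inter> - A)"
      using E by (simp add: prod.If_cases)
    also have "E \<inter> A = A" using A by auto
    also have "E \<inter> - A = E - A" by auto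
    finally show "pmf ?M (\<lambda>e. e \<in> A) = p ^ card A * (1 - p) ^ card (E - A)" .
  qed
  also have "\<dots> = bexp E p (\<lambda>A. of_bool (Q A))"
    unfolding bexp_def using E by (intro sum.mono_neutral_cong_left) auto
  finally show ?thesis .
qed

lemma prob_binomial_hypergraph:
  assumes "0 \<le> p" "p \<le> 1"
  shows "measure_pmf.prob (binomial_hypergraph k n p) {G. Q G} =
    bexp (k_subsets k n) p (\<lambda>A. of_bool (Q (Hypergraph {..<n} A)))"
  unfolding binomial_hypergraph_def measure_map_pmf
  using prob_Pi_pmf_bernoulli[OF finite_k_subsets[of k n] assms, of "\<lambda>A. Q (Hypergraph {..<n} A)"]
  by (simp add: vimage_def)

section \<open>The Ramsey property\<close>

lemma ramsey_arrow_mono: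
  assumes "ramsey_arrow (Hypergraph V A) r F" "A \<subseteq> B"
  shows "ramsey_arrow (Hypergraph V B) r F"
  unfolding ramsey_arrow_def
proof (intro allI impI)
  fix c assume "\<forall>e\<in>edges (Hypergraph V B). c e \<in> {1..r}"
  then have "\<forall>e\<in>edges (Hypergraph V A). c e \<in> {1..r}" using assms(2) by auto
  then obtain i H where "i \<in> {1..r}" "subhypergraph H (Hypergraph V A)" "hypergraph_iso (F i) H"
    "\<forall>e\<in>edges H. c e = i" using assms(1) unfolding ramsey_arrow_def by blast
  moreover have "subhypergraph H (Hypergraph V B)"
    using calculation(2) assms(2) by (auto simp: subhypergraph_def)
  ultimately show "\<exists>i\<in>{1..r}. \<exists>H. subhypergraph H (Hypergraph V B) \<and> hypergraph_iso (F i) H \<and>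
    (\<forall>e\<in>edges H. c e = i)" by blast
qed

lemma not_ramsey_arrowE:
  assumes F: "\<And>i. i \<in> {1..r} \<Longrightarrow> uniform_hypergraph k (F i)"
    and nr: "\<not> ramsey_arrow (Hypergraph {..<n} A) r F"
  obtains c where "\<And>e. e \<in> A \<Longrightarrow> c e \<in> {1..r}"
    "\<And>i \<phi>. i \<in> {1..r} \<Longrightarrow> \<phi> \<in> embeddings (F i) n \<Longrightarrow> copy \<phi> (edges (F i)) \<subseteq> A \<Longrightarrow>
        \<exists>f\<in>copy \<phi> (edges (F i)). c f \<noteq> i"
proof -
  from nr obtain c where c: "\<forall>e\<in>A. c e \<in> {1..r}" and
    no: "\<not> (\<exists>i\<in>{1..r}. \<exists>H. subhypergraph H (Hypergraph {..<n} A) \<and> hypergraph_iso (F i) H \<and>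
      (\<forall>e\<in>edges H. c e = i))"
    unfolding ramsey_arrow_def not_all not_imp hypergraph.sel by (elim exE conjE)
  have "\<exists>f\<in>copy \<phi> (edges (F i)). c f \<noteq> i"
    if i: "i \<in> {1..r}" and \<phi>: "\<phi> \<in> embeddings (F i) n" and A: "copy \<phi> (edges (F i)) \<subseteq> A" for i \<phi>
  proof -
    let ?H = "Hypergraph (\<phi> ` verts (F i)) (copy \<phi> (edges (F i)))"
    have "\<phi> ` e \<subseteq> \<phi> ` verts (F i)" if "e \<in> edges (F i)" for e
      using F[OF i] that unfolding uniform_hypergraph_def by (intro image_mono) blast
    moreover have "\<phi> ` verts (F i) \<subseteq> {..<n}" using \<phi> by (auto simp: embeddings_def)
    ultimately have "subhypergraph ?H (Hypergraph {..<n} A)"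
      using A by (simp add: subhypergraph_def)
    moreover have "hypergraph_iso (F i) ?H"
      unfolding hypergraph_iso_def using \<phi> by (intro exI[of _ \<phi>]) (simp add: embeddings_def bij_betw_def)
    ultimately have "\<not> (\<forall>f\<in>edges ?H. c f = i)" using no i by blast
    then show ?thesis by simp
  qed
  with c show ?thesis using that[of c] by blast
qed

text \<open>The colour classes are cut down to edges in copies of \<open>F 1\<close> inside
  \<open>A\<close>, which places the fingerprint in such copies and makes it encodable. The cut is
  harmless, because it keeps every edge of every such copy.\<close>

lemma not_ramsey_arrow_fingerprint:
  fixes F :: "nat \<Rightarrow> 'a hypergraph"
  assumes r: "2 \<le> r"
    and F: "\<And>i. i \<in> {1..r} \<Longrightarrow> uniform_hypergraph k (F i)"
    and fam: "complement_family r k F n \<delta> L s \<D>"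
    and A: "A \<subseteq> k_subsets k n" and nr: "\<not> ramsey_arrow (Hypergraph {..<n} A) r F"
  shows "\<exists>T. finite T \<and> card T \<le> nat \<lfloor>s\<rfloor> \<and> (\<forall>e\<in>T. \<exists>B\<in>copies (F 1) n. e \<in> B \<and> B \<subseteq> A) \<and>
        (\<forall>X. finite X \<and> T \<subseteq> X \<longrightarrow> (\<exists>D\<in>\<D> X. \<forall>B\<in>copies (F 1) n. \<not> B \<subseteq> A \<inter> D))"
proof -
  from not_ramsey_arrowE[OF F nr] obtain c where c: "\<And>e. e \<in> A \<Longrightarrow> c e \<in> {1..r}" and
    no: "\<And>i \<phi>. i \<in> {1..r} \<Longrightarrow> \<phi> \<in> embeddings (F i) n \<Longrightarrow> copy \<phi> (edges (F i)) \<subseteq> A \<Longrightarrow>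
        \<exists>f\<in>copy \<phi> (edges (F i)). c f \<noteq> i" by blast
  define Z where "Z = {e\<in>A. \<exists>B\<in>copies (F 1) n. e \<in> B \<and> B \<subseteq> A}"
  define I where "I = (\<lambda>i. {e\<in>Z. c e = i})"
  have ZA: "Z \<subseteq> A" by (auto simp: Z_def)
  have "\<exists>T. T \<subseteq> (\<Union>i\<in>{2..r}. I i) \<and> real (card T) \<le> s \<and>
           (\<forall>X. finite X \<and> T \<subseteq> X \<longrightarrow> (\<exists>D\<in>\<D> X. D \<inter> (\<Union>i\<in>{2..r}. I i) = {}))"
  proof (rule fam[unfolded complement_family_def, THEN conjunct2, THEN conjunct2, THEN spec, THEN mp],
      intro ballI conjI)
    fix i assume i: "i \<in> {2..r}"
    have IA: "I i \<subseteq> A" using ZA by (auto simp: I_def)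
    then show "I i \<subseteq> k_subsets k n" using A by blast
    fix \<phi> assume \<phi>: "\<phi> \<in> embeddings (F i) n"
    show "\<not> copy \<phi> (edges (F i)) \<subseteq> I i"
    proof
      assume sub: "copy \<phi> (edges (F i)) \<subseteq> I i"
      have "i \<in> {1..r}" using i by auto
      from no[OF this \<phi> order_trans[OF sub IA]] obtain f
        where "f \<in> copy \<phi> (edges (F i))" "c f \<noteq> i" by blast
      then show False using sub by (auto simp: I_def)
    qed
  qed
  then obtain T where T_all: "T \<subseteq> (\<Union>i\<in>{2..r}. I i) \<and> real (card T) \<le> s \<and>
      (\<forall>X. finite X \<and> T \<subseteq> X \<longrightarrow> (\<exists>D\<in>\<D> X. D \<inter> (\<Union>i\<in>{2..r}. I i) = {}))" by (rule exE)
  have T: "T \<subseteq> (\<Union>i\<in>{2..r}. I i)" "real (card T) \<le> s"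
    "\<And>X. finite X \<Longrightarrow> T \<subseteq> X \<Longrightarrow> \<exists>D\<in>\<D> X. D \<inter> (\<Union>i\<in>{2..r}. I i) = {}"
    using T_all by simp_all
  have TZ: "T \<subseteq> Z" using T(1) by (auto simp: I_def)
  have f1: "finite T" using TZ ZA A finite_k_subsets finite_subset by (meson subset_trans)
  have f2: "card T \<le> nat \<lfloor>s\<rfloor>" using T(2) by (simp add: le_nat_floor)
  have f3: "\<forall>e\<in>T. \<exists>B\<in>copies (F 1) n. e \<in> B \<and> B \<subseteq> A" using TZ by (auto simp: Z_def)
  have f4: "\<exists>D\<in>\<D> X. \<forall>B\<in>copies (F 1) n. \<not> B \<subseteq> A \<inter> D" if X: "finite X" "T \<subseteq> X" for X
  proof -
    from T(3)[OF X] obtain D where D: "D \<in> \<D> X" "D \<inter> (\<Union>i\<in>{2..r}. I i) = {}" by blast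
    have "\<not> B \<subseteq> A \<inter> D" if B: "B \<in> copies (F 1) n" for B
    proof
      assume BAD: "B \<subseteq> A \<inter> D"
      from B obtain \<phi> where \<phi>: "\<phi> \<in> embeddings (F 1) n" "B = copy \<phi> (edges (F 1))"
        by (auto simp: copies_def)
      \<comment> \<open>Some edge of the copy has a colour other than 1; lying in a copy, it belongs
        to a class \<open>I i\<close>, which \<open>D\<close> avoids.\<close>
      obtain f where f: "f \<in> B" "c f \<noteq> 1" using no[of 1 \<phi>] \<phi> BAD r by auto
      have fA: "f \<in> A" "f \<in> D" using f BAD by auto
      have "f \<in> Z" using fA f(1) B BAD by (auto simp: Z_def)
      moreover have "c f \<in> {2..r}" using c[OF fA(1)] f(2) by auto
      ultimately have "f \<in> (\<Union>i\<in>{2..r}. I i)" by (auto simp: I_def)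
      then show False using D(2) fA(2) by blast
    qed
    then show ?thesis using D(1) by blast
  qed
  show ?thesis
    by (intro exI[of _ T] conjI allI impI f1 f2 f3, elim conjE, rule f4)
qed

text \<open>Only \<open>F1\<close> itself can attain the maximum. This yields the equality of
  exponents for \<open>F1\<close>, a strict inequality for each proper nonempty edge set, and the
  absence of isolated vertices, since deleting one would increase the quotient.\<close>

lemma strictly_balanced_strict:
  assumes F1: "uniform_hypergraph k F1" and e: "1 \<le> card (edges F1)"
    and sb: "strictly_balanced k F1 F2" and m2: "0 < max_k_dens k F2"
  shows "0 < max_asym_dens k F1 F2"
    and "real (card (edges F1)) / max_asym_dens k F1 F2 =
           real (card (verts F1)) - real k + 1 / max_k_dens k F2"
    and "\<And>E. E \<subset> edges F1 \<Longrightarrow> E \<noteq> {} \<Longrightarrow> real (card E) / max_asym_dens k F1 F2 <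
           real (card (\<Union>E)) - real k + 1 / max_k_dens k F2"
    and "\<Union>(edges F1) = verts F1"
proof -
  define m where "m = max_asym_dens k F1 F2"
  define m2' where "m2' = 1 / max_k_dens k F2"
  have m2': "0 < m2'" using m2 by (simp add: m2'_def)
  let ?\<H> = "{H. subhypergraph H F1 \<and> card (edges H) \<ge> 1}"
  have fin: "finite ?\<H>" using finite_subhypergraphs[OF F1] by (rule finite_subset[rotated]) auto
  have F1in: "F1 \<in> ?\<H>" using F1 e by (auto simp: subhypergraph_def uniform_hypergraph_def)
  have "m \<in> (\<lambda>H. asym_dens k H F2) ` ?\<H>"
    unfolding m_def max_asym_dens_def using fin F1in by (intro Max_in) auto
  then obtain H where "H \<in> ?\<H>" "asym_dens k H F2 = m" by auto
  then have mF1: "asym_dens k F1 F2 = m" using sb unfolding strictly_balanced_def m_def by blast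
  have le: "asym_dens k H F2 \<le> m" if "H \<in> ?\<H>" for H
    unfolding m_def max_asym_dens_def using fin that by (intro Max_ge) auto
  \<comment> \<open>A nonempty edge set covers at least \<open>k\<close> vertices, so all
    denominators are positive.\<close>
  have cover: "k \<le> card (\<Union>E)" if E: "E \<subseteq> edges F1" "E \<noteq> {}" for E
  proof -
    obtain f where f: "f \<in> E" using E(2) by auto
    have "\<Union>E \<subseteq> verts F1" "finite (verts F1)" using F1 E(1) unfolding uniform_hypergraph_def by blast+
    then have "finite (\<Union>E)" by (rule finite_subset)
    then have "card f \<le> card (\<Union>E)" using f by (intro card_mono) auto
    moreover have "card f = k" using F1 E(1) f unfolding uniform_hypergraph_def by blast
    ultimately show ?thesis by simp
  qed
  have UV: "\<Union>(edges F1) \<subseteq> verts F1" and finV: "finite (verts F1)"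
    using F1 by (auto simp: uniform_hypergraph_def)
  have "edges F1 \<noteq> {}" using e by auto
  then have "k \<le> card (verts F1)" using cover[of "edges F1"] card_mono[OF finV UV] by simp
  then have den: "0 < real (card (verts F1)) - real k + m2'" using m2' by simp
  have mdef: "m = real (card (edges F1)) / (real (card (verts F1)) - real k + m2')"
    using mF1 by (simp add: asym_dens_def m2'_def)
  have m: "0 < m" using den e by (simp add: mdef)
  then show "0 < max_asym_dens k F1 F2" by (simp add: m_def)
  have eq: "real (card (edges F1)) / m = real (card (verts F1)) - real k + m2'"
    using den e by (simp add: mdef)
  then show "real (card (edges F1)) / max_asym_dens k F1 F2 =
           real (card (verts F1)) - real k + 1 / max_k_dens k F2" by (simp add: m_def m2'_def)
  have strict: "real (card E) / m < real (card (\<Union>E)) - real k + m2'"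
    if E: "E \<subseteq> edges F1" "E \<noteq> {}" and ne: "Hypergraph (\<Union>E) E \<noteq> F1" for E
  proof -
    let ?H = "Hypergraph (\<Union>E) E"
    have "finite E" using finite_edges[OF F1] E finite_subset by blast
    then have "0 < card E" using E by (simp add: card_gt_0_iff)
    then have H: "?H \<in> ?\<H>" using subhypergraph_spanned[OF E(1) F1] by simp
    then have "asym_dens k ?H F2 \<noteq> m" using sb ne unfolding strictly_balanced_def m_def by blast
    then have "asym_dens k ?H F2 < m" using le[OF H] by simp
    moreover have "0 < real (card (\<Union>E)) - real k + m2'" using cover[OF E] m2' by simp
    ultimately show ?thesis
      using m by (simp add: asym_dens_def m2'_def[symmetric] field_simps)
  qed
  show "real (card E) / max_asym_dens k F1 F2 < real (card (\<Union>E)) - real k + 1 / max_k_dens k F2"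
    if E: "E \<subset> edges F1" "E \<noteq> {}" for E
  proof -
    have "Hypergraph (\<Union>E) E \<noteq> F1" using E(1) by (metis hypergraph.sel(2) psubset_eq)
    with strict[of E] E show ?thesis by (simp add: m_def m2'_def psubset_imp_subset)
  qed
  show "\<Union>(edges F1) = verts F1"
  proof (rule ccontr)
    assume ne: "\<Union>(edges F1) \<noteq> verts F1"
    then have "Hypergraph (\<Union>(edges F1)) (edges F1) \<noteq> F1" by (metis hypergraph.sel(1))
    from strict[OF subset_refl \<open>edges F1 \<noteq> {}\<close> this] eq have "card (verts F1) < card (\<Union>(edges F1))" by simp
    then show False using card_mono[OF finV UV] by simp
  qed
qed

text \<open>Two intersecting edges cover at most \<open>2 * k - 1\<close> vertices and hence have
  \<open>k\<close>-density at least \<open>1 / (k - 1)\<close>. The exponent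
  \<open>k - 1 / max_k_dens k F\<close> is therefore at least 1.\<close>

lemma max_k_dens_intersecting:
  assumes F: "uniform_hypergraph k F" and e: "e \<in> edges F" "e' \<in> edges F" "e \<noteq> e'" "e \<inter> e' \<noteq> {}"
  shows "0 < max_k_dens k F" "1 / max_k_dens k F \<le> real k - 1"
proof -
  let ?H = "Hypergraph (\<Union>{e, e'}) {e, e'}"
  have c: "card e = k" "card e' = k" "finite e" "finite e'"
    using F e finite_subset by (auto simp: uniform_hypergraph_def)
  have gt: "k < card (e \<union> e')"
    using card_Union_edges_gt[OF F, of "{e, e'}"] e by simp
  have "0 < card (e \<inter> e')" using e c by (simp add: card_gt_0_iff)
  moreover have "card (e \<union> e') + card (e \<inter> e') = 2 * k" using card_Un_Int[OF c(3,4)] c by simp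
  ultimately have lt: "card (e \<union> e') < 2 * k" by linarith
  have "k_dens k ?H \<le> max_k_dens k F"
    unfolding max_k_dens_def
    using finite_subhypergraphs[OF F] subhypergraph_spanned[of "{e, e'}", OF _ F] e
    by (intro Max_ge) auto
  then have d: "1 / (real (card (e \<union> e')) - real k) \<le> max_k_dens k F"
    using e gt by (simp add: k_dens_def)
  have "0 < real (card (e \<union> e')) - real k" using gt by simp
  then show pos: "0 < max_k_dens k F" using d by (smt (verit) divide_pos_pos)
  have "1 / max_k_dens k F \<le> real (card (e \<union> e')) - real k"
    using d pos gt by (simp add: field_simps)
  also have "\<dots> \<le> real k - 1" using lt by linarith
  finally show "1 / max_k_dens k F \<le> real k - 1" .
qed

section \<open>Choice of constants and asymptotics\<close>

text \<open>\<open>a\<close> will be \<open>C ^ b\<close>: the left side collects the costs of the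
  encoding, the right side is Janson's gain. A square as witness makes \<open>ln (s\<^sup>2)\<close>
  at most \<open>2 * s\<close>, which \<open>s\<^sup>2\<close> dominates.\<close>

lemma linear_dominates_ln:
  fixes \<delta> M c :: real
  assumes "0 < \<delta>" "0 \<le> M"
  shows "\<exists>a\<ge>1. M * ln a + c \<le> \<delta> * a"
proof -
  define s where "s = max 1 ((2 * M + \<bar>c\<bar>) / \<delta>)"
  have s: "1 \<le> s" "(2 * M + \<bar>c\<bar>) / \<delta> \<le> s" by (auto simp: s_def)
  have "ln (s\<^sup>2) = 2 * ln s" using s by (simp add: ln_realpow)
  also have "\<dots> \<le> 2 * s" using ln_le_minus_one[of s] s by simp
  finally have "M * ln (s\<^sup>2) \<le> M * (2 * s)" using assms by (intro mult_left_mono)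
  moreover have "c \<le> \<bar>c\<bar> * s" using s by (metis abs_ge_self abs_ge_zero mult.right_neutral mult_left_mono order_trans)
  ultimately have "M * ln (s\<^sup>2) + c \<le> (2 * M + \<bar>c\<bar>) * s" by (simp add: algebra_simps)
  also have "\<dots> \<le> (\<delta> * s) * s" using s assms by (intro mult_right_mono) (auto simp: field_simps)
  finally have "M * ln (s\<^sup>2) + c \<le> \<delta> * s\<^sup>2" by (simp add: power2_eq_square)
  moreover have "1 \<le> s\<^sup>2" using s by simp
  ultimately show ?thesis by blast
qed

text \<open>With \<open>x\<close> for \<open>n powr \<kappa>\<close>, the 3 in the assumption on
  \<open>\<mu>\<close> pays for \<open>exp x\<close>, for the lower-order terms, and for a decay of
  \<open>exp (- x)\<close> that is left over.\<close>

lemma error_tendsto_0: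
  fixes \<kappa> \<epsilon> M a c \<mu> :: real and L b k :: nat
  assumes \<kappa>: "0 < \<kappa>" and \<epsilon>: "0 < \<epsilon>" and M: "0 < M" and a: "1 \<le> a"
    and \<mu>: "M * ln a + (3 + real L * real b * M * ln 2) \<le> \<mu>"
  defines "t \<equiv> \<lambda>n::nat. nat \<lfloor>M * real n powr \<kappa>\<rfloor>"
    and "q \<equiv> \<lambda>n::nat. nat \<lceil>real b * real n powr (\<kappa> - \<epsilon> / 2)\<rceil>"
    and "\<nu> \<equiv> \<lambda>n::nat. c * real n powr (\<kappa> - \<epsilon>)"
  shows "(\<lambda>n. \<nu> n / real n powr (\<kappa> - \<epsilon> / 2) + a ^ t n * exp (real n powr \<kappa>) * (real n ^ k + 1) ^ q n *
     2 ^ (L * (b * t n + q n)) * exp (- (\<mu> * real n powr \<kappa>) + \<nu> n)) \<longlonglongrightarrow> 0"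
proof -
  \<comment> \<open>The part of the exponent of smaller order than \<open>n powr \<kappa>\<close>:
    the cost of the \<open>q\<close> further elements and the overlap term. \<open>+ 1\<close> in
    the first factor comes from rounding \<open>q\<close> up, \<open>+ 1\<close> in
    \<open>real L + 1\<close> from \<open>n ^ k + 1 \<le> 2 * n ^ k\<close>.\<close>
  define R where "R = (\<lambda>n::nat. (real b * real n powr (\<kappa> - \<epsilon> / 2) + 1) *
      (real k * ln (real n) + (real L + 1) * ln 2) + c * real n powr (\<kappa> - \<epsilon>))"
  have l1: "(\<lambda>n::nat. real n powr (- \<epsilon> / 2) * ln (real n)) \<longlonglongrightarrow> 0" using \<epsilon> by real_asymp
  have l2: "(\<lambda>n::nat. real n powr (- \<epsilon> / 2)) \<longlonglongrightarrow> 0" using \<epsilon> by real_asymp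
  have l3: "(\<lambda>n::nat. real n powr (- \<kappa>) * ln (real n)) \<longlonglongrightarrow> 0" using \<kappa> by real_asymp
  have l4: "(\<lambda>n::nat. real n powr (- \<kappa>)) \<longlonglongrightarrow> 0" using \<kappa> by real_asymp
  have l5: "(\<lambda>n::nat. real n powr (- \<epsilon>)) \<longlonglongrightarrow> 0" using \<epsilon> by real_asymp
  have l6: "(\<lambda>n::nat. exp (- (real n powr \<kappa>))) \<longlonglongrightarrow> 0" using \<kappa> by real_asymp
  have Req: "R n / real n powr \<kappa> = real b * real k * (real n powr (- \<epsilon> / 2) * ln (real n)) +
      real b * ((real L + 1) * ln 2) * real n powr (- \<epsilon> / 2) + real k * (real n powr (- \<kappa>) * ln (real n)) +
      (real L + 1) * ln 2 * real n powr (- \<kappa>) + c * real n powr (- \<epsilon>)" if n: "1 \<le> n" for n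
  proof -
    have e1: "real n powr (\<kappa> - \<epsilon> / 2) = real n powr \<kappa> * real n powr (- \<epsilon> / 2)"
      by (simp add: powr_add[symmetric])
    have e2: "real n powr (\<kappa> - \<epsilon>) = real n powr \<kappa> * real n powr (- \<epsilon>)"
      by (simp add: powr_add[symmetric])
    have e3: "real n powr (- \<kappa>) = 1 / real n powr \<kappa>" by (simp add: powr_minus divide_inverse)
    have "0 < real n powr \<kappa>" using n by simp
    then show ?thesis unfolding R_def e1 e2 e3 by (simp add: field_simps)
  qed
  have "(\<lambda>n. real b * real k * (real n powr (- \<epsilon> / 2) * ln (real n)) +
      real b * ((real L + 1) * ln 2) * real n powr (- \<epsilon> / 2) + real k * (real n powr (- \<kappa>) * ln (real n)) +
      (real L + 1) * ln 2 * real n powr (- \<kappa>) + c * real n powr (- \<epsilon>)) \<longlonglongrightarrow>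
      real b * real k * 0 + real b * ((real L + 1) * ln 2) * 0 + real k * 0 + (real L + 1) * ln 2 * 0 + c * 0"
    by (intro tendsto_add tendsto_mult_left l1 l2 l3 l4 l5)
  then have "\<forall>\<^sub>F n in sequentially. real b * real k * (real n powr (- \<epsilon> / 2) * ln (real n)) +
      real b * ((real L + 1) * ln 2) * real n powr (- \<epsilon> / 2) + real k * (real n powr (- \<kappa>) * ln (real n)) +
      (real L + 1) * ln 2 * real n powr (- \<kappa>) + c * real n powr (- \<epsilon>) < 1"
    by (intro order_tendstoD) auto
  then have evR: "\<forall>\<^sub>F n in sequentially. R n \<le> real n powr \<kappa>"
    using eventually_ge_at_top[of 1]
  proof eventually_elim
    case (elim n)
    then have "R n / real n powr \<kappa> < 1" using Req[of n] by simp
    moreover have "0 < real n powr \<kappa>" using elim by simp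
    ultimately show ?case by (simp add: field_simps)
  qed
  have first: "(\<lambda>n. \<nu> n / real n powr (\<kappa> - \<epsilon> / 2)) \<longlonglongrightarrow> 0"
  proof -
    have "(\<lambda>n::nat. c * real n powr (- \<epsilon> / 2)) \<longlonglongrightarrow> c * 0" by (intro tendsto_mult_left l2)
    moreover have "\<forall>\<^sub>F n in sequentially. c * real n powr (- \<epsilon> / 2) = \<nu> n / real n powr (\<kappa> - \<epsilon> / 2)"
      using eventually_ge_at_top[of 1]
    proof eventually_elim
      case (elim n)
      have "real n powr (\<kappa> - \<epsilon>) = real n powr (- \<epsilon> / 2) * real n powr (\<kappa> - \<epsilon> / 2)"
        by (simp add: powr_add[symmetric])
      then show ?case using elim by (simp add: \<nu>_def)
    qed
    ultimately show ?thesis by (simp add: tendsto_cong)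
  qed
  let ?G = "\<lambda>n. a ^ t n * exp (real n powr \<kappa>) * (real n ^ k + 1) ^ q n *
     2 ^ (L * (b * t n + q n)) * exp (- (\<mu> * real n powr \<kappa>) + \<nu> n)"
  have bound: "\<forall>\<^sub>F n in sequentially. ?G n \<le> exp (- (real n powr \<kappa>))"
    using evR eventually_ge_at_top[of 1]
  proof eventually_elim
    case (elim n)
    let ?x = "real n powr \<kappa>"
    have n: "1 \<le> real n" using elim by simp
    have pw: "z ^ j = exp (real j * ln z)" if "0 < z" for z :: real and j
      using that by (simp add: exp_of_nat_mult)
    have nk: "0 < real n ^ k + 1" by (simp add: add_nonneg_pos)
    have t: "real (t n) \<le> M * ?x" unfolding t_def using M by (simp add: of_nat_floor)
    have q: "real (q n) \<le> real b * real n powr (\<kappa> - \<epsilon> / 2) + 1"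
    proof -
      have "0 \<le> real b * real n powr (\<kappa> - \<epsilon> / 2)" by simp
      then show ?thesis unfolding q_def by (simp add: of_nat_nat)
    qed
    have lnk: "ln (real n ^ k + 1) \<le> real k * ln (real n) + ln 2"
    proof -
      have "real n ^ k + 1 \<le> 2 * real n ^ k" using one_le_power[OF n, of k] by simp
      then have "ln (real n ^ k + 1) \<le> ln (2 * real n ^ k)" using n nk by (subst ln_le_cancel_iff) auto
      also have "\<dots> = real k * ln (real n) + ln 2" using n by (simp add: ln_mult ln_realpow)
      finally show ?thesis .
    qed
    have "?G n = exp (real (t n) * ln a + ?x + real (q n) * ln (real n ^ k + 1) +
        (real L * (real b * real (t n) + real (q n))) * ln 2 + (- (\<mu> * ?x) + \<nu> n))"
      using a nk by (simp add: pw exp_add)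
    also have "\<dots> \<le> exp (- ?x)"
    proof -
      have "real (t n) * ln a \<le> M * ?x * ln a" using t a by (intro mult_right_mono) auto
      moreover have "real L * real b * ln 2 * real (t n) \<le> real L * real b * ln 2 * (M * ?x)"
        using t by (intro mult_left_mono) auto
      moreover have "real (q n) * (ln (real n ^ k + 1) + real L * ln 2) \<le>
         (real b * real n powr (\<kappa> - \<epsilon> / 2) + 1) * (real k * ln (real n) + (real L + 1) * ln 2)"
        using q lnk n nk by (intro mult_mono) (auto simp: algebra_simps intro!: add_nonneg_nonneg)
      moreover have "(M * ln a + (3 + real L * real b * M * ln 2)) * ?x \<le> \<mu> * ?x"
        using \<mu> by (intro mult_right_mono) auto
      moreover have "R n \<le> ?x" by (rule elim)
      moreover have "0 \<le> ?x" by simp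
      ultimately have "real (t n) * ln a + ?x + real (q n) * ln (real n ^ k + 1) +
        (real L * (real b * real (t n) + real (q n))) * ln 2 + (- (\<mu> * ?x) + \<nu> n) \<le> - ?x"
        unfolding R_def \<nu>_def by (simp add: algebra_simps)
      then show ?thesis by simp
    qed
    finally show ?case .
  qed
  have second: "?G \<longlonglongrightarrow> 0"
    by (rule tendsto_sandwich[OF _ bound tendsto_const l6]) (use a in \<open>simp add: add_nonneg_nonneg\<close>)
  show ?thesis using tendsto_add[OF first second] by simp
qed

text \<open>Up to powers of \<open>C\<close>, an overlap in \<open>E\<close> contributes
  \<open>n powr (\<kappa> - (card (\<Union>E) - card E / m))\<close> extensions per copy, and the
  gap bounds this by \<open>n powr (- \<epsilon>)\<close>. One factor \<open>2 ^ b\<close> of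
  \<open>4 ^ b\<close>, \<open>b\<close> being the number of edges, counts images of
  \<open>E\<close>, the other the choices of \<open>E\<close>.\<close>

lemma overlap_sum_strictly_balanced:
  fixes F :: "'a hypergraph" and C m \<kappa> \<epsilon> :: real
  assumes F: "uniform_hypergraph k F" and m: "0 < m" and C: "1 \<le> C" and n: "1 \<le> n"
    and eq: "real (card (verts F)) - real (card (edges F)) / m = \<kappa>"
    and gap: "\<And>E. E \<subset> edges F \<Longrightarrow> E \<noteq> {} \<Longrightarrow>
      \<epsilon> \<le> real (card (\<Union>E)) - real (card E) / m - \<kappa>"
    and p: "p = C * real n powr (- 1 / m)" "p \<le> 1"
  shows "real n ^ card (verts F) * p ^ card (edges F) = C ^ card (edges F) * real n powr \<kappa>"
    and "(\<Sum>(B, B')\<in>overlapping (copies F n). p ^ card (B \<union> B')) \<le>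
      (C ^ card (edges F))\<^sup>2 * 4 ^ card (edges F) * real (card (verts F)) ^ card (verts F) *
      real n powr (\<kappa> - \<epsilon>)"
proof -
  define v b where "v = card (verts F)" and "b = card (edges F)"
  let ?P = "{E'. E' \<subset> edges F \<and> E' \<noteq> {}}"
  have finE: "finite (edges F)" by (rule finite_edges[OF F])
  have finV: "finite (verts F)" using F by (simp add: uniform_hypergraph_def)
  have p0: "0 \<le> p" using C by (simp add: p)
  have ppow: "p ^ j = C ^ j * real n powr (- real j / m)" for j
    using n by (simp add: p power_mult_distrib powr_realpow[symmetric] powr_powr)
  have npow: "real n ^ j = real n powr real j" for j using n by (simp add: powr_realpow)
  have "real n ^ v * p ^ b = C ^ b * (real n powr real v * real n powr (- real b / m))"
    by (simp add: ppow npow)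
  also have "real n powr real v * real n powr (- real b / m) = real n powr \<kappa>"
    using eq by (simp add: powr_add[symmetric] v_def b_def)
  finally have main: "real n ^ v * p ^ b = C ^ b * real n powr \<kappa>" .
  then show "real n ^ card (verts F) * p ^ card (edges F) = C ^ card (edges F) * real n powr \<kappa>"
    by (simp add: v_def b_def)
  have small: "real n ^ (v - card (\<Union>E)) * p ^ (b - card E) \<le> C ^ b * real n powr (- \<epsilon>)"
    if E: "E \<in> ?P" for E
  proof -
    have uv: "card (\<Union>E) \<le> v" unfolding v_def
      using E F by (intro card_mono[OF finV]) (auto simp: uniform_hypergraph_def)
    have jb: "card E \<le> b" unfolding b_def using E finE by (intro card_mono) auto
    have "real n ^ (v - card (\<Union>E)) * p ^ (b - card E) =
        C ^ (b - card E) * real n powr (real (v - card (\<Union>E)) + - real (b - card E) / m)"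
      by (simp only: ppow npow powr_add mult_ac)
    also have "real (v - card (\<Union>E)) + - real (b - card E) / m =
       \<kappa> - (real (card (\<Union>E)) - real (card E) / m)"
      using uv jb eq by (simp add: of_nat_diff v_def b_def diff_divide_distrib)
    also have "C ^ (b - card E) * real n powr (\<kappa> - (real (card (\<Union>E)) - real (card E) / m)) \<le>
       C ^ b * real n powr (- \<epsilon>)"
      using C n gap[of E] E by (intro mult_mono power_increasing powr_mono) auto
    finally show ?thesis .
  qed
  have "(\<Sum>(B, B')\<in>overlapping (copies F n). p ^ card (B \<union> B')) \<le>
    real n ^ v * p ^ b *
    (\<Sum>E'\<in>?P. 2 ^ b * real v ^ v * (real n ^ (v - card (\<Union>E')) * p ^ (b - card E')))"
    unfolding v_def b_def by (rule overlap_sum_le[OF F p0 p(2)])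
  also have "\<dots> \<le> real n ^ v * p ^ b * (\<Sum>E'\<in>?P. 2 ^ b * real v ^ v * (C ^ b * real n powr (- \<epsilon>)))"
    using small p0 by (intro mult_left_mono sum_mono) auto
  also have "\<dots> = real (card ?P) * (real n ^ v * p ^ b * (2 ^ b * real v ^ v * (C ^ b * real n powr (- \<epsilon>))))"
    by simp
  also have "\<dots> \<le> 2 ^ b * (real n ^ v * p ^ b * (2 ^ b * real v ^ v * (C ^ b * real n powr (- \<epsilon>))))"
  proof (rule mult_right_mono)
    have "card ?P \<le> card (Pow (edges F))" using finE by (intro card_mono) auto
    then have "card ?P \<le> 2 ^ b" using finE by (simp add: card_Pow b_def)
    then show "real (card ?P) \<le> 2 ^ b" by (metis of_nat_le_iff of_nat_numeral of_nat_power)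
  qed (use p0 C in auto)
  also have "\<dots> = (C ^ b)\<^sup>2 * (2 ^ b * 2 ^ b) * real v ^ v * (real n powr \<kappa> * real n powr (- \<epsilon>))"
    unfolding main by (simp add: power2_eq_square mult_ac)
  also have "\<dots> = (C ^ b)\<^sup>2 * 4 ^ b * real v ^ v * real n powr (\<kappa> - \<epsilon>)"
    by (simp add: powr_add[symmetric] power_mult_distrib[symmetric])
  finally show "(\<Sum>(B, B')\<in>overlapping (copies F n). p ^ card (B \<union> B')) \<le>
      (C ^ card (edges F))\<^sup>2 * 4 ^ card (edges F) * real (card (verts F)) ^ card (verts F) *
      real n powr (\<kappa> - \<epsilon>)" by (simp add: v_def b_def)
qed

theorem theorem1p5:
  fixes F :: "nat \<Rightarrow> 'a hypergraph" and r k :: nat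
  assumes "r \<ge> 2"
    and "\<And>i. i \<in> {1..r} \<Longrightarrow> uniform_hypergraph k (F i)"
    and "\<And>i. i \<in> {1..r} \<Longrightarrow> card (edges (F i)) \<ge> 1"
    and "\<And>i. i \<in> {1..<r} \<Longrightarrow> max_k_dens k (F i) \<ge> max_k_dens k (F (Suc i))"
    and "strictly_balanced k (F 1) (F 2)"
    and F2_max_degree: "\<exists>e\<in>edges (F 2). \<exists>e'\<in>edges (F 2). e \<noteq> e' \<and> e \<inter> e' \<noteq> {}"
  shows "\<exists>C>0. \<forall>p :: nat \<Rightarrow> real.
           (\<forall>n. 0 \<le> p n \<and> p n \<le> 1) \<longrightarrow>
           (\<forall>\<^sub>F n in sequentially.
              p n \<ge> C * real n powr (- 1 / max_asym_dens k (F 1) (F 2))) \<longrightarrow>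
           (\<lambda>n. measure_pmf.prob (binomial_hypergraph k n (p n)) {G. ramsey_arrow G r F})
             \<longlonglongrightarrow> 1"
proof -
  define m2 where "m2 = max_k_dens k (F 2)"
  define m where "m = max_asym_dens k (F 1) (F 2)"
  define v where "v = card (verts (F 1))"
  define b where "b = card (edges (F 1))"
  define \<kappa> where "\<kappa> = real k - 1 / m2"
  have F1: "uniform_hypergraph k (F 1)" and F2: "uniform_hypergraph k (F 2)"
    and b: "1 \<le> b" using assms(1-3) by (auto simp: b_def)
  from F2_max_degree obtain e e' where e: "e \<in> edges (F 2)" "e' \<in> edges (F 2)" "e \<noteq> e'" "e \<inter> e' \<noteq> {}"
    by blast
  \<comment> \<open>The two intersecting edges of \<open>F 2\<close> make \<open>\<kappa>\<close>
    positive, so that \<open>n powr \<kappa>\<close> tends to infinity.\<close>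
  have m2: "0 < m2" and \<kappa>: "0 < \<kappa>"
    using max_k_dens_intersecting[OF F2 e] by (auto simp: m2_def \<kappa>_def)
  have dens: "max_k_dens k (F i) \<le> m2" if "i \<in> {2..r}" for i
  proof -
    have "2 \<le> i" "i \<le> r" using that by auto
    then show ?thesis
    proof (induction i rule: dec_induct)
      case (step j)
      then have "max_k_dens k (F (Suc j)) \<le> max_k_dens k (F j)" using assms(4)[of j] by auto
      then show ?case using step by linarith
    qed (simp add: m2_def)
  qed
  note sb = strictly_balanced_strict[OF F1 _ assms(5), folded m_def m2_def v_def b_def, OF b m2]
  have "\<exists>\<delta>>0. \<exists>L. \<exists>M>0. \<exists>n0. \<forall>n\<ge>n0. \<exists>\<D>.
      complement_family r k F n \<delta> L (M * real n powr \<kappa>) \<D>"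
    unfolding \<kappa>_def by (rule colour_containers) (use assms(1-3) dens m2 in auto)
  then obtain \<delta> L M n0 where \<delta>: "0 < \<delta>" and M: "0 < M" and
    cont: "\<And>n. n0 \<le> n \<Longrightarrow> \<exists>\<D>. complement_family r k F n \<delta> L (M * real n powr \<kappa>) \<D>"
    by blast
  let ?P = "{E. E \<subset> edges (F 1) \<and> E \<noteq> {}}"
  define gap where "gap = (\<lambda>E :: 'a set set. real (card (\<Union>E)) - real (card E) / m - \<kappa>)"
  \<comment> \<open>The smallest gap over all ways of overlapping; the 1 covers a single edge, for
    which there are none.\<close>
  define \<epsilon> where "\<epsilon> = Min (insert 1 (gap ` ?P))"
  have finP: "finite ?P"
    by (rule finite_subset[of _ "Pow (edges (F 1))"]) (use finite_edges[OF F1] in auto)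
  have gap0: "0 < gap E" if "E \<in> ?P" for E using sb(3)[of E] that by (auto simp: gap_def \<kappa>_def)
  then have \<epsilon>: "0 < \<epsilon>" unfolding \<epsilon>_def using finP by (subst Min_gr_iff) auto
  have gap_ge: "\<epsilon> \<le> gap E" if "E \<in> ?P" for E unfolding \<epsilon>_def using finP that by (intro Min_le) auto
  define V where "V = real v ^ v"
  have V: "0 < V" unfolding V_def by (cases "v = 0") auto
  define \<delta>' where "\<delta>' = \<delta> / V"
  have \<delta>': "0 < \<delta>'" using \<delta> V by (simp add: \<delta>'_def)
  \<comment> \<open>\<open>\<delta>'\<close>, \<open>L\<close> and \<open>M\<close> come from
    supersaturation and containers and do not involve \<open>C\<close>, so \<open>a\<close> can be
    chosen after them; \<open>C\<close> is its \<open>b\<close>-th root.\<close>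
  obtain a where a: "1 \<le> a" "M * ln a + (3 + real L * real b * M * ln 2) \<le> \<delta>' * a"
    using linear_dominates_ln[OF \<delta>', of M] M by fastforce
  define C where "C = a powr (1 / real b)"
  have C: "1 \<le> C" unfolding C_def using a by (intro ge_one_powr_ge_zero) auto
  have Cb: "C ^ b = a" using a b C by (simp add: C_def powr_realpow[symmetric] powr_powr)
  define c where "c = a\<^sup>2 * 4 ^ b * V"
  define x where "x = (\<lambda>n::nat. real n powr \<kappa>)"
  \<comment> \<open>The geometric mean of \<open>n powr \<kappa>\<close> and
    \<open>n powr (\<kappa> - \<epsilon>)\<close>: large against the expected number of overlapping
    pairs, yet small enough to absorb a logarithm per listed edge.\<close>
  define y where "y = (\<lambda>n::nat. real n powr (\<kappa> - \<epsilon> / 2))"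
  define t where "t = (\<lambda>n::nat. nat \<lfloor>M * real n powr \<kappa>\<rfloor>)"
  define q where "q = (\<lambda>n::nat. nat \<lceil>real b * real n powr (\<kappa> - \<epsilon> / 2)\<rceil>)"
  define \<nu> where "\<nu> = (\<lambda>n::nat. c * real n powr (\<kappa> - \<epsilon>))"
  define err where "err = (\<lambda>n. \<nu> n / y n + a ^ t n * exp (x n) * (real n ^ k + 1) ^ q n *
     2 ^ (L * (b * t n + q n)) * exp (- (\<delta>' * a * x n) + \<nu> n))"
  have err: "err \<longlonglongrightarrow> 0"
    unfolding err_def \<nu>_def y_def x_def t_def q_def by (rule error_tendsto_0[OF \<kappa> \<epsilon> M a])
  \<comment> \<open>Only at the exact threshold density, because the expected number of copies must
    also be bounded above; larger densities follow by monotonicity.\<close>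
  have fail: "bexp (k_subsets k n) p (\<lambda>A. of_bool (\<not> ramsey_arrow (Hypergraph {..<n} A) r F)) \<le> err n"
    if n: "1 \<le> n" "n0 \<le> n" and p: "p = C * real n powr (- 1 / m)" "p \<le> 1" for n p
  proof -
    have p0: "0 \<le> p" using C by (simp add: p)
    have E: "finite (k_subsets k n)" by (rule finite_k_subsets)
    have eq: "real (card (verts (F 1))) - real (card (edges (F 1))) / m = \<kappa>"
      using sb(2) by (simp add: v_def b_def \<kappa>_def)
    have gap': "\<epsilon> \<le> real (card (\<Union>E)) - real (card E) / m - \<kappa>"
      if "E \<subset> edges (F 1)" "E \<noteq> {}" for E using gap_ge[of E] that by (simp add: gap_def)
    note os = overlap_sum_strictly_balanced[OF F1 sb(1) C n(1) eq gap' p, folded v_def b_def, unfolded Cb, folded V_def]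
    obtain \<D> where fam: "complement_family r k F n \<delta> L (M * real n powr \<kappa>) \<D>"
      using cont[OF n(2)] by blast
    note D = fam[unfolded complement_family_def]
    note D1 = D[THEN conjunct1, rule_format]
      and D2 = D[THEN conjunct2, THEN conjunct1, rule_format, folded v_def]
    have "bexp (k_subsets k n) p (\<lambda>A. of_bool (\<not> ramsey_arrow (Hypergraph {..<n} A) r F)) \<le>
      \<nu> n / y n + a ^ t n * exp (x n) * (real (card (k_subsets k n)) + 1) ^ q n *
        2 ^ (L * (b * t n + q n)) * exp (- (\<delta>' * a * x n) + \<nu> n)"
    proof (rule union_bound[OF E p0 p(2), where \<C> = "copies (F 1) n" and \<D> = \<D>])
      show "B \<subseteq> k_subsets k n \<and> card B = b" if "B \<in> copies (F 1) n" for B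
        using that copy_subset_k_subsets[OF F1] card_copy[OF F1] by (auto simp: copies_def b_def)
      show "finite (\<D> X) \<and> card (\<D> X) \<le> 2 ^ (L * card X)" if "finite X" for X by (rule D1[OF that])
      show "\<delta>' * a * x n \<le> real (card {B\<in>copies (F 1) n. B \<subseteq> D}) * p ^ b" if D: "D \<in> \<D> X" for X D
      proof -
        have "\<delta> * real n ^ v \<le> V * real (card {B\<in>copies (F 1) n. B \<subseteq> D})"
          using D2[OF D] card_copies_ge[OF F1 sb(4), of n D, folded v_def]
          unfolding V_def by (metis (no_types, lifting) of_nat_le_iff of_nat_mult of_nat_power order_trans)
        then have "\<delta>' * real n ^ v \<le> real (card {B\<in>copies (F 1) n. B \<subseteq> D})"
          using V by (simp add: \<delta>'_def field_simps)
        then have "\<delta>' * real n ^ v * p ^ b \<le> real (card {B\<in>copies (F 1) n. B \<subseteq> D}) * p ^ b"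
          using p0 by (intro mult_right_mono) auto
        moreover have "\<delta>' * real n ^ v * p ^ b = \<delta>' * a * x n" using os(1) by (simp add: x_def mult.assoc)
        ultimately show ?thesis by simp
      qed
      show "(\<Sum>(B, B')\<in>overlapping (copies (F 1) n). p ^ card (B \<union> B')) \<le> \<nu> n"
        unfolding \<nu>_def c_def by (rule os(2))
      show "1 \<le> a" by (rule a(1))
      show "0 \<le> x n" by (simp add: x_def)
      have "real (card (copies (F 1) n)) \<le> real n ^ v"
        using card_copies_le[OF F1, of n] unfolding v_def by (metis of_nat_le_iff of_nat_power)
      then have "real (card (copies (F 1) n)) * p ^ b \<le> real n ^ v * p ^ b"
        using p0 by (intro mult_right_mono) auto
      then show "real (card (copies (F 1) n)) * p ^ b \<le> a * x n" using os(1) by (simp add: x_def)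
      show "0 < y n" using n by (simp add: y_def)
      show "real b * y n \<le> real (q n)" unfolding y_def q_def by linarith
      show "\<exists>T. finite T \<and> card T \<le> t n \<and> (\<forall>e\<in>T. \<exists>B\<in>copies (F 1) n. e \<in> B \<and> B \<subseteq> A) \<and>
          (\<forall>X. finite X \<and> T \<subseteq> X \<longrightarrow> (\<exists>D\<in>\<D> X. \<forall>B\<in>copies (F 1) n. \<not> B \<subseteq> A \<inter> D))"
        if "A \<subseteq> k_subsets k n" "\<not> ramsey_arrow (Hypergraph {..<n} A) r F" for A
        unfolding t_def by (rule not_ramsey_arrow_fingerprint[OF assms(1,2) fam that])
    qed
    also have "\<dots> \<le> err n"
    proof -
      have "real (card (k_subsets k n)) \<le> real n ^ k"
        using card_k_subsets_le[of k n] by (metis of_nat_le_iff of_nat_power)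
      then have "(real (card (k_subsets k n)) + 1) ^ q n \<le> (real n ^ k + 1) ^ q n"
        by (intro power_mono) auto
      then show ?thesis unfolding err_def using a
        by (intro add_left_mono mult_right_mono mult_left_mono) auto
    qed
    finally show ?thesis .
  qed
  have "(\<lambda>n. measure_pmf.prob (binomial_hypergraph k n (p n)) {G. ramsey_arrow G r F}) \<longlonglongrightarrow> 1"
    if p01: "\<forall>n. 0 \<le> p n \<and> p n \<le> 1"
      and large: "\<forall>\<^sub>F n in sequentially. C * real n powr (- 1 / m) \<le> p n" for p :: "nat \<Rightarrow> real"
  proof (rule tendsto_sandwich)
    show "\<forall>\<^sub>F n in sequentially. 1 - err n \<le>
        measure_pmf.prob (binomial_hypergraph k n (p n)) {G. ramsey_arrow G r F}"
      using large eventually_ge_at_top[of "max 1 n0"]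
    proof eventually_elim
      case (elim n)
      define p0 where "p0 = C * real n powr (- 1 / m)"
      let ?R = "\<lambda>A. ramsey_arrow (Hypergraph {..<n} A) r F"
      let ?E = "k_subsets k n"
      have p: "0 \<le> p n" "p n \<le> 1" using p01 by auto
      have p0: "0 \<le> p0" "p0 \<le> p n" "p0 \<le> 1" using elim p C by (auto simp: p0_def)
      have "1 - err n \<le> 1 - bexp ?E p0 (\<lambda>A. of_bool (\<not> ?R A))"
        using fail[of n p0] elim p0 by (simp add: p0_def)
      also have "\<dots> = bexp ?E p0 (\<lambda>A. 1 - of_bool (\<not> ?R A))"
        by (simp only: bexp_diff bexp_const[OF finite_k_subsets])
      also have "\<dots> = bexp ?E p0 (\<lambda>A. of_bool (?R A))" by (rule bexp_cong) simp
      also have "\<dots> \<le> bexp ?E (p n) (\<lambda>A. of_bool (?R A))"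
        by (rule bexp_mono_prob[OF finite_k_subsets p0(1,2) p(2)])
           (auto intro!: monoI intro: ramsey_arrow_mono)
      also have "\<dots> = measure_pmf.prob (binomial_hypergraph k n (p n)) {G. ramsey_arrow G r F}"
        by (rule prob_binomial_hypergraph[OF p, symmetric])
      finally show ?case .
    qed
    show "(\<lambda>n. 1 - err n) \<longlonglongrightarrow> 1" using tendsto_diff[OF tendsto_const err, of 1] by simp
  qed auto
  then show ?thesis using C unfolding m_def by (intro exI[of _ C]) auto
qed

end
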